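(* Let $d\ge 2$, $p\ge1$, $q\in[0,p)$. Let $\Omega\subset\mathbb{R}^d$ be a bounded open set with Lipschitz boundary, and let $\rho\in C^1(\Omega)\cap C^0(\overline\Omega)$ be a probability density on $\Omega$ with $0<c\le \rho(x)\le C<\infty$ for all $x\in\overline\Omega$. Let $\zeta$ and $\eta$ satisfy (A1)-(A3) and (B1)-(B2) (see context). Let $\{x_i\}_{i\in\mathbb{N}}$ be i.i.d. random points with density $\rho$, let $\mu_n=\frac1n\sum_{i=1}^n\delta_{x_i}$, and let $\{\varepsilon_n\}$ be positive numbers converging to $0$ with $\lim_{n\to\infty}\frac{(\log n)^{1/d}}{\varepsilon_n n^{1/d}}=0$. Then, almost surely, the following holds: if $u_n\in L^\infty(\Omega;\mu_n)$, $n\in\mathbb{N}$, satisfy $$\sup_{n\in\mathbb{N}}\big\{\|u_n\|_{L^\infty(\mu_n)}+\mathcal{GMS}_{\varepsilon_n,n}(u_n)\big\}<\infty,$$ then the sequence $\{(\mu_n,u_n)\}_{n\in\mathbb{N}}$ is relatively compact in $TL^1$.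
   Context: Assumptions on $\zeta:[0,\infty)\to[0,\infty)$: (A1) $\zeta$ is concave and differentiable at $0$, with $\zeta(0)=0$; (A2) $\zeta$ is nondecreasing; (A3) $0<\zeta'(0)<\infty$ and $\Theta:=\lim_{x\to\infty}\zeta(x)<\infty$. Assumptions on the kernel $\eta:[0,\infty)\to[0,\infty)$: (B1) $\eta$ is a nonincreasing $L^1$ function, not identically $0$; (B2) $0<\int_0^\infty (t^d+t^{p-q+d-1})\eta(t)\,dt<\infty$. For $\varepsilon>0$, $\eta_\varepsilon(s):=\varepsilon^{-d}\eta(s/\varepsilon)$. For $u:\{x_1,\dots,x_n\}\to\mathbb{R}$, $$\mathcal{GMS}_{\varepsilon,n}(u):=\frac1\varepsilon\frac1{n^2}\sum_{i,j=1}^n\zeta\Big(\varepsilon^{1-p+q}\frac{|u(x_i)-u(x_j)|^p}{|x_i-x_j|^q}\Big)\eta_\varepsilon(|x_i-x_j|),$$ where the diagonal terms $i=j$ are taken to be $0$. $TL^1$: the set of pairs $(\nu,g)$ with $\nu$ a Borel probability measure on $\overline\Omega$ and $g\in L^1(\nu)$, with metric $d_{TL^1}((\nu,g),(\nu',g'))=\inf_\pi\int |x-y|+|g(x)-g'(y)|\,d\pi(x,y)$, the infimum being over couplings $\pi$ of $\nu$ and $\nu'$. Relatively compact means that every subsequence has a further subsequence converging in $TL^1$. *)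

theory Defs
  imports "HOL-Probability.Probability"
begin

text \<open>Euclidean space $R^d$ is a type of class \<^class>\<open>euclidean_space\<close>, with $d$ = \<open>DIM('a)\<close>.\<close>

text \<open>Near each boundary point the domain is the strict epigraph of a Lipschitz function over the
  hyperplane orthogonal to a unit vector \<open>e\<close>, i.e. of a Lipschitz function of $d-1$ variables in a
  rotated orthonormal coordinate system.\<close>

definition lipschitz_boundary :: "'a::euclidean_space set \<Rightarrow> bool" where
  "lipschitz_boundary \<Omega> \<longleftrightarrow>
     (\<forall>x\<in>frontier \<Omega>. \<exists>r>0. \<exists>e \<gamma> L. norm e = 1 \<and> L-lipschitz_on {y. y \<bullet> e = 0} \<gamma> \<and>
        \<Omega> \<inter> ball x r = {y \<in> ball x r. \<gamma> (y - (y \<bullet> e) *\<^sub>R e) < y \<bullet> e})"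

definition C1_on :: "'a::euclidean_space set \<Rightarrow> ('a \<Rightarrow> real) \<Rightarrow> bool" where
  "C1_on \<Omega> f \<longleftrightarrow> (\<exists>g. continuous_on \<Omega> g \<and> (\<forall>x\<in>\<Omega>. GDERIV f x :> g x))"

text \<open>Functions on $[0,\infty)$ are total functions on the reals of which only the values on
  \<open>{0..}\<close> matter; the derivative at $0$ is accordingly one-sided.\<close>

definition admissible_zeta :: "(real \<Rightarrow> real) \<Rightarrow> bool" where
  "admissible_zeta \<zeta> \<longleftrightarrow>
     (\<forall>x\<ge>0. 0 \<le> \<zeta> x) \<and>
     concave_on {0..} \<zeta> \<and> \<zeta> 0 = 0 \<and>
     mono_on {0..} \<zeta> \<and>
     (\<exists>D>0. (\<zeta> has_real_derivative D) (at 0 within {0..})) \<and>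
     (\<exists>\<Theta>. (\<zeta> \<longlongrightarrow> \<Theta>) at_top)"

definition admissible_kernel :: "nat \<Rightarrow> real \<Rightarrow> real \<Rightarrow> (real \<Rightarrow> real) \<Rightarrow> bool" where
  "admissible_kernel d p q \<eta> \<longleftrightarrow>
     (\<forall>t\<ge>0. 0 \<le> \<eta> t) \<and>
     antimono_on {0..} \<eta> \<and> set_integrable lborel {0..} \<eta> \<and> (\<exists>t\<ge>0. \<eta> t \<noteq> 0) \<and>
     0 < (\<integral>\<^sup>+t\<in>{0..}. ennreal ((t ^ d + t powr (p - q + real d - 1)) * \<eta> t) \<partial>lborel) \<and>
     (\<integral>\<^sup>+t\<in>{0..}. ennreal ((t ^ d + t powr (p - q + real d - 1)) * \<eta> t) \<partial>lborel) < \<infinity>"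

definition rescaled_kernel :: "nat \<Rightarrow> (real \<Rightarrow> real) \<Rightarrow> real \<Rightarrow> real \<Rightarrow> real" where
  "rescaled_kernel d \<eta> \<epsilon> s = \<eta> (s / \<epsilon>) / \<epsilon> ^ d"

text \<open>The first $n$ points of a sequence are \<open>x 0, \<dots>, x (n - 1)\<close>. Off-diagonal terms with
  coinciding points vanish because of \<open>0 powr p = 0\<close> and \<open>\<zeta> 0 = 0\<close>.\<close>

definition GMS ::
  "real \<Rightarrow> real \<Rightarrow> (real \<Rightarrow> real) \<Rightarrow> (real \<Rightarrow> real) \<Rightarrow> (nat \<Rightarrow> 'a::euclidean_space) \<Rightarrow>
   real \<Rightarrow> nat \<Rightarrow> ('a \<Rightarrow> real) \<Rightarrow> real" where
  "GMS p q \<zeta> \<eta> x \<epsilon> n u =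
     1 / \<epsilon> * (1 / (real n)\<^sup>2) *
       (\<Sum>i<n. \<Sum>j<n. if i = j then 0 else
          \<zeta> (\<epsilon> powr (1 - p + q) * (\<bar>u (x i) - u (x j)\<bar> powr p / norm (x i - x j) powr q)) *
          rescaled_kernel DIM('a) \<eta> \<epsilon> (norm (x i - x j)))"

definition empirical_measure :: "(nat \<Rightarrow> 'a::euclidean_space) \<Rightarrow> nat \<Rightarrow> 'a measure" where
  "empirical_measure x n = distr (uniform_count_measure {..<n}) borel x"

lemma emeasure_empirical_measure:
  assumes "n \<ge> 1" "A \<in> sets borel"
  shows "emeasure (empirical_measure x n) A = ennreal (1 / real n * (\<Sum>i<n. indicator A (x i)))"
proof -
  have m: "x \<in> measurable (uniform_count_measure {..<n}) borel"
    by (auto simp: measurable_def sets_uniform_count_measure space_uniform_count_measure)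
  have c: "(\<Sum>i<n. indicator A (x i) :: real) = real (card (x -` A \<inter> {..<n}))"
  proof -
    have "(\<Sum>i<n. indicator A (x i) :: real) = (\<Sum>i<n. indicator (x -` A) i)"
      by (simp add: indicator_def)
    also have "\<dots> = real (card ({..<n} \<inter> x -` A))"
      by (simp add: indicator_def of_bool_def sum.If_cases vimage_def)
    finally show ?thesis by (simp add: Int_commute)
  qed
  show ?thesis
    unfolding empirical_measure_def emeasure_distr[OF m assms(2)] space_uniform_count_measure c
    by (subst emeasure_uniform_count_measure) (auto simp: divide_inverse mult.commute)
qed

definition Linf_norm :: "'a measure \<Rightarrow> ('a \<Rightarrow> real) \<Rightarrow> ereal" where
  "Linf_norm M u = esssup M (\<lambda>x. ereal \<bar>u x\<bar>)"

definition Linf :: "'a measure \<Rightarrow> ('a \<Rightarrow> real) set" where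
  "Linf M = {u \<in> borel_measurable M. Linf_norm M u < \<infinity>}"

definition couplings ::
  "'a::euclidean_space measure \<Rightarrow> 'a measure \<Rightarrow> ('a \<times> 'a) measure set" where
  "couplings \<nu> \<nu>' = {\<pi>. sets \<pi> = sets (borel \<Otimes>\<^sub>M borel) \<and>
                      distr \<pi> borel fst = \<nu> \<and> distr \<pi> borel snd = \<nu>'}"

text \<open>A Borel probability measure on the closure of \<open>\<Omega>\<close> is represented by a Borel probability
  measure on the whole space that is concentrated on that closure, and an $L^1$ class by any of its
  representatives.\<close>

definition TL1 :: "'a::euclidean_space set \<Rightarrow> ('a measure \<times> ('a \<Rightarrow> real)) set" where
  "TL1 \<Omega> = {(\<nu>, g). prob_space \<nu> \<and> sets \<nu> = sets borel \<and> (AE x in \<nu>. x \<in> closure \<Omega>) \<and>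
                    integrable \<nu> g}"

definition TL1_dist ::
  "'a::euclidean_space measure \<times> ('a \<Rightarrow> real) \<Rightarrow> 'a measure \<times> ('a \<Rightarrow> real) \<Rightarrow> ennreal" where
  "TL1_dist z z' =
     (INF \<pi>\<in>couplings (fst z) (fst z').
        \<integral>\<^sup>+(x, y). ennreal (norm (x - y) + \<bar>snd z x - snd z' y\<bar>) \<partial>\<pi>)"

definition TL1_relatively_compact ::
  "'a::euclidean_space set \<Rightarrow> (nat \<Rightarrow> 'a measure \<times> ('a \<Rightarrow> real)) \<Rightarrow> bool" where
  "TL1_relatively_compact \<Omega> z \<longleftrightarrow>
     (\<forall>n. z n \<in> TL1 \<Omega>) \<and>
     (\<forall>r::nat \<Rightarrow> nat. strict_mono r \<longrightarrow>
        (\<exists>s::nat \<Rightarrow> nat. strict_mono s \<and>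
           (\<exists>w\<in>TL1 \<Omega>. (\<lambda>k. TL1_dist (z (r (s k))) w) \<longlonglongrightarrow> 0)))"

end

theory Submission
  imports Defs "HOL-Library.Diagonal_Subsequence"
begin

text \<open>Concavity of \<open>\<zeta>\<close> and monotonicity of \<open>\<eta>\<close> turn the energy bound, for functions bounded by \<open>M\<close>, into a
  bound of order \<open>n\<^sup>2 \<epsilon>\<^sup>d\<^sup>+\<^sup>1\<close> on the sum of \<open>\<bar>u x\<^sub>i - u x\<^sub>j\<bar>\<close> over the pairs at distance at most \<open>r \<epsilon>\<close>.
  Almost surely, every dyadic cube in \<open>\<Omega>\<close> of side comparable to \<open>\<epsilon>\<close> contains a number of sample points
  comparable to \<open>n \<epsilon>\<^sup>d\<close> (Chernoff, union bound, Borel-Cantelli), so a Poincare inequality on the grid of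
  these small cubes shows that \<open>u\<close> differs in $L^1(\mu_n)$ by at most a constant times \<open>2\<^sup>-\<^sup>k\<close> from its means over the dyadic
  cubes of level \<open>k\<close> contained in \<open>\<Omega>\<close>. The remaining boundary layer has mass tending to 0 as \<open>k\<close> grows and
  \<open>u\<close> is bounded there, so nothing has to be proved near the boundary. Along a diagonal subsequence all
  these means converge; the resulting step functions are Cauchy in $L^1(\mu)$, and a
  coupling of $\mu_n$ and $\mu$ that keeps almost all mass within the cells of level \<open>k\<close> gives
  convergence in $TL^1$ to their limit.\<close>

section \<open>A Poincare inequality on the discrete grid\<close>

text \<open>Since \<open>\<zeta>\<close> saturates, a large jump is charged only a bounded amount;
  the uniform bound on \<open>u\<close> lets this charge dominate the first power of the increment.
  The exponents then balance. With \<open>N = 2 ^ (m - k)\<close> small cubes per side of a cube of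
  level \<open>k\<close>, the Poincare inequality costs \<open>N ^ (d + 1)\<close>; dividing by the
  roughly \<open>n / 2 ^ (k * d)\<close> points of a cube turns the energy bound into
  \<open>n * 2 ^ (k * d) * (N * \<epsilon>) ^ (d + 1)\<close>, which is of order
  \<open>n / 2 ^ k\<close> because \<open>N * \<epsilon>\<close> is of order
  \<open>1 / 2 ^ k\<close>. The point counts have to hold in all small cubes at once, whose number
  is of order \<open>\<epsilon> ^ - d\<close>; this is where \<open>n * \<epsilon> ^ d\<close> must
  dominate \<open>ln n\<close>. The exceptional null set must not depend on \<open>u\<close>, so
  everything asked of the sample concerns sets fixed in advance, and the rest is deterministic. The
  step functions of two levels are compared through the frequencies of the intersections of their
  cells: these pass to the limit, whereas the \<open>u n\<close> live on varying measures and have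
  no common space in which to converge.\<close>

definition adjacent :: "'i set \<Rightarrow> ('i \<Rightarrow> nat) \<Rightarrow> ('i \<Rightarrow> nat) \<Rightarrow> bool" where
  "adjacent B s t \<longleftrightarrow> (\<forall>b\<in>B. s b \<le> Suc (t b) \<and> t b \<le> Suc (s b))"

lemma sum_PiE_insert:
  fixes h :: "('i \<Rightarrow> 'b) \<Rightarrow> 'c::comm_monoid_add"
  assumes "j \<notin> B"
  shows "(\<Sum>s\<in>PiE (insert j B) (\<lambda>_. S). h s) = (\<Sum>y\<in>S. \<Sum>g\<in>PiE B (\<lambda>_. S). h (g(j := y)))"
proof -
  have "(\<Sum>s\<in>PiE (insert j B) (\<lambda>_. S). h s)
      = (\<Sum>z\<in>S \<times> PiE B (\<lambda>_. S). h ((\<lambda>(y, g). g(j := y)) z))"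
    unfolding PiE_insert_eq using inj_combinator[OF assms, of "\<lambda>_. S"]
    by (subst sum.reindex) (auto simp: o_def)
  also have "\<dots> = (\<Sum>y\<in>S. \<Sum>g\<in>PiE B (\<lambda>_. S). h (g(j := y)))"
    by (simp add: sum.cartesian_product case_prod_unfold)
  finally show ?thesis .
qed

text \<open>Iterated triangle inequality along the integers from \<open>a\<close> to
  \<open>b\<close>. \<open>G\<close> need not vanish on the diagonal, hence the summand
  \<open>G a a\<close> at the start of the chain and the diagonal terms on the right, which the
  condition on \<open>c\<close> and \<open>e\<close> includes.\<close>

lemma chain_le_sum_adjacent:
  fixes G :: "nat \<Rightarrow> nat \<Rightarrow> real"
  assumes nn: "\<And>a b. a < N \<Longrightarrow> b < N \<Longrightarrow> 0 \<le> G a b"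
    and sym: "\<And>a b. a < N \<Longrightarrow> b < N \<Longrightarrow> G a b = G b a"
    and tri: "\<And>a b e. a < N \<Longrightarrow> b < N \<Longrightarrow> e < N \<Longrightarrow> G a b \<le> G a e + G e b"
    and "a < N" "b < N"
  shows "G a b \<le> (\<Sum>c<N. \<Sum>e<N. if c \<le> Suc e \<and> e \<le> Suc c then G c e else 0)"
proof -
  have main: "G a b \<le> (\<Sum>c<N. \<Sum>e<N. if c \<le> Suc e \<and> e \<le> Suc c then G c e else 0)"
    if "a \<le> b" "b < N" for a b
  proof -
    have "G a b \<le> G a a + (\<Sum>c=a..<b. G c (Suc c))"
      using that
    proof (induction b rule: dec_induct)
      case (step b)
      have "G a (Suc b) \<le> G a b + G b (Suc b)" using step by (intro tri) auto
      then show ?case using step by simp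
    qed simp
    \<comment> \<open>The chain is distributed over the rows of the double sum: row \<open>c\<close>
      pays for the step from \<open>c\<close> to \<open>Suc c\<close>, and row \<open>a\<close> pays
      also for \<open>G a a\<close>.\<close>
    also have "\<dots> \<le> (\<Sum>c=a..b. G a a * of_bool (c = a) + G c (Suc c) * of_bool (c < b))"
    proof -
      have "(\<Sum>c=a..b. G a a * of_bool (c = a)) = G a a"
        using that by (simp add: of_bool_def if_distrib cong: if_cong)
      moreover have "(\<Sum>c=a..b. G c (Suc c) * of_bool (c < b)) = (\<Sum>c=a..<b. G c (Suc c))"
        by (rule sum.mono_neutral_cong_right) auto
      ultimately show ?thesis by (simp add: sum.distrib)
    qed
    also have "\<dots> \<le> (\<Sum>c=a..b. \<Sum>e<N. if c \<le> Suc e \<and> e \<le> Suc c then G c e else 0)"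
    proof (rule sum_mono)
      fix c assume c: "c \<in> {a..b}"
      have cN: "c < N" using c that by auto
      have "G a a * of_bool (c = a) + G c (Suc c) * of_bool (c < b)
          \<le> (\<Sum>e\<in>{c, Suc c} \<inter> {..<N}. if c \<le> Suc e \<and> e \<le> Suc c then G c e else 0)"
      proof (cases "c < b")
        case True
        then have "{c, Suc c} \<inter> {..<N} = {c, Suc c}" using that by auto
        then show ?thesis using True that cN nn[of c c] by (auto simp: of_bool_def)
      next
        case False
        then have "G a a * of_bool (c = a) + G c (Suc c) * of_bool (c < b) \<le> G c c"
          using nn[of c c] cN by (auto simp: of_bool_def)
        also have "\<dots> = (\<Sum>e\<in>{c}. if c \<le> Suc e \<and> e \<le> Suc c then G c e else 0)" by simp
        also have "\<dots> \<le> (\<Sum>e\<in>{c, Suc c} \<inter> {..<N}. if c \<le> Suc e \<and> e \<le> Suc c then G c e else 0)"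
          using cN nn by (intro sum_mono2) auto
        finally show ?thesis .
      qed
      also have "\<dots> \<le> (\<Sum>e<N. if c \<le> Suc e \<and> e \<le> Suc c then G c e else 0)"
        using cN nn by (intro sum_mono2) auto
      finally show "G a a * of_bool (c = a) + G c (Suc c) * of_bool (c < b) \<le> \<dots>" .
    qed
    also have "\<dots> \<le> (\<Sum>c<N. \<Sum>e<N. if c \<le> Suc e \<and> e \<le> Suc c then G c e else 0)"
      using that nn by (intro sum_mono2 sum_nonneg) auto
    finally show ?thesis .
  qed
  show ?thesis
    using main[of a b] main[of b a] sym[of a b] assms(4,5) by (cases "a \<le> b") auto
qed

text \<open>The straight canonical path from \<open>s\<close> to \<open>t\<close> changes
  one coordinate at a time, which is the induction on the index set.\<close>

lemma grid_poincare:
  fixes F :: "('i \<Rightarrow> nat) \<Rightarrow> ('i \<Rightarrow> nat) \<Rightarrow> real"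
  assumes "finite B" "N \<ge> 1"
    and "\<And>s t. s \<in> B \<rightarrow>\<^sub>E {..<N} \<Longrightarrow> t \<in> B \<rightarrow>\<^sub>E {..<N} \<Longrightarrow> 0 \<le> F s t"
    and "\<And>s t. s \<in> B \<rightarrow>\<^sub>E {..<N} \<Longrightarrow> t \<in> B \<rightarrow>\<^sub>E {..<N} \<Longrightarrow> F s t = F t s"
    and "\<And>s t w. s \<in> B \<rightarrow>\<^sub>E {..<N} \<Longrightarrow> t \<in> B \<rightarrow>\<^sub>E {..<N} \<Longrightarrow> w \<in> B \<rightarrow>\<^sub>E {..<N} \<Longrightarrow>
           F s t \<le> F s w + F w t"
  shows "(\<Sum>s\<in>B \<rightarrow>\<^sub>E {..<N}. \<Sum>t\<in>B \<rightarrow>\<^sub>E {..<N}. F s t)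
       \<le> real (card B + 1) * real N ^ (card B + 1) *
         (\<Sum>s\<in>B \<rightarrow>\<^sub>E {..<N}. \<Sum>t\<in>B \<rightarrow>\<^sub>E {..<N}. if adjacent B s t then F s t else 0)"
  using assms
proof (induction B arbitrary: F rule: finite_induct)
  case empty
  \<comment> \<open>There is one multi-index, adjacent to itself, and the factor \<open>N\<close> is
    at least 1.\<close>
  then show ?case
    by (simp add: adjacent_def mult_le_cancel_right1)
next
  case (insert j B)
  let ?T = "B \<rightarrow>\<^sub>E {..<N}" and ?T' = "insert j B \<rightarrow>\<^sub>E {..<N}"
  have upd: "s(j := a) \<in> ?T'" if "s \<in> ?T" "a < N" for s a
    using that insert.hyps by (auto simp: PiE_iff extensional_def)
  have fT: "finite ?T" using insert.hyps by (intro finite_PiE) auto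
  have cT: "card ?T = N ^ card B" using insert.hyps by (simp add: card_PiE)
  define E where "E = (\<Sum>s\<in>?T'. \<Sum>t\<in>?T'. if adjacent (insert j B) s t then F s t else 0)"
  have E: "E = (\<Sum>a<N. \<Sum>s\<in>?T. \<Sum>b<N. \<Sum>t\<in>?T.
      if adjacent B s t \<and> a \<le> Suc b \<and> b \<le> Suc a then F (s(j := a)) (t(j := b)) else 0)"
  proof -
    have "adjacent (insert j B) (s(j := a)) (t(j := b)) \<longleftrightarrow>
        adjacent B s t \<and> a \<le> Suc b \<and> b \<le> Suc a" for s t :: "'i \<Rightarrow> nat" and a b
      using insert.hyps by (auto simp: adjacent_def)
    then show ?thesis unfolding E_def sum_PiE_insert[OF insert.hyps(2)] by simp
  qed
  have nn: "0 \<le> F (s(j := a)) (t(j := b))" if "s \<in> ?T" "t \<in> ?T" "a < N" "b < N" for s t a b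
    using that by (intro insert.prems(2) upd)
  have sy: "F (s(j := a)) (t(j := b)) = F (t(j := b)) (s(j := a))"
    if "s \<in> ?T" "t \<in> ?T" "a < N" "b < N" for s t a b
    using that by (intro insert.prems(3) upd)
  have tr: "F (s(j := a)) (t(j := b)) \<le> F (s(j := a)) (w(j := e)) + F (w(j := e)) (t(j := b))"
    if "s \<in> ?T" "t \<in> ?T" "w \<in> ?T" "a < N" "b < N" "e < N" for s t w a b e
    using that by (intro insert.prems(4) upd)
  \<comment> \<open>\<open>E1\<close> keeps the pairs of the grid that agree in coordinate
    \<open>j\<close>, \<open>E2\<close> those that agree outside \<open>j\<close>; these are the two
    kinds of legs of the path below.\<close>
  have E1: "(\<Sum>a<N. \<Sum>s\<in>?T. \<Sum>t\<in>?T. if adjacent B s t then F (s(j := a)) (t(j := a)) else 0) \<le> E"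
    unfolding E
  proof (intro sum_mono)
    fix a s assume as: "a \<in> {..<N}" "s \<in> ?T"
    have "(\<Sum>t\<in>?T. if adjacent B s t then F (s(j := a)) (t(j := a)) else 0)
      = (\<Sum>t\<in>?T. if adjacent B s t \<and> a \<le> Suc a \<and> a \<le> Suc a then F (s(j := a)) (t(j := a)) else 0)"
      by simp
    also have "\<dots> \<le> (\<Sum>b<N. \<Sum>t\<in>?T. if adjacent B s t \<and> a \<le> Suc b \<and> b \<le> Suc a
            then F (s(j := a)) (t(j := b)) else 0)"
      using as upd
      by (intro member_le_sum[where f="\<lambda>b. \<Sum>t\<in>?T. if adjacent B s t \<and> a \<le> Suc b \<and> b \<le> Suc a
            then F (s(j := a)) (t(j := b)) else 0"]) (auto intro!: sum_nonneg nn)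
    finally show "(\<Sum>t\<in>?T. if adjacent B s t then F (s(j := a)) (t(j := a)) else 0) \<le> \<dots>" .
  qed
  have E2: "(\<Sum>a<N. \<Sum>s\<in>?T. \<Sum>b<N. if a \<le> Suc b \<and> b \<le> Suc a then F (s(j := a)) (s(j := b)) else 0) \<le> E"
    unfolding E
  proof (intro sum_mono)
    fix a s b assume as: "a \<in> {..<N}" "s \<in> ?T" "b \<in> {..<N}"
    have "adjacent B s s" by (auto simp: adjacent_def)
    then have "(if a \<le> Suc b \<and> b \<le> Suc a then F (s(j := a)) (s(j := b)) else 0)
      = (if adjacent B s s \<and> a \<le> Suc b \<and> b \<le> Suc a then F (s(j := a)) (s(j := b)) else 0)" by simp
    also have "\<dots> \<le> (\<Sum>t\<in>?T. if adjacent B s t \<and> a \<le> Suc b \<and> b \<le> Suc a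
            then F (s(j := a)) (t(j := b)) else 0)"
      using as upd fT
      by (intro member_le_sum[where f="\<lambda>t. if adjacent B s t \<and> a \<le> Suc b \<and> b \<le> Suc a
            then F (s(j := a)) (t(j := b)) else 0"]) (auto intro!: nn)
    finally show "(if a \<le> Suc b \<and> b \<le> Suc a then F (s(j := a)) (s(j := b)) else 0) \<le> \<dots>" .
  qed
  have "(\<Sum>s\<in>?T'. \<Sum>t\<in>?T'. F s t)
      = (\<Sum>a<N. \<Sum>s\<in>?T. \<Sum>b<N. \<Sum>t\<in>?T. F (s(j := a)) (t(j := b)))"
    unfolding sum_PiE_insert[OF insert.hyps(2)] ..
  \<comment> \<open>The intermediate point is \<open>t(j := a)\<close>: the first leg moves only in
    \<open>B\<close>, the second only in coordinate \<open>j\<close>. The first does not depend on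
    \<open>b\<close> and the second not on \<open>s\<close>, which gives the factors
    \<open>N\<close> and \<open>N ^ card B\<close>.\<close>
  also have "\<dots> \<le> (\<Sum>a<N. \<Sum>s\<in>?T. \<Sum>b<N. \<Sum>t\<in>?T.
      F (s(j := a)) (t(j := a)) + F (t(j := a)) (t(j := b)))"
    by (intro sum_mono tr) auto
  also have "\<dots> = N * (\<Sum>a<N. \<Sum>s\<in>?T. \<Sum>t\<in>?T. F (s(j := a)) (t(j := a)))
      + real (N ^ card B) * (\<Sum>a<N. \<Sum>b<N. \<Sum>t\<in>?T. F (t(j := a)) (t(j := b)))"
    by (simp add: sum.distrib sum_distrib_left cT)
  \<comment> \<open>Both contributions carry the power \<open>N ^ (card B + 2)\<close>: the
    induction hypothesis gives the coefficient \<open>card B + 1\<close>, and the lines in direction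
    \<open>j\<close> add 1.\<close>
  also have "\<dots> \<le> N * (real (card B + 1) * real N ^ (card B + 1) * E) + real (N ^ card B) * (N^2 * E)"
  proof (intro add_mono mult_left_mono)
    have "(\<Sum>a<N. \<Sum>s\<in>?T. \<Sum>t\<in>?T. F (s(j := a)) (t(j := a)))
      \<le> (\<Sum>a<N. real (card B + 1) * real N ^ (card B + 1) *
          (\<Sum>s\<in>?T. \<Sum>t\<in>?T. if adjacent B s t then F (s(j := a)) (t(j := a)) else 0))"
      using insert.prems(1) by (intro sum_mono insert.IH nn sy tr) auto
    also have "\<dots> = real (card B + 1) * real N ^ (card B + 1) *
         (\<Sum>a<N. \<Sum>s\<in>?T. \<Sum>t\<in>?T. if adjacent B s t then F (s(j := a)) (t(j := a)) else 0)"
      by (simp only: sum_distrib_left)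
    also have "\<dots> \<le> real (card B + 1) * real N ^ (card B + 1) * E"
      by (intro mult_left_mono E1) auto
    finally show "(\<Sum>a<N. \<Sum>s\<in>?T. \<Sum>t\<in>?T. F (s(j := a)) (t(j := a))) \<le> \<dots>" .
  next
    have "(\<Sum>a<N. \<Sum>b<N. \<Sum>t\<in>?T. F (t(j := a)) (t(j := b)))
        = (\<Sum>t\<in>?T. \<Sum>a<N. \<Sum>b<N. F (t(j := a)) (t(j := b)))"
      by (subst sum.swap[of _ ?T], subst (2) sum.swap) (rule refl)
    also have "\<dots> \<le> (\<Sum>t\<in>?T. \<Sum>a<N. \<Sum>b<N.
          \<Sum>c<N. \<Sum>e<N. if c \<le> Suc e \<and> e \<le> Suc c then F (t(j := c)) (t(j := e)) else 0)"
      by (intro sum_mono chain_le_sum_adjacent nn sy tr) auto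
    also have "\<dots> = N^2 * (\<Sum>t\<in>?T. \<Sum>c<N. \<Sum>e<N. if c \<le> Suc e \<and> e \<le> Suc c then F (t(j := c)) (t(j := e)) else 0)"
      by (simp add: sum_distrib_left power2_eq_square mult.assoc)
    also have "(\<Sum>t\<in>?T. \<Sum>c<N. \<Sum>e<N. if c \<le> Suc e \<and> e \<le> Suc c then F (t(j := c)) (t(j := e)) else 0)
       = (\<Sum>c<N. \<Sum>t\<in>?T. \<Sum>e<N. if c \<le> Suc e \<and> e \<le> Suc c then F (t(j := c)) (t(j := e)) else 0)"
      by (rule sum.swap)
    also have "real (N^2) * \<dots> \<le> real (N^2) * E"
      by (intro mult_left_mono E2) auto
    finally show "(\<Sum>a<N. \<Sum>b<N. \<Sum>t\<in>?T. F (t(j := a)) (t(j := b))) \<le> real (N^2) * E" .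
  qed auto
  also have "\<dots> = real (card (insert j B) + 1) * real N ^ (card (insert j B) + 1) * E"
    using insert.hyps by (simp add: algebra_simps power2_eq_square)
  finally show ?case unfolding E_def .
qed

lemma card_adjacent_le:
  assumes "finite B"
  shows "card {t \<in> B \<rightarrow>\<^sub>E {..<N}. adjacent B s t} \<le> 3 ^ card B"
proof -
  \<comment> \<open>At \<open>s b = 0\<close> truncated subtraction merely repeats an
    element.\<close>
  have "card {t \<in> B \<rightarrow>\<^sub>E {..<N}. adjacent B s t} \<le> card (PiE B (\<lambda>b. {s b - 1, s b, Suc (s b)}))"
    using assms by (intro card_mono finite_PiE) (fastforce simp: adjacent_def PiE_iff extensional_def)+
  also have "\<dots> = (\<Prod>b\<in>B. card {s b - 1, s b, Suc (s b)})" using assms by (simp add: card_PiE)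
  also have "\<dots> \<le> (\<Prod>b\<in>B. 3)" by (intro prod_mono) (auto simp: card_insert_if)
  finally show ?thesis by simp
qed

text \<open>Passage from grid cells to points. \<open>F s t\<close> is the mean of
  \<open>|u i - u j|\<close> over the pairs from the fibres \<open>s\<close> and \<open>t\<close>;
  means, unlike sums, satisfy the triangle inequality whatever the sizes of the fibres, so
  \<open>grid_poincare\<close> applies. Going from sums to means and back costs
  \<open>(b / a)\<^sup>2\<close>. The second bound counts adjacent pairs: \<open>N ^ card B\<close>
  cells, at most \<open>3 ^ card B\<close> neighbours each, at most \<open>b\<^sup>2\<close> pairs
  of points for two cells. It serves for the additive error in
  \<open>oscillation_le_zeta\<close>.\<close>

lemma fibre_oscillation:
  fixes u :: "'p \<Rightarrow> real" and a b :: real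
  assumes fB: "finite B" and N: "N \<ge> 1" and fI: "finite I"
    and \<sigma>: "\<And>i. i \<in> I \<Longrightarrow> \<sigma> i \<in> B \<rightarrow>\<^sub>E {..<N}" and a: "0 < a"
    and fib: "\<And>s. s \<in> B \<rightarrow>\<^sub>E {..<N} \<Longrightarrow> a \<le> card {i\<in>I. \<sigma> i = s} \<and> card {i\<in>I. \<sigma> i = s} \<le> b"
  shows "(\<Sum>i\<in>I. \<Sum>j\<in>I. \<bar>u i - u j\<bar>) \<le> (b / a)\<^sup>2 * (real (card B + 1) * real N ^ (card B + 1)) *
           (\<Sum>i\<in>I. \<Sum>j\<in>I. if adjacent B (\<sigma> i) (\<sigma> j) then \<bar>u i - u j\<bar> else 0)"
    and "(\<Sum>i\<in>I. \<Sum>j\<in>I. if adjacent B (\<sigma> i) (\<sigma> j) then 1 else 0) \<le> (3 * real N) ^ card B * b\<^sup>2"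
proof -
  let ?T = "B \<rightarrow>\<^sub>E {..<N}"
  define J where "J s = {i\<in>I. \<sigma> i = s}" for s
  define D where "D s t = (\<Sum>i\<in>J s. \<Sum>j\<in>J t. \<bar>u i - u j\<bar>)" for s t
  define F where "F s t = D s t / (real (card (J s)) * real (card (J t)))" for s t
  define E where "E = (\<Sum>s\<in>?T. \<Sum>t\<in>?T. if adjacent B s t then F s t else 0)"
  have fT: "finite ?T" using fB by (intro finite_PiE) auto
  have cT: "card ?T = N ^ card B" using fB by (simp add: card_PiE)
  have cJ: "a \<le> card (J s)" "card (J s) \<le> b" "0 < card (J s)" if "s \<in> ?T" for s
    using fib[OF that] a unfolding J_def by auto
  have regroup: "(\<Sum>i\<in>I. \<Sum>j\<in>I. h i j) = (\<Sum>s\<in>?T. \<Sum>t\<in>?T. \<Sum>i\<in>J s. \<Sum>j\<in>J t. h i j)"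
    for h :: "'p \<Rightarrow> 'p \<Rightarrow> real"
  proof -
    have g: "(\<Sum>i\<in>I. f i) = (\<Sum>s\<in>?T. \<Sum>i\<in>J s. f i)" for f :: "'p \<Rightarrow> real"
      unfolding J_def using \<sigma> by (subst sum.group[OF fI fT]) auto
    show ?thesis
      by (simp add: g sum.swap[of _ "J _" ?T])
  qed
  have Dnn: "0 \<le> D s t" for s t unfolding D_def by (intro sum_nonneg) auto
  have Fnn: "0 \<le> F s t" for s t unfolding F_def using Dnn by auto
  have Fsym: "F s t = F t s" for s t
    unfolding F_def D_def by (subst sum.swap) (simp add: abs_minus_commute mult.commute)
  have Ftri: "F s t \<le> F s w + F w t" if "s \<in> ?T" "t \<in> ?T" "w \<in> ?T" for s t w
  proof -
    \<comment> \<open>The triangle inequality is summed over all triples from the three fibres and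
      divided by the product of their sizes, which are positive since \<open>0 < a\<close>.\<close>
    have "card (J w) * D s t = (\<Sum>i\<in>J s. \<Sum>j\<in>J t. \<Sum>k\<in>J w. \<bar>u i - u j\<bar>)"
      by (simp add: D_def sum_distrib_left)
    also have "\<dots> \<le> (\<Sum>i\<in>J s. \<Sum>j\<in>J t. \<Sum>k\<in>J w. \<bar>u i - u k\<bar> + \<bar>u k - u j\<bar>)"
      by (intro sum_mono) linarith
    also have "\<dots> = card (J t) * D s w + card (J s) * D w t"
    proof -
      have "(\<Sum>j\<in>J t. \<Sum>k\<in>J w. \<bar>u k - u j\<bar>) = D w t"
        unfolding D_def by (rule sum.swap)
      then show ?thesis
        by (simp add: sum.distrib D_def sum_distrib_left)
    qed
    finally have "card (J w) * D s t \<le> card (J t) * D s w + card (J s) * D w t" .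
    then show ?thesis unfolding F_def
      using cJ(3)[OF that(1)] cJ(3)[OF that(2)] cJ(3)[OF that(3)]
      by (simp add: field_simps)
  qed
  have P: "(\<Sum>s\<in>?T. \<Sum>t\<in>?T. F s t) \<le> real (card B + 1) * real N ^ (card B + 1) * E"
    unfolding E_def by (intro grid_poincare fB N Fnn Fsym Ftri)
  have "(\<Sum>i\<in>I. \<Sum>j\<in>I. \<bar>u i - u j\<bar>) = (\<Sum>s\<in>?T. \<Sum>t\<in>?T. D s t)"
    unfolding regroup D_def ..
  also have "\<dots> \<le> (\<Sum>s\<in>?T. \<Sum>t\<in>?T. b\<^sup>2 * F s t)"
  proof (intro sum_mono)
    fix s t assume st: "s \<in> ?T" "t \<in> ?T"
    have "D s t = real (card (J s)) * real (card (J t)) * F s t"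
      using cJ(3)[OF st(1)] cJ(3)[OF st(2)] by (simp add: F_def)
    also have "\<dots> \<le> b * b * F s t"
      using cJ[OF st(1)] cJ[OF st(2)] Fnn by (intro mult_right_mono mult_mono) auto
    finally show "D s t \<le> b\<^sup>2 * F s t" by (simp add: power2_eq_square)
  qed
  also have "\<dots> = b\<^sup>2 * (\<Sum>s\<in>?T. \<Sum>t\<in>?T. F s t)" by (simp add: sum_distrib_left)
  also have "\<dots> \<le> b\<^sup>2 * (real (card B + 1) * real N ^ (card B + 1) * E)"
    by (intro mult_left_mono P) auto
  also have "\<dots> \<le> b\<^sup>2 * (real (card B + 1) * real N ^ (card B + 1) *
      ((\<Sum>s\<in>?T. \<Sum>t\<in>?T. if adjacent B s t then D s t else 0) / a\<^sup>2))"
  proof (intro mult_left_mono)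
    show "E \<le> (\<Sum>s\<in>?T. \<Sum>t\<in>?T. if adjacent B s t then D s t else 0) / a\<^sup>2"
      unfolding E_def sum_divide_distrib
    proof (intro sum_mono)
      fix s t assume st: "s \<in> ?T" "t \<in> ?T"
      have "F s t \<le> D s t / a\<^sup>2" unfolding F_def power2_eq_square
        using cJ[OF st(1)] cJ[OF st(2)] a Dnn by (intro divide_left_mono mult_mono mult_pos_pos) auto
      then show "(if adjacent B s t then F s t else 0) \<le> (if adjacent B s t then D s t else 0) / a\<^sup>2"
        by auto
    qed
  qed auto
  also have "(\<Sum>s\<in>?T. \<Sum>t\<in>?T. if adjacent B s t then D s t else 0)
    = (\<Sum>i\<in>I. \<Sum>j\<in>I. if adjacent B (\<sigma> i) (\<sigma> j) then \<bar>u i - u j\<bar> else 0)"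
    unfolding regroup D_def by (intro sum.cong refl) (auto simp: J_def)
  finally show "(\<Sum>i\<in>I. \<Sum>j\<in>I. \<bar>u i - u j\<bar>) \<le> (b / a)\<^sup>2 * (real (card B + 1) * real N ^ (card B + 1)) *
           (\<Sum>i\<in>I. \<Sum>j\<in>I. if adjacent B (\<sigma> i) (\<sigma> j) then \<bar>u i - u j\<bar> else 0)"
    by (simp add: power_divide)
  have "(\<Sum>i\<in>I. \<Sum>j\<in>I. if adjacent B (\<sigma> i) (\<sigma> j) then 1 else 0)
      = (\<Sum>s\<in>?T. \<Sum>t\<in>?T. if adjacent B s t then real (card (J s)) * real (card (J t)) else 0)"
    unfolding regroup by (intro sum.cong refl) (auto simp: J_def)
  also have "\<dots> \<le> (\<Sum>s\<in>?T. \<Sum>t\<in>?T. if adjacent B s t then b\<^sup>2 else 0)"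
  proof (intro sum_mono)
    fix s t assume st: "s \<in> ?T" "t \<in> ?T"
    have "real (card (J s)) * real (card (J t)) \<le> b\<^sup>2" unfolding power2_eq_square
      using cJ[OF st(1)] cJ[OF st(2)] by (intro mult_mono) auto
    then show "(if adjacent B s t then real (card (J s)) * real (card (J t)) else 0) \<le> (if adjacent B s t then b\<^sup>2 else 0)"
      by auto
  qed
  also have "\<dots> = (\<Sum>s\<in>?T. b\<^sup>2 * card {t\<in>?T. adjacent B s t})"
    using fT by (simp add: sum.If_cases Int_def mult.commute)
  also have "\<dots> \<le> (\<Sum>s\<in>?T. b\<^sup>2 * 3 ^ card B)"
  proof (intro sum_mono mult_left_mono)
    show "real (card {t \<in> ?T. adjacent B s t}) \<le> 3 ^ card B" for s
      using card_adjacent_le[OF fB, of N s] by (metis of_nat_le_iff of_nat_numeral of_nat_power)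
  qed auto
  also have "\<dots> = (3 * real N) ^ card B * b\<^sup>2"
    by (simp add: cT power_mult_distrib)
  finally show "(\<Sum>i\<in>I. \<Sum>j\<in>I. if adjacent B (\<sigma> i) (\<sigma> j) then 1 else 0) \<le> (3 * real N) ^ card B * b\<^sup>2" .
qed

section \<open>Lower bounds for the energy density\<close>

text \<open>Concavity puts \<open>\<zeta>\<close> above its chord between 0 and 1; beyond 1
  monotonicity takes over. Positivity of \<open>\<zeta> 1\<close> comes from the positive one-sided
  derivative at 0.\<close>

lemma admissible_zeta_lower:
  assumes "admissible_zeta \<zeta>"
  shows "0 < \<zeta> 1" and "\<And>t. 0 \<le> t \<Longrightarrow> min t 1 * \<zeta> 1 \<le> \<zeta> t"
proof -
  obtain D where D: "D > 0" "(\<zeta> has_real_derivative D) (at 0 within {0..})"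
    using assms by (auto simp: admissible_zeta_def)
  have z0: "\<zeta> 0 = 0" and mono: "mono_on {0..} \<zeta>" and conc: "concave_on {0..} \<zeta>"
    using assms by (auto simp: admissible_zeta_def)
  obtain d where d: "d > 0" "\<And>h. h > 0 \<Longrightarrow> 0 + h \<in> {0..} \<Longrightarrow> h < d \<Longrightarrow> \<zeta> 0 < \<zeta> (0 + h)"
    using has_real_derivative_pos_inc_right[OF D(2,1)] by blast
  have "0 < \<zeta> (min (d / 2) 1)" using d(2)[of "min (d / 2) 1"] d(1) z0 by auto
  also have "\<dots> \<le> \<zeta> 1" using d(1) by (intro mono_onD[OF mono]) auto
  finally show "0 < \<zeta> 1" .
  show "min t 1 * \<zeta> 1 \<le> \<zeta> t" if "0 \<le> t" for t
  proof (cases "t \<le> 1")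
    case True
    then show ?thesis using concave_onD[OF conc, of t 0 1] that z0 by simp
  next
    case False
    then show ?thesis using mono_onD[OF mono, of 1 t] by simp
  qed
qed

text \<open>A kernel that is nonzero only at 0 is excluded by the positive moment integral, since a
  point is a null set.\<close>

lemma admissible_kernel_pos:
  assumes "admissible_kernel d p q \<eta>"
  obtains r where "0 < r" "0 < \<eta> r"
proof (rule ccontr)
  assume "\<not> thesis"
  with that have "\<not> (\<exists>t>0. 0 < \<eta> t)" by blast
  then have "\<not> 0 < \<eta> t" if "t > 0" for t using that by simp
  moreover have "0 \<le> \<eta> t" if "t > 0" for t
    using assms that by (simp add: admissible_kernel_def)
  ultimately have *: "\<eta> t = 0" if "t > 0" for t
    using that by (metis order_less_le)
  have "(\<integral>\<^sup>+t\<in>{0..}. ennreal ((t ^ d + t powr (p - q + real d - 1)) * \<eta> t) \<partial>lborel)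
      = (\<integral>\<^sup>+t. 0 \<partial>(lborel :: real measure))"
    using AE_lborel_singleton[of "0::real"]
    by (intro nn_integral_cong_AE) (auto elim!: eventually_mono simp: * indicator_def)
  then show False using assms by (simp add: admissible_kernel_def)
qed

text \<open>For \<open>w \<le> e\<close> the first term suffices, and an error \<open>e\<close> per
  pair is affordable because it has the order of the grid spacing. For \<open>w > e\<close>,
  \<open>p \<ge> 1\<close> gives \<open>(w / e) powr (p - 1) \<ge> 1\<close>, so the argument
  \<open>t\<close> of \<open>\<zeta>\<close> is at least \<open>w * r powr - q\<close>; moreover
  \<open>w / (2 * M) \<le> 1\<close>. The smaller factor \<open>m\<close> thus satisfies
  \<open>w * m \<le> min t 1\<close>, and the chord bound applies.\<close>

lemma oscillation_le_zeta:
  assumes \<zeta>: "admissible_zeta \<zeta>" and pos: "0 < r" "0 < e" "0 < M" and p: "1 \<le> p" and q: "0 \<le> q"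
    and w: "0 \<le> w" "w \<le> 2 * M" and \<delta>: "0 < \<delta>" "\<delta> \<le> r * e"
  shows "w \<le> e + 1 / (\<zeta> 1 * min (r powr - q) (1 / (2 * M))) * \<zeta> (e powr (1 - p + q) * (w powr p / \<delta> powr q))"
proof (cases "w \<le> e")
  case True
  have "0 \<le> \<zeta> (e powr (1 - p + q) * (w powr p / \<delta> powr q))"
    using \<zeta> by (auto simp: admissible_zeta_def)
  moreover have "0 \<le> 1 / (\<zeta> 1 * min (r powr - q) (1 / (2 * M)))"
    using admissible_zeta_lower[OF \<zeta>] pos by auto
  ultimately show ?thesis using True by (meson add_increasing2 mult_nonneg_nonneg)
next
  case False
  define m where "m = min (r powr - q) (1 / (2 * M))"
  define t where "t = e powr (1 - p + q) * (w powr p / \<delta> powr q)"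
  have m: "0 < m" using pos by (simp add: m_def)
  have w0: "0 < w" using False pos by linarith
  have "w * m \<le> w * r powr - q" using w0 by (simp add: m_def)
  also have "\<dots> \<le> e powr (1 - p) * w powr p * r powr - q"
  proof (rule mult_right_mono)
    have "1 \<le> (w / e) powr (p - 1)" using False pos p by (intro ge_one_powr_ge_zero) auto
    also have "(w / e) powr (p - 1) = w powr p / w * e powr (1 - p)"
      using w0 pos by (simp add: powr_divide powr_diff)
    finally have "w * 1 \<le> w * (w powr p / w * e powr (1 - p))"
      using w0 by (intro mult_left_mono) auto
    then show "w \<le> e powr (1 - p) * w powr p" using w0 by (simp add: mult.commute)
  qed auto
  \<comment> \<open>At distance \<open>r * e\<close> the exponent \<open>1 - p + q\<close> leaves
    exactly \<open>e powr (1 - p)\<close>; shorter distances only increase the argument of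
    \<open>\<zeta>\<close>.\<close>
  also have "\<dots> = e powr (1 - p + q) * (w powr p / (r * e) powr q)"
    using pos by (simp add: powr_mult powr_add[of e "1 - p" q] powr_minus divide_inverse mult_ac)
  also have "\<dots> \<le> t" unfolding t_def
    using \<delta> q pos by (intro mult_left_mono divide_left_mono powr_mono2 mult_pos_pos) auto
  finally have wt: "w * m \<le> t" .
  have "w * m \<le> w * (1 / (2 * M))" using w0 by (intro mult_left_mono) (auto simp: m_def)
  also have "\<dots> \<le> 1" using w pos by auto
  finally have "w * m \<le> min t 1" using wt by simp
  then have "w * m * \<zeta> 1 \<le> min t 1 * \<zeta> 1"
    using admissible_zeta_lower[OF \<zeta>] by (intro mult_right_mono) auto
  also have "\<dots> \<le> \<zeta> t" using w0 m wt by (intro admissible_zeta_lower(2)[OF \<zeta>]) (meson less_imp_le mult_pos_pos order_trans)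
  finally have "w \<le> 1 / (\<zeta> 1 * m) * \<zeta> t"
    using m admissible_zeta_lower(1)[OF \<zeta>] by (simp add: field_simps)
  then show ?thesis using pos unfolding m_def t_def by linarith
qed

section \<open>Dyadic cubes\<close>

text \<open>The restriction to \<open>Basis\<close> makes an index depend on its coordinates only; a
  \<open>z\<close> that is not extensional has an empty cube.\<close>

definition dyadic_index :: "nat \<Rightarrow> 'a::euclidean_space \<Rightarrow> 'a \<Rightarrow> int" where
  "dyadic_index k x = (\<lambda>b\<in>Basis. \<lfloor>2 ^ k * (x \<bullet> b)\<rfloor>)"

definition dyadic_cube :: "nat \<Rightarrow> ('a \<Rightarrow> int) \<Rightarrow> 'a::euclidean_space set" where
  "dyadic_cube k z = {x. dyadic_index k x = z}"

text \<open>Without \<open>extensional\<close>, every function with an empty cube would belong here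
  and the set would not be finite.\<close>

definition inner_cubes :: "'a::euclidean_space set \<Rightarrow> nat \<Rightarrow> ('a \<Rightarrow> int) set" where
  "inner_cubes \<Omega> k = {z \<in> extensional Basis. dyadic_cube k z \<subseteq> \<Omega>}"

text \<open>The complement of all inner cubes is lumped into the one cell \<open>None\<close>. The
  range is therefore finite for bounded \<open>\<Omega>\<close>, and \<open>None\<close> is the only
  cell without a diameter bound.\<close>

definition dyadic_cell :: "'a::euclidean_space set \<Rightarrow> nat \<Rightarrow> 'a \<Rightarrow> ('a \<Rightarrow> int) option" where
  "dyadic_cell \<Omega> k x =
     (if dyadic_index k x \<in> inner_cubes \<Omega> k then Some (dyadic_index k x) else None)"

lemma dyadic_index_extensional [simp]: "dyadic_index k x \<in> extensional Basis"
  by (simp add: dyadic_index_def)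

lemma mem_dyadic_cube:
  "z \<in> extensional Basis \<Longrightarrow> x \<in> dyadic_cube k z \<longleftrightarrow> (\<forall>b\<in>Basis. \<lfloor>2 ^ k * (x \<bullet> b)\<rfloor> = z b)"
  by (auto simp: dyadic_cube_def dyadic_index_def extensional_def fun_eq_iff)

lemma sets_dyadic_cube [measurable]: "dyadic_cube k z \<in> sets borel"
proof (cases "z \<in> extensional Basis")
  case True
  have "dyadic_cube k z = {x\<in>space borel. \<forall>b\<in>Basis. \<lfloor>2 ^ k * (x \<bullet> b)\<rfloor> = z b}"
    using mem_dyadic_cube[OF True] by auto
  also have "\<dots> \<in> sets borel" by measurable
  finally show ?thesis .
next
  case False
  then have "dyadic_cube k z = {}" using dyadic_index_extensional by (auto simp: dyadic_cube_def)
  then show ?thesis by simp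
qed

lemma dyadic_corner_mem:
  assumes "z \<in> extensional Basis"
  shows "(\<Sum>b\<in>Basis. (z b / 2 ^ k) *\<^sub>R b) \<in> dyadic_cube k z"
  using assms by (simp add: mem_dyadic_cube inner_sum_left_Basis)

text \<open>The half-open cube lies between the open and the closed box with the same corners, and
  these have the same volume.\<close>

lemma emeasure_dyadic_cube:
  fixes z :: "'a::euclidean_space \<Rightarrow> int"
  assumes z: "z \<in> extensional Basis"
  shows "emeasure lborel (dyadic_cube k z) = ennreal ((1 / 2 ^ k) ^ DIM('a))"
proof -
  define l u where "l = (\<Sum>b\<in>Basis. (z b / 2 ^ k) *\<^sub>R b)"
    and "u = (\<Sum>b\<in>Basis. ((z b + 1) / 2 ^ k) *\<^sub>R b :: 'a)"
  have lu: "l \<bullet> b = z b / 2 ^ k" "u \<bullet> b = (z b + 1) / 2 ^ k" if "b \<in> Basis" for b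
    using that by (simp_all add: l_def u_def inner_sum_left_Basis)
  have le: "l \<bullet> b \<le> u \<bullet> b" if "b \<in> Basis" for b using that by (simp add: lu divide_right_mono)
  have p: "(\<Prod>b\<in>Basis. (u - l) \<bullet> b) = (1 / 2 ^ k) ^ DIM('a)"
    by (simp add: inner_diff_left lu add_divide_distrib)
  have "box l u \<subseteq> dyadic_cube k z"
  proof
    fix x assume x: "x \<in> box l u"
    show "x \<in> dyadic_cube k z" unfolding mem_dyadic_cube[OF z]
    proof
      fix b :: 'a assume b: "b \<in> Basis"
      then have "z b / 2 ^ k < x \<bullet> b" "x \<bullet> b < (z b + 1) / 2 ^ k"
        using x lu[OF b] by (auto simp: mem_box)
      then show "\<lfloor>2 ^ k * (x \<bullet> b)\<rfloor> = z b" by (simp add: floor_eq_iff field_simps)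
    qed
  qed
  then have "emeasure lborel (box l u) \<le> emeasure lborel (dyadic_cube k z)"
    by (rule emeasure_mono) simp
  moreover have "dyadic_cube k z \<subseteq> cbox l u"
  proof
    fix x assume x: "x \<in> dyadic_cube k z"
    show "x \<in> cbox l u" unfolding mem_box
    proof
      fix b :: 'a assume b: "b \<in> Basis"
      then have "\<lfloor>2 ^ k * (x \<bullet> b)\<rfloor> = z b" using x by (simp add: mem_dyadic_cube[OF z])
      then have "z b \<le> 2 ^ k * (x \<bullet> b)" "2 ^ k * (x \<bullet> b) < z b + 1" by (auto simp: floor_eq_iff)
      then show "l \<bullet> b \<le> x \<bullet> b \<and> x \<bullet> b \<le> u \<bullet> b" by (simp add: lu[OF b] field_simps)
    qed
  qed
  then have "emeasure lborel (dyadic_cube k z) \<le> emeasure lborel (cbox l u)"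
    by (rule emeasure_mono) simp
  ultimately show ?thesis
    using le by (simp add: emeasure_lborel_box emeasure_lborel_cbox p antisym)
qed

text \<open>A cube contains its lower corner, so the corner of an inner cube is a point of the
  bounded set \<open>\<Omega>\<close>, which bounds the index.\<close>

lemma finite_inner_cubes:
  fixes \<Omega> :: "'a::euclidean_space set"
  assumes "bounded \<Omega>"
  shows "finite (inner_cubes \<Omega> k)"
proof -
  obtain R where R: "\<And>x. x \<in> \<Omega> \<Longrightarrow> norm x \<le> R" using assms by (auto simp: bounded_iff)
  have "inner_cubes \<Omega> k \<subseteq> PiE Basis (\<lambda>_. {\<lfloor>- (2 ^ k * R)\<rfloor>..\<lceil>2 ^ k * R\<rceil>})"
  proof
    fix z assume z: "z \<in> inner_cubes \<Omega> k"
    let ?x = "\<Sum>b\<in>Basis. (z b / 2 ^ k) *\<^sub>R b :: 'a"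
    have ze: "z \<in> extensional Basis" and "?x \<in> \<Omega>"
      using z dyadic_corner_mem[of z k] by (auto simp: inner_cubes_def)
    then have "\<bar>?x \<bullet> b\<bar> \<le> R" if "b \<in> Basis" for b
      using Basis_le_norm[OF that, of ?x] R[of ?x] by linarith
    then have zR: "\<bar>z b / 2 ^ k\<bar> \<le> R" if "b \<in> Basis" for b
      using that by (simp add: inner_sum_left_Basis)
    have "z b \<in> {\<lfloor>- (2 ^ k * R)\<rfloor>..\<lceil>2 ^ k * R\<rceil>}" if b: "b \<in> Basis" for b
    proof -
      have "\<bar>real_of_int (z b)\<bar> \<le> 2 ^ k * R" using zR[OF b] by (simp add: field_simps)
      then show ?thesis by simp linarith
    qed
    then show "z \<in> PiE Basis (\<lambda>_. {\<lfloor>- (2 ^ k * R)\<rfloor>..\<lceil>2 ^ k * R\<rceil>})" using ze by (simp add: PiE_iff)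
  qed
  then show ?thesis by (rule finite_subset) (intro finite_PiE finite_Basis finite_atLeastAtMost_int)
qed

lemma vimage_dyadic_cell:
  "dyadic_cell \<Omega> k -` {Some z} = (if z \<in> inner_cubes \<Omega> k then dyadic_cube k z else {})"
  "dyadic_cell \<Omega> k -` {None} = - (\<Union>z\<in>inner_cubes \<Omega> k. dyadic_cube k z)"
  by (auto simp: dyadic_cell_def dyadic_cube_def split: if_splits)

lemma sets_vimage_dyadic_cell:
  assumes "bounded \<Omega>"
  shows "dyadic_cell \<Omega> k -` {B} \<in> sets borel"
proof (cases B)
  case None
  have "(\<Union>z\<in>inner_cubes \<Omega> k. dyadic_cube k z) \<in> sets borel"
    using finite_inner_cubes[OF assms] by (intro sets.finite_UN) auto
  then show ?thesis unfolding None vimage_dyadic_cell by (rule borel_comp)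
qed (simp add: vimage_dyadic_cell)

lemma finite_range_dyadic_cell:
  assumes "bounded \<Omega>"
  shows "finite (range (dyadic_cell \<Omega> k))"
  by (rule finite_subset[of _ "insert None (Some ` inner_cubes \<Omega> k)"])
    (auto simp: dyadic_cell_def finite_inner_cubes[OF assms])

text \<open>Used with \<open>j = 0\<close> for points of one cube and with \<open>j = 1\<close> for
  adjacent cubes. Floors that differ by at most \<open>j\<close> belong to numbers less than
  \<open>j + 1\<close> apart; the comparison with the l1 norm brings in
  \<open>DIM('a)\<close>.\<close>

lemma norm_le_of_index:
  fixes x y :: "'a::euclidean_space"
  assumes "\<And>b. b \<in> Basis \<Longrightarrow> \<bar>\<lfloor>2 ^ k * (x \<bullet> b)\<rfloor> - \<lfloor>2 ^ k * (y \<bullet> b)\<rfloor>\<bar> \<le> j"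
  shows "norm (x - y) \<le> real DIM('a) * (real_of_int j + 1) / 2 ^ k"
proof -
  have "norm (x - y) \<le> (\<Sum>b\<in>Basis. \<bar>(x - y) \<bullet> b\<bar>)" by (rule norm_le_l1)
  also have "\<dots> \<le> (\<Sum>b\<in>(Basis :: 'a set). (real_of_int j + 1) / 2 ^ k)"
  proof (rule sum_mono)
    fix b :: 'a assume b: "b \<in> Basis"
    have "2 ^ k * (x \<bullet> b) - 2 ^ k * (y \<bullet> b) \<le> j + 1" "2 ^ k * (y \<bullet> b) - 2 ^ k * (x \<bullet> b) \<le> j + 1"
      using assms[OF b] by linarith+
    then show "\<bar>(x - y) \<bullet> b\<bar> \<le> (real_of_int j + 1) / 2 ^ k"
      by (simp add: inner_diff_left field_simps abs_le_iff)
  qed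
  finally show ?thesis by simp
qed

lemma norm_le_of_same_index:
  fixes x y :: "'a::euclidean_space"
  assumes "dyadic_index k x = dyadic_index k y"
  shows "norm (x - y) \<le> real DIM('a) / 2 ^ k"
proof -
  have "\<lfloor>2 ^ k * (x \<bullet> b)\<rfloor> = \<lfloor>2 ^ k * (y \<bullet> b)\<rfloor>" if "b \<in> Basis" for b
    using fun_cong[OF assms, of b] that by (simp add: dyadic_index_def)
  then show ?thesis using norm_le_of_index[of k x y 0] by simp
qed

lemma eventually_dyadic_cell_neq_None:
  fixes x :: "'a::euclidean_space"
  assumes "open \<Omega>" "x \<in> \<Omega>"
  shows "\<forall>\<^sub>F k in sequentially. dyadic_cell \<Omega> k x \<noteq> None"
proof -
  obtain e where e: "e > 0" "ball x e \<subseteq> \<Omega>" using assms by (auto simp: open_contains_ball)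
  have "(\<lambda>k. real DIM('a) * (1 / 2) ^ k) \<longlonglongrightarrow> real DIM('a) * 0"
    by (intro tendsto_intros LIMSEQ_power_zero) auto
  then have "\<forall>\<^sub>F k in sequentially. real DIM('a) * (1 / 2) ^ k < e"
    using e(1) by (simp add: order_tendsto_iff)
  then show ?thesis
  proof (rule eventually_mono)
    fix k assume k: "real DIM('a) * (1 / 2) ^ k < e"
    have "dyadic_cube k (dyadic_index k x) \<subseteq> ball x e"
    proof
      fix y assume "y \<in> dyadic_cube k (dyadic_index k x)"
      then have "norm (x - y) \<le> real DIM('a) / 2 ^ k"
        by (intro norm_le_of_same_index) (simp add: dyadic_cube_def)
      then show "y \<in> ball x e" using k by (simp add: dist_norm power_divide)
    qed
    then show "dyadic_cell \<Omega> k x \<noteq> None" using e(2) by (auto simp: dyadic_cell_def inner_cubes_def)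
  qed
qed

section \<open>Subdivision of a dyadic cube into cubes of a finer level\<close>

lemma floor_dyadic_refine:
  assumes "k \<le> m"
  shows "\<lfloor>2 ^ k * (t::real)\<rfloor> = \<lfloor>2 ^ m * t\<rfloor> div 2 ^ (m - k)"
proof -
  have "2 ^ m = (2::real) ^ k * 2 ^ (m - k)" using assms by (simp flip: power_add)
  then have "2 ^ k * t = 2 ^ m * t / real_of_int (2 ^ (m - k))" by simp
  then show ?thesis using floor_divide_real_eq_div[of "2 ^ (m - k)" "2 ^ m * t"] by simp
qed

text \<open>The position of \<open>x\<close> among the level-\<open>m\<close> subcubes of the level-\<open>k\<close> cube with index \<open>z\<close>.\<close>

definition subindex :: "nat \<Rightarrow> nat \<Rightarrow> ('a \<Rightarrow> int) \<Rightarrow> 'a::euclidean_space \<Rightarrow> 'a \<Rightarrow> nat" where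
  "subindex k m z x = (\<lambda>b\<in>Basis. nat (\<lfloor>2 ^ m * (x \<bullet> b)\<rfloor> - 2 ^ (m - k) * z b))"

lemma subindex_bounds:
  assumes "k \<le> m" "x \<in> dyadic_cube k z" "b \<in> Basis"
  shows "2 ^ (m - k) * z b \<le> \<lfloor>2 ^ m * (x \<bullet> b)\<rfloor>" "\<lfloor>2 ^ m * (x \<bullet> b)\<rfloor> < 2 ^ (m - k) * z b + 2 ^ (m - k)"
proof -
  have "z b = \<lfloor>2 ^ k * (x \<bullet> b)\<rfloor>" using assms(2,3) by (auto simp: dyadic_cube_def dyadic_index_def)
  then have z: "z b = \<lfloor>2 ^ m * (x \<bullet> b)\<rfloor> div 2 ^ (m - k)" using floor_dyadic_refine[OF assms(1)] by simp
  have e: "\<lfloor>2 ^ m * (x \<bullet> b)\<rfloor> = 2 ^ (m - k) * z b + \<lfloor>2 ^ m * (x \<bullet> b)\<rfloor> mod 2 ^ (m - k)"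
    unfolding z by simp
  have "0 \<le> \<lfloor>2 ^ m * (x \<bullet> b)\<rfloor> mod 2 ^ (m - k)" "\<lfloor>2 ^ m * (x \<bullet> b)\<rfloor> mod 2 ^ (m - k) < 2 ^ (m - k)"
    by simp_all
  then show "2 ^ (m - k) * z b \<le> \<lfloor>2 ^ m * (x \<bullet> b)\<rfloor>" "\<lfloor>2 ^ m * (x \<bullet> b)\<rfloor> < 2 ^ (m - k) * z b + 2 ^ (m - k)"
    using e by linarith+
qed

lemma subindex_mem:
  assumes "k \<le> m" "x \<in> dyadic_cube k z"
  shows "subindex k m z x \<in> Basis \<rightarrow>\<^sub>E {..<2 ^ (m - k)}"
  using subindex_bounds[OF assms] by (auto simp: subindex_def nat_less_iff algebra_simps)

text \<open>The level \<open>m\<close> is later chosen so that this bound is at most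
  \<open>r * \<epsilon>\<close>; points of adjacent small cubes then interact.\<close>

lemma adjacent_subindex_norm_le:
  fixes x y :: "'a::euclidean_space"
  assumes "k \<le> m" "x \<in> dyadic_cube k z" "y \<in> dyadic_cube k z"
    and "adjacent Basis (subindex k m z x) (subindex k m z y)"
  shows "norm (x - y) \<le> 2 * real DIM('a) / 2 ^ m"
proof -
  have "\<bar>\<lfloor>2 ^ m * (x \<bullet> b)\<rfloor> - \<lfloor>2 ^ m * (y \<bullet> b)\<rfloor>\<bar> \<le> 1" if b: "b \<in> Basis" for b
  proof -
    let ?X = "\<lfloor>2 ^ m * (x \<bullet> b)\<rfloor> - 2 ^ (m - k) * z b" and ?Y = "\<lfloor>2 ^ m * (y \<bullet> b)\<rfloor> - 2 ^ (m - k) * z b"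
    have "nat ?X \<le> Suc (nat ?Y)" "nat ?Y \<le> Suc (nat ?X)"
      using assms(4) b by (auto simp: adjacent_def subindex_def)
    moreover have "0 \<le> ?X" "0 \<le> ?Y"
      using subindex_bounds(1)[OF assms(1,2) b] subindex_bounds(1)[OF assms(1,3) b] by auto
    ultimately have "\<bar>?X - ?Y\<bar> \<le> 1" by linarith
    then show ?thesis by simp
  qed
  from norm_le_of_index[OF this] show ?thesis by (simp add: mult.commute)
qed

text \<open>The fibres of \<open>subindex\<close> are exactly the small cubes, with coordinates
  \<open>2 ^ (m - k) * z b + s b\<close>. Lying in an inner cube they are inner themselves, so point
  counts at level \<open>m\<close> serve as the fibre sizes in
  \<open>fibre_oscillation\<close>.\<close>

lemma subindex_fibre:
  assumes km: "k \<le> m" and z: "z \<in> inner_cubes \<Omega> k" and s: "s \<in> Basis \<rightarrow>\<^sub>E {..<2 ^ (m - k)}"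
  obtains y where "y \<in> inner_cubes \<Omega> m"
    "\<And>x. x \<in> dyadic_cube k z \<and> subindex k m z x = s \<longleftrightarrow> x \<in> dyadic_cube m y"
proof -
  define y where "y = (\<lambda>b\<in>Basis. 2 ^ (m - k) * z b + int (s b))"
  have ye: "y \<in> extensional Basis" by (simp add: y_def)
  have ze: "z \<in> extensional Basis" using z by (simp add: inner_cubes_def)
  have iff: "x \<in> dyadic_cube k z \<and> subindex k m z x = s \<longleftrightarrow> x \<in> dyadic_cube m y" for x
  proof
    assume x: "x \<in> dyadic_cube k z \<and> subindex k m z x = s"
    show "x \<in> dyadic_cube m y" unfolding mem_dyadic_cube[OF ye]
    proof
      fix b :: 'a assume b: "b \<in> Basis"
      have "int (s b) = \<lfloor>2 ^ m * (x \<bullet> b)\<rfloor> - 2 ^ (m - k) * z b"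
        using x subindex_bounds(1)[OF km _ b, of x z] b by (auto simp: subindex_def)
      then show "\<lfloor>2 ^ m * (x \<bullet> b)\<rfloor> = y b" using b by (simp add: y_def)
    qed
  next
    assume "x \<in> dyadic_cube m y"
    then have f: "\<lfloor>2 ^ m * (x \<bullet> b)\<rfloor> = 2 ^ (m - k) * z b + int (s b)" if "b \<in> Basis" for b
      using that unfolding mem_dyadic_cube[OF ye] by (simp add: y_def)
    have "\<lfloor>2 ^ k * (x \<bullet> b)\<rfloor> = z b" if b: "b \<in> Basis" for b
    proof -
      have "int (s b) < 2 ^ (m - k)" using s b by (auto simp: PiE_iff)
      then show ?thesis unfolding floor_dyadic_refine[OF km] f[OF b] by (simp add: div_pos_pos_trivial)
    qed
    moreover have "subindex k m z x = s"
      using f s by (auto simp: subindex_def fun_eq_iff PiE_iff extensional_def)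
    ultimately show "x \<in> dyadic_cube k z \<and> subindex k m z x = s" by (simp add: mem_dyadic_cube[OF ze])
  qed
  moreover have "y \<in> inner_cubes \<Omega> m" using iff ye z by (auto simp: inner_cubes_def)
  ultimately show ?thesis using that by blast
qed

section \<open>Oscillation of functions of bounded energy\<close>

lemma sum_dev_mean_le:
  fixes w :: "'i \<Rightarrow> real"
  assumes "finite J"
  shows "(\<Sum>i\<in>J. \<bar>w i - (\<Sum>j\<in>J. w j) / card J\<bar>) \<le> (\<Sum>i\<in>J. \<Sum>j\<in>J. \<bar>w i - w j\<bar>) / card J"
  unfolding sum_divide_distrib
proof (rule sum_mono)
  fix i assume i: "i \<in> J"
  then have c: "0 < real (card J)" using assms by (auto simp: card_gt_0_iff)
  have "w i - (\<Sum>j\<in>J. w j) / card J = (\<Sum>j\<in>J. w i - w j) / card J"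
    using c by (simp add: sum_subtractf field_simps)
  also have "\<bar>\<dots>\<bar> \<le> (\<Sum>j\<in>J. \<bar>w i - w j\<bar>) / card J"
    using c by (simp add: abs_divide divide_right_mono sum_abs)
  finally show "\<bar>w i - (\<Sum>j\<in>J. w j / card J)\<bar> \<le> (\<Sum>j\<in>J. \<bar>w i - w j\<bar> / card J)"
    by (simp add: sum_divide_distrib)
qed

definition cube_points :: "(nat \<Rightarrow> 'a::euclidean_space) \<Rightarrow> nat \<Rightarrow> nat \<Rightarrow> ('a \<Rightarrow> int) \<Rightarrow> nat set" where
  "cube_points x n k z = {i \<in> {..<n}. x i \<in> dyadic_cube k z}"

definition interaction ::
  "real \<Rightarrow> real \<Rightarrow> (real \<Rightarrow> real) \<Rightarrow> (nat \<Rightarrow> 'a::euclidean_space) \<Rightarrow> real \<Rightarrow> ('a \<Rightarrow> real) \<Rightarrow> nat \<Rightarrow> nat \<Rightarrow> real" where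
  "interaction p q \<zeta> x e u i j =
     \<zeta> (e powr (1 - p + q) * (\<bar>u (x i) - u (x j)\<bar> powr p / norm (x i - x j) powr q))"

text \<open>By monotonicity the rescaled kernel is at least \<open>\<eta> r / e ^ d\<close> at
  distances up to \<open>r * e\<close>, and the other terms are nonnegative. The power
  \<open>e ^ (d + 1)\<close> collects this \<open>e ^ d\<close> and the prefactor
  \<open>1 / e\<close> of \<open>GMS\<close>.\<close>

lemma interaction_sum_le_GMS:
  fixes x :: "nat \<Rightarrow> 'a::euclidean_space"
  assumes \<zeta>: "admissible_zeta \<zeta>" and \<eta>: "\<And>t. 0 \<le> t \<Longrightarrow> 0 \<le> \<eta> t" "antimono_on {0..} \<eta>"
    and r: "0 < r" "0 < \<eta> r" and e: "0 < e" and n: "1 \<le> n" and K: "GMS p q \<zeta> \<eta> x e n u \<le> K"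
  shows "(\<Sum>i<n. \<Sum>j<n. if i \<noteq> j \<and> norm (x i - x j) \<le> r * e then interaction p q \<zeta> x e u i j else 0)
      \<le> K * (real n)\<^sup>2 * e ^ (DIM('a) + 1) / \<eta> r"
proof -
  let ?W = "\<lambda>i j. if i \<noteq> j \<and> norm (x i - x j) \<le> r * e then interaction p q \<zeta> x e u i j else 0"
  have int0: "0 \<le> interaction p q \<zeta> x e u i j" for i j
    using \<zeta> by (auto simp: interaction_def admissible_zeta_def)
  have "(\<Sum>i<n. \<Sum>j<n. ?W i j) * (\<eta> r / e ^ DIM('a)) = (\<Sum>i<n. \<Sum>j<n. ?W i j * (\<eta> r / e ^ DIM('a)))"
    by (simp only: sum_distrib_right)
  also have "\<dots> \<le> (\<Sum>i<n. \<Sum>j<n. if i = j then 0 else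
      interaction p q \<zeta> x e u i j * rescaled_kernel DIM('a) \<eta> e (norm (x i - x j)))"
  proof (intro sum_mono)
    fix i j
    have "?W i j * (\<eta> r / e ^ DIM('a)) \<le> interaction p q \<zeta> x e u i j * rescaled_kernel DIM('a) \<eta> e (norm (x i - x j))"
      if "i \<noteq> j"
    proof (cases "norm (x i - x j) \<le> r * e")
      case True
      then have "norm (x i - x j) / e \<le> r" using e by (simp add: field_simps)
      then have "\<eta> r \<le> \<eta> (norm (x i - x j) / e)"
        using \<eta>(2) e r by (auto simp: monotone_on_def)
      then have "\<eta> r / e ^ DIM('a) \<le> rescaled_kernel DIM('a) \<eta> e (norm (x i - x j))"
        using e by (simp add: rescaled_kernel_def divide_right_mono)
      then show ?thesis using True that int0 by (simp add: mult_left_mono del: times_divide_eq_right)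
    next
      case False
      have "0 \<le> rescaled_kernel DIM('a) \<eta> e (norm (x i - x j))"
        using \<eta>(1) e by (simp add: rescaled_kernel_def)
      then show ?thesis using False int0 by simp
    qed
    then show "?W i j * (\<eta> r / e ^ DIM('a)) \<le> (if i = j then 0 else
      interaction p q \<zeta> x e u i j * rescaled_kernel DIM('a) \<eta> e (norm (x i - x j)))" by auto
  qed
  also have "\<dots> = GMS p q \<zeta> \<eta> x e n u * (e * (real n)\<^sup>2)"
    unfolding GMS_def interaction_def using e n by simp
  also have "\<dots> \<le> K * (e * (real n)\<^sup>2)" using K e by (intro mult_right_mono) auto
  finally have "(\<Sum>i<n. \<Sum>j<n. ?W i j) \<le> K * (e * (real n)\<^sup>2) / (\<eta> r / e ^ DIM('a))"
    using r e by (subst pos_le_divide_eq) auto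
  also have "\<dots> = K * (real n)\<^sup>2 * e ^ (DIM('a) + 1) / \<eta> r" by simp
  finally show ?thesis .
qed

text \<open>\<open>fibre_oscillation\<close> with the \<open>N ^ d\<close> small cubes as fibres,
  and \<open>oscillation_le_zeta\<close> on adjacent pairs, which lie within \<open>r * e\<close> by
  the choice of \<open>m\<close>. The inner sum of interactions runs over all \<open>j < n\<close>:
  distinct cubes then carry disjoint rows of the double sum over all pairs.\<close>

lemma cube_oscillation_le:
  fixes x :: "nat \<Rightarrow> 'a::euclidean_space" and a b :: real
  assumes \<zeta>: "admissible_zeta \<zeta>" and p: "1 \<le> p" and q: "0 \<le> q"
    and pos: "0 < r" "0 < e" "0 < M" and uM: "\<And>i. i < n \<Longrightarrow> \<bar>u (x i)\<bar> \<le> M"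
    and km: "k \<le> m" and m: "2 * real DIM('a) \<le> r * e * 2 ^ m"
    and a: "0 < a" and cnt: "\<And>z. z \<in> inner_cubes \<Omega> m \<Longrightarrow> a \<le> card (cube_points x n m z) \<and> card (cube_points x n m z) \<le> b"
    and z: "z \<in> inner_cubes \<Omega> k"
  defines "C2 \<equiv> 1 / (\<zeta> 1 * min (r powr - q) (1 / (2 * M)))"
    and "N \<equiv> 2 ^ (m - k) :: real" and "d \<equiv> DIM('a)"
  shows "N ^ d * a \<le> card (cube_points x n k z)"
    and "(\<Sum>i\<in>cube_points x n k z. \<Sum>j\<in>cube_points x n k z. \<bar>u (x i) - u (x j)\<bar>) \<le>
      (b / a)\<^sup>2 * (real (d + 1) * N ^ (d + 1)) * (e * ((3 * N) ^ d * b\<^sup>2) +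
        C2 * (\<Sum>i\<in>cube_points x n k z. \<Sum>j<n.
          if i \<noteq> j \<and> norm (x i - x j) \<le> r * e then interaction p q \<zeta> x e u i j else 0))"
proof -
  let ?I = "cube_points x n k z"
  let ?W = "\<lambda>i j. if i \<noteq> j \<and> norm (x i - x j) \<le> r * e then interaction p q \<zeta> x e u i j else 0"
  define \<sigma> where "\<sigma> i = subindex k m z (x i)" for i
  have N: "real (2 ^ (m - k)) = N" by (simp add: N_def)
  have I: "finite ?I" "\<And>i. i \<in> ?I \<Longrightarrow> x i \<in> dyadic_cube k z" "\<And>i. i \<in> ?I \<Longrightarrow> i < n"
    by (auto simp: cube_points_def)
  have \<sigma>: "\<sigma> i \<in> Basis \<rightarrow>\<^sub>E {..<2 ^ (m - k)}" if "i \<in> ?I" for i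
    unfolding \<sigma>_def using subindex_mem[OF km I(2)[OF that]] .
  have fib: "a \<le> card {i\<in>?I. \<sigma> i = s} \<and> card {i\<in>?I. \<sigma> i = s} \<le> b"
    if s: "s \<in> Basis \<rightarrow>\<^sub>E {..<2 ^ (m - k)}" for s
  proof -
    obtain y where y: "y \<in> inner_cubes \<Omega> m"
      "\<And>x. x \<in> dyadic_cube k z \<and> subindex k m z x = s \<longleftrightarrow> x \<in> dyadic_cube m y"
      using subindex_fibre[OF km z s] by metis
    have "{i\<in>?I. \<sigma> i = s} = cube_points x n m y"
      using y(2) by (auto simp: cube_points_def \<sigma>_def)
    then show ?thesis using cnt[OF y(1)] by simp
  qed
  have z1: "0 < \<zeta> 1" using admissible_zeta_lower[OF \<zeta>] by simp
  have C2: "0 \<le> C2" using z1 pos by (auto simp: C2_def)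
  have int0: "0 \<le> interaction p q \<zeta> x e u i j" for i j
    using \<zeta> by (auto simp: interaction_def admissible_zeta_def)
  have N1: "(1::nat) \<le> 2 ^ (m - k)" by simp
  note fo1 = fibre_oscillation(1)[OF finite_Basis N1 I(1) \<sigma> a fib, of "\<lambda>i. u (x i)", unfolded N, folded d_def]
  note fo2 = fibre_oscillation(2)[OF finite_Basis N1 I(1) \<sigma> a fib, unfolded N, folded d_def]
  have "(\<Sum>i\<in>?I. \<Sum>j\<in>?I. if adjacent Basis (\<sigma> i) (\<sigma> j) then \<bar>u (x i) - u (x j)\<bar> else 0)
     \<le> (\<Sum>i\<in>?I. \<Sum>j\<in>?I. e * (if adjacent Basis (\<sigma> i) (\<sigma> j) then 1 else 0) + C2 * ?W i j)"
  proof (intro sum_mono)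
    fix i j assume i: "i \<in> ?I" and j: "j \<in> ?I"
    have "\<bar>u (x i) - u (x j)\<bar> \<le> e + C2 * ?W i j" if adj: "adjacent Basis (\<sigma> i) (\<sigma> j)"
    \<comment> \<open>Coinciding points, in particular \<open>i = j\<close>, have no oscillation;
      the estimate by \<open>\<zeta>\<close> needs a positive distance.\<close>
    proof (cases "x i = x j")
      case True
      then show ?thesis using C2 int0[of i j] pos by simp
    next
      case False
      have "norm (x i - x j) \<le> 2 * real DIM('a) / 2 ^ m"
        using adj unfolding \<sigma>_def by (intro adjacent_subindex_norm_le[OF km I(2)[OF i] I(2)[OF j]])
      also have "\<dots> \<le> r * e" using m by (simp add: field_simps)
      finally have le: "norm (x i - x j) \<le> r * e" .
      have "\<bar>u (x i) - u (x j)\<bar> \<le> e + C2 * interaction p q \<zeta> x e u i j"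
        unfolding C2_def interaction_def using uM[OF I(3)[OF i]] uM[OF I(3)[OF j]] False le
        by (intro oscillation_le_zeta[OF \<zeta> pos p q]) auto
      moreover have "i \<noteq> j" using False by auto
      ultimately show ?thesis using le by simp
    qed
    then show "(if adjacent Basis (\<sigma> i) (\<sigma> j) then \<bar>u (x i) - u (x j)\<bar> else 0)
       \<le> e * (if adjacent Basis (\<sigma> i) (\<sigma> j) then 1 else 0) + C2 * ?W i j"
      using C2 int0 by auto
  qed
  also have "\<dots> = e * (\<Sum>i\<in>?I. \<Sum>j\<in>?I. if adjacent Basis (\<sigma> i) (\<sigma> j) then 1 else 0)
      + C2 * (\<Sum>i\<in>?I. \<Sum>j\<in>?I. ?W i j)"
    by (simp only: sum.distrib sum_distrib_left)
  also have "\<dots> \<le> e * ((3 * N) ^ d * b\<^sup>2) + C2 * (\<Sum>i\<in>?I. \<Sum>j<n. ?W i j)"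
  proof (intro add_mono mult_left_mono C2 sum_mono)
    show "(\<Sum>i\<in>?I. \<Sum>j\<in>?I. if adjacent Basis (\<sigma> i) (\<sigma> j) then 1 else 0) \<le> (3 * N) ^ d * b\<^sup>2"
      by (rule fo2)
    show "(\<Sum>j\<in>?I. ?W i j) \<le> (\<Sum>j<n. ?W i j)" for i
      using int0 by (intro sum_mono2) (auto simp: cube_points_def)
  qed (use pos in auto)
  finally have A: "(\<Sum>i\<in>?I. \<Sum>j\<in>?I. if adjacent Basis (\<sigma> i) (\<sigma> j) then \<bar>u (x i) - u (x j)\<bar> else 0)
     \<le> e * ((3 * N) ^ d * b\<^sup>2) + C2 * (\<Sum>i\<in>?I. \<Sum>j<n. ?W i j)" .
  have "(\<Sum>i\<in>?I. \<Sum>j\<in>?I. \<bar>u (x i) - u (x j)\<bar>) \<le> (b / a)\<^sup>2 * (real (d + 1) * N ^ (d + 1)) *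
     (\<Sum>i\<in>?I. \<Sum>j\<in>?I. if adjacent Basis (\<sigma> i) (\<sigma> j) then \<bar>u (x i) - u (x j)\<bar> else 0)"
    by (rule fo1)
  also have "\<dots> \<le> (b / a)\<^sup>2 * (real (d + 1) * N ^ (d + 1)) * (e * ((3 * N) ^ d * b\<^sup>2) +
        C2 * (\<Sum>i\<in>?I. \<Sum>j<n. ?W i j))"
    by (intro mult_left_mono A) (auto simp: N_def)
  finally show "(\<Sum>i\<in>?I. \<Sum>j\<in>?I. \<bar>u (x i) - u (x j)\<bar>) \<le> \<dots>" .
  have "N ^ d * a = (\<Sum>s\<in>(Basis :: 'a set) \<rightarrow>\<^sub>E {..<2 ^ (m - k) :: nat}. a)"
    by (simp add: card_PiE d_def N_def)
  also have "\<dots> \<le> (\<Sum>s\<in>(Basis :: 'a set) \<rightarrow>\<^sub>E {..<2 ^ (m - k) :: nat}. real (card {i\<in>?I. \<sigma> i = s}))"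
    using fib by (intro sum_mono) auto
  also have "\<dots> = card ?I"
  proof -
    have "(\<Sum>s\<in>(Basis :: 'a set) \<rightarrow>\<^sub>E {..<2 ^ (m - k) :: nat}. \<Sum>i\<in>{i\<in>?I. \<sigma> i = s}. 1::nat) = (\<Sum>i\<in>?I. 1)"
      using \<sigma> by (intro sum.group I(1) finite_PiE) auto
    then show ?thesis by (simp flip: of_nat_sum)
  qed
  finally show "N ^ d * a \<le> card (cube_points x n k z)" .
qed

text \<open>The scaling computation. With \<open>T = 2 ^ k\<close>, each cube has at least
  \<open>\<alpha> * n / T ^ d\<close> points, so its deviation from the mean costs
  \<open>T ^ d / (\<alpha> * n)\<close> times the pair sum. As \<open>b\<close> has the order
  \<open>n / (T * N) ^ d\<close>, the powers of \<open>N\<close> and \<open>e\<close> combine into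
  powers of \<open>N * e\<close>, which is at most \<open>L / T\<close>: the additive error gives
  \<open>n * (N * e)\<close>, the energy \<open>n * T ^ d * (N * e) ^ (d + 1)\<close>, and both are
  of order \<open>n / T\<close>.\<close>

lemma mean_oscillation_le:
  fixes x :: "nat \<Rightarrow> 'a::euclidean_space" and c :: real
  assumes \<zeta>: "admissible_zeta \<zeta>" and p: "1 \<le> p" and q: "0 \<le> q"
    and \<eta>: "\<And>t. 0 \<le> t \<Longrightarrow> 0 \<le> \<eta> t" "antimono_on {0..} \<eta>"
    and pos: "0 < r" "0 < \<eta> r" "0 < e" "0 < M" "0 \<le> K" and uM: "\<And>i. i < n \<Longrightarrow> \<bar>u (x i)\<bar> \<le> M"
    and n: "1 \<le> n" and K: "GMS p q \<zeta> \<eta> x e n u \<le> K"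
    and km: "k \<le> m" and m: "2 * real DIM('a) \<le> r * e * 2 ^ m" "r * e * 2 ^ m \<le> 4 * real DIM('a)"
    and \<alpha>: "0 < \<alpha>" and cnt: "\<And>z. z \<in> inner_cubes \<Omega> m \<Longrightarrow>
       \<alpha> * n / (2 ^ m) ^ DIM('a) \<le> card (cube_points x n m z) \<and>
       card (cube_points x n m z) \<le> \<beta> * n / (2 ^ m) ^ DIM('a)"
    and fin: "finite (inner_cubes \<Omega> k)" and c: "0 < c" "c * card (inner_cubes \<Omega> k) \<le> (2 ^ k) ^ DIM('a)"
  defines "C2 \<equiv> 1 / (\<zeta> 1 * min (r powr - q) (1 / (2 * M)))" and "d \<equiv> DIM('a)"
    and "L \<equiv> 4 * real DIM('a) / r"
  shows "(\<Sum>z\<in>inner_cubes \<Omega> k. \<Sum>i\<in>cube_points x n k z.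
      \<bar>u (x i) - (\<Sum>j\<in>cube_points x n k z. u (x j)) / card (cube_points x n k z)\<bar>)
    \<le> n * ((\<beta> / \<alpha>)\<^sup>2 * real (d + 1) / \<alpha> * (3 ^ d * \<beta>\<^sup>2 / c * L + C2 * K / \<eta> r * L ^ (d + 1)) / 2 ^ k)"
proof -
  let ?I = "cube_points x n k"
  let ?W = "\<lambda>i j. if i \<noteq> j \<and> norm (x i - x j) \<le> r * e then interaction p q \<zeta> x e u i j else 0"
  define H T N where "H = (2::real) ^ m" and "T = (2::real) ^ k" and "N = (2::real) ^ (m - k)"
  have HTN: "0 < H" "0 < T" "0 < N" "H = T * N" using km by (auto simp: H_def T_def N_def simp flip: power_add)
  define a b where "a = \<alpha> * n / H ^ d" and "b = \<beta> * n / H ^ d"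
  define \<kappa> where "\<kappa> = (\<beta> / \<alpha>)\<^sup>2 * real (d + 1)"
  have n0: "0 < real n" using n by simp
  have a0: "0 < a" using \<alpha> n0 HTN by (simp add: a_def)
  have ba: "b / a = \<beta> / \<alpha>" using n0 HTN \<alpha> by (simp add: a_def b_def)
  have \<kappa>0: "0 \<le> \<kappa>" by (simp add: \<kappa>_def)
  have cnt': "a \<le> card (cube_points x n m z) \<and> card (cube_points x n m z) \<le> b" if "z \<in> inner_cubes \<Omega> m" for z
    using cnt[OF that] by (simp add: a_def b_def H_def d_def)
  have z1: "0 < \<zeta> 1" using admissible_zeta_lower[OF \<zeta>] by simp
  have C2: "0 \<le> C2" using z1 pos by (auto simp: C2_def)
  have int0: "0 \<le> interaction p q \<zeta> x e u i j" for i j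
    using \<zeta> by (auto simp: interaction_def admissible_zeta_def)
  note osc = cube_oscillation_le[where x=x and u=u and \<Omega>=\<Omega>, OF \<zeta> p q pos(1,3,4) uM km m(1) a0 cnt', folded C2_def d_def N_def]
  define Z where "Z z = (\<Sum>i\<in>?I z. \<Sum>j<n. ?W i j)" for z
  have Z0: "0 \<le> Z z" for z unfolding Z_def using int0 by (intro sum_nonneg) auto
  define Q where "Q = e * ((3 * N) ^ d * b\<^sup>2)"
  have Q0: "0 \<le> Q" using pos HTN by (simp add: Q_def)
  have one: "(\<Sum>i\<in>?I z. \<bar>u (x i) - (\<Sum>j\<in>?I z. u (x j)) / card (?I z)\<bar>)
     \<le> T ^ d / (\<alpha> * n) * (\<kappa> * N ^ (d + 1) * (Q + C2 * Z z))" if z: "z \<in> inner_cubes \<Omega> k" for z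
  proof -
    have "N ^ d * a = \<alpha> * n / T ^ d" using HTN by (simp add: a_def power_mult_distrib)
    then have card: "\<alpha> * n / T ^ d \<le> card (?I z)" using osc(1)[OF _ _ z] by simp
    have "(\<Sum>i\<in>?I z. \<bar>u (x i) - (\<Sum>j\<in>?I z. u (x j)) / card (?I z)\<bar>)
        \<le> (\<Sum>i\<in>?I z. \<Sum>j\<in>?I z. \<bar>u (x i) - u (x j)\<bar>) / card (?I z)"
      by (rule sum_dev_mean_le) (simp add: cube_points_def)
    also have "\<dots> \<le> (\<kappa> * N ^ (d + 1) * (Q + C2 * Z z)) / (\<alpha> * n / T ^ d)"
    proof (rule frac_le)
      show "(\<Sum>i\<in>?I z. \<Sum>j\<in>?I z. \<bar>u (x i) - u (x j)\<bar>) \<le> \<kappa> * N ^ (d + 1) * (Q + C2 * Z z)"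
        using osc(2)[OF _ _ z] by (simp add: ba \<kappa>_def Q_def Z_def mult.assoc)
      show "0 \<le> \<kappa> * N ^ (d + 1) * (Q + C2 * Z z)" using \<kappa>0 HTN C2 Z0 Q0 by simp
    qed (use card \<alpha> n0 HTN in auto)
    also have "\<dots> = T ^ d / (\<alpha> * n) * (\<kappa> * N ^ (d + 1) * (Q + C2 * Z z))" by simp
    finally show ?thesis .
  qed
  \<comment> \<open>Cubes of one level are disjoint, so every row \<open>i\<close> is counted at
    most once.\<close>
  have ZK: "(\<Sum>z\<in>inner_cubes \<Omega> k. Z z) \<le> K * (real n)\<^sup>2 * e ^ (d + 1) / \<eta> r"
  proof -
    have "(\<Sum>z\<in>inner_cubes \<Omega> k. Z z) = (\<Sum>i\<in>(\<Union>z\<in>inner_cubes \<Omega> k. ?I z). \<Sum>j<n. ?W i j)"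
      unfolding Z_def using fin
      by (intro sum.UNION_disjoint[symmetric]) (auto simp: cube_points_def dyadic_cube_def)
    also have "\<dots> \<le> (\<Sum>i<n. \<Sum>j<n. ?W i j)"
      using int0 by (intro sum_mono2 sum_nonneg) (auto simp: cube_points_def)
    also have "\<dots> \<le> K * (real n)\<^sup>2 * e ^ (d + 1) / \<eta> r"
      unfolding d_def by (rule interaction_sum_le_GMS[OF \<zeta> \<eta> pos(1,2,3) n K])
    finally show ?thesis .
  qed
  have cardle: "card (inner_cubes \<Omega> k) \<le> T ^ d / c"
    using c by (simp add: T_def d_def field_simps)
  \<comment> \<open>Here the upper bound on \<open>2 ^ m\<close> enters: the small cubes must not be
    much smaller than \<open>e\<close>.\<close>
  have Ne: "N * e \<le> L / T"
  proof -
    have "r * e * (T * N) \<le> 4 * real DIM('a)" using m(2) HTN by (simp add: H_def)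
    then show ?thesis using pos HTN by (simp add: L_def field_simps)
  qed
  have "(\<Sum>z\<in>inner_cubes \<Omega> k. \<Sum>i\<in>?I z. \<bar>u (x i) - (\<Sum>j\<in>?I z. u (x j)) / card (?I z)\<bar>)
     \<le> (\<Sum>z\<in>inner_cubes \<Omega> k. T ^ d / (\<alpha> * n) * (\<kappa> * N ^ (d + 1) * (Q + C2 * Z z)))"
    by (rule sum_mono) (rule one)
  also have "\<dots> = T ^ d / (\<alpha> * n) * (\<kappa> * N ^ (d + 1) * (card (inner_cubes \<Omega> k) * Q + C2 * (\<Sum>z\<in>inner_cubes \<Omega> k. Z z)))"
    by (simp only: sum_distrib_left[symmetric] sum.distrib sum_constant)
  also have "\<dots> \<le> T ^ d / (\<alpha> * n) * (\<kappa> * N ^ (d + 1) * (T ^ d / c * Q + C2 * (K * (real n)\<^sup>2 * e ^ (d + 1) / \<eta> r)))"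
    using \<alpha> n0 HTN \<kappa>0 C2 Q0 ZK cardle
    by (intro mult_left_mono add_mono mult_right_mono) auto
  also have "\<dots> = n * (\<kappa> / \<alpha> * (3 ^ d * \<beta>\<^sup>2 / c * (N * e) + C2 * K / \<eta> r * (T ^ d * (N * e) ^ (d + 1))))"
    using HTN n0 \<alpha> c pos
    by (simp add: Q_def b_def power_mult_distrib power2_eq_square field_simps)
  also have "\<dots> \<le> n * (\<kappa> / \<alpha> * (3 ^ d * \<beta>\<^sup>2 / c * (L / T) + C2 * K / \<eta> r * (T ^ d * (L / T) ^ (d + 1))))"
    using Ne n0 \<kappa>0 \<alpha> c C2 pos HTN
    by (intro mult_left_mono add_mono power_mono) auto
  also have "T ^ d * (L / T) ^ (d + 1) = L ^ (d + 1) / T"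
    using HTN by (simp add: power_divide)
  also have "n * (\<kappa> / \<alpha> * (3 ^ d * \<beta>\<^sup>2 / c * (L / T) + C2 * K / \<eta> r * (L ^ (d + 1) / T)))
    = n * (\<kappa> / \<alpha> * (3 ^ d * \<beta>\<^sup>2 / c * L + C2 * K / \<eta> r * L ^ (d + 1)) / T)"
    by (simp add: add_divide_distrib ring_distribs)
  finally show ?thesis by (simp add: \<kappa>_def T_def)
qed

section \<open>Couplings adapted to a finite partition\<close>

lemma nn_integral_finite_range:
  fixes \<kappa> :: "'a \<Rightarrow> 'b" and h :: "'b \<Rightarrow> real"
  assumes "finite_measure \<mu>" and sp: "space \<mu> = UNIV" and meas: "\<And>B. \<kappa> -` {B} \<in> sets \<mu>"
    and fin: "finite (range \<kappa>)" and h: "\<And>B. 0 \<le> h B"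
  shows "(\<integral>\<^sup>+x. ennreal (h (\<kappa> x)) \<partial>\<mu>) = ennreal (\<Sum>B\<in>range \<kappa>. h B * measure \<mu> (\<kappa> -` {B}))"
proof -
  interpret finite_measure \<mu> by fact
  have *: "ennreal (h (\<kappa> x)) = (\<Sum>B\<in>range \<kappa>. ennreal (h B) * indicator (\<kappa> -` {B}) x)" for x
  proof -
    have "(\<Sum>B\<in>range \<kappa>. ennreal (h B) * indicator (\<kappa> -` {B}) x)
        = (\<Sum>B\<in>{\<kappa> x}. ennreal (h B) * indicator (\<kappa> -` {B}) x)"
      using fin by (intro sum.mono_neutral_right) (auto simp: indicator_def)
    then show ?thesis by simp
  qed
  show ?thesis unfolding *
    using meas h by (subst nn_integral_sum)
      (auto simp: nn_integral_cmult emeasure_eq_measure ennreal_mult'' sum_ennreal[symmetric])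
qed

text \<open>The label type \<open>'b\<close> carries no sigma-algebra; the finite range reduces
  measurability to indicators of fibres.\<close>

lemma borel_measurable_finite_range_pair:
  fixes \<kappa> :: "'a::euclidean_space \<Rightarrow> 'b" and g :: "'b \<Rightarrow> 'b \<Rightarrow> real"
  assumes meas: "\<And>B. \<kappa> -` {B} \<in> sets borel" and fin: "finite (range \<kappa>)"
  shows "(\<lambda>z. g (\<kappa> (fst z)) (\<kappa> (snd z))) \<in> borel_measurable (borel \<Otimes>\<^sub>M borel)"
proof -
  note [measurable] = meas
  have eq: "g (\<kappa> (fst z)) (\<kappa> (snd z)) = (\<Sum>A\<in>range \<kappa>. \<Sum>B\<in>range \<kappa>.
      g A B * (indicator (\<kappa> -` {A}) (fst z) * indicator (\<kappa> -` {B}) (snd z)))" for z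
  proof -
    have "(\<Sum>A\<in>range \<kappa>. \<Sum>B\<in>range \<kappa>.
      g A B * (indicator (\<kappa> -` {A}) (fst z) * indicator (\<kappa> -` {B}) (snd z)))
      = (\<Sum>A\<in>{\<kappa> (fst z)}. \<Sum>B\<in>range \<kappa>.
      g A B * (indicator (\<kappa> -` {A}) (fst z) * indicator (\<kappa> -` {B}) (snd z)))"
      using fin by (intro sum.mono_neutral_right) (auto simp: indicator_def)
    also have "\<dots> = (\<Sum>A\<in>{\<kappa> (fst z)}. \<Sum>B\<in>{\<kappa> (snd z)}.
      g A B * (indicator (\<kappa> -` {A}) (fst z) * indicator (\<kappa> -` {B}) (snd z)))"
      using fin by (intro sum.cong refl sum.mono_neutral_right) (auto simp: indicator_def)
    finally show ?thesis by simp
  qed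
  show ?thesis unfolding eq by measurable
qed

lemma borel_measurable_finite_range:
  fixes \<kappa> :: "'a::euclidean_space \<Rightarrow> 'b" and w :: "'b \<Rightarrow> real"
  assumes "\<And>B. \<kappa> -` {B} \<in> sets borel" "finite (range \<kappa>)"
  shows "(\<lambda>x. w (\<kappa> x)) \<in> borel_measurable borel"
proof -
  have "(\<lambda>x::'a. (x, x)) \<in> borel \<rightarrow>\<^sub>M borel \<Otimes>\<^sub>M borel"
    by (intro measurable_Pair measurable_ident_sets refl)
  from measurable_compose[OF this borel_measurable_finite_range_pair[OF assms, of "\<lambda>A B. w A"]]
  show ?thesis by simp
qed

lemma sets_finite_range_disagree:
  fixes \<kappa> :: "'a::euclidean_space \<Rightarrow> 'b"
  assumes "\<And>B. \<kappa> -` {B} \<in> sets borel" "finite (range \<kappa>)"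
  shows "{z. \<kappa> (fst z) \<noteq> \<kappa> (snd z)} \<in> sets (borel \<Otimes>\<^sub>M borel)"
proof -
  have "(\<lambda>z. of_bool (\<kappa> (fst z) \<noteq> \<kappa> (snd z)) :: real) -` {1} \<inter> space (borel \<Otimes>\<^sub>M borel)
      \<in> sets (borel \<Otimes>\<^sub>M borel)"
    by (intro measurable_sets[OF borel_measurable_finite_range_pair[OF assms]]) auto
  also have "(\<lambda>z. of_bool (\<kappa> (fst z) \<noteq> \<kappa> (snd z)) :: real) -` {1} \<inter> space (borel \<Otimes>\<^sub>M borel)
      = {z. \<kappa> (fst z) \<noteq> \<kappa> (snd z)}"
    by (auto simp: space_pair_measure)
  finally show ?thesis .
qed

text \<open>The coupling has density \<open>\<theta> / \<mu> A + (1 - \<theta> \<nu> A / \<mu> A)\<close> on \<open>A \<times> A\<close> and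
  \<open>1 - \<theta> \<nu> A / \<mu> A\<close> on \<open>A \<times> B\<close> with respect to the product measure, for fibres \<open>A \<noteq> B\<close> of \<open>\<kappa>\<close>.\<close>

lemma coupling_of_partition:
  fixes \<mu> \<nu> :: "'a::euclidean_space measure" and \<kappa> :: "'a \<Rightarrow> 'b"
  assumes "prob_space \<mu>" "prob_space \<nu>" and s: "sets \<mu> = sets borel" "sets \<nu> = sets borel"
    and meas: "\<And>B. \<kappa> -` {B} \<in> sets borel" and fin: "finite (range \<kappa>)"
    and \<theta>: "0 \<le> \<theta>" "\<theta> \<le> 1"
    and le: "\<And>B. \<theta> * measure \<nu> (\<kappa> -` {B}) \<le> measure \<mu> (\<kappa> -` {B})"
  shows "\<exists>\<pi>\<in>couplings \<mu> \<nu>. emeasure \<pi> {z. \<kappa> (fst z) \<noteq> \<kappa> (snd z)} \<le> ennreal (1 - \<theta>)"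
proof -
  interpret M: prob_space \<mu> by fact
  interpret N: prob_space \<nu> by fact
  interpret pair_sigma_finite \<mu> \<nu> ..
  have sp: "space \<mu> = UNIV" "space \<nu> = UNIV"
    using sets_eq_imp_space_eq[OF s(1)] sets_eq_imp_space_eq[OF s(2)] by auto
  have sP[measurable_cong]: "sets (\<mu> \<Otimes>\<^sub>M \<nu>) = sets (borel \<Otimes>\<^sub>M borel)"
    by (intro sets_pair_measure_cong s)
  note [measurable_cong] = s
  define m v where "m B = measure \<mu> (\<kappa> -` {B})" and "v B = measure \<nu> (\<kappa> -` {B})" for B
  have le': "\<theta> * v B \<le> m B" for B using le by (simp add: m_def v_def)
  have m0: "0 \<le> m B" and v0: "0 \<le> v B" for B by (auto simp: m_def v_def)
  \<comment> \<open>The coupling keeps the mass \<open>\<theta> * v A\<close> inside each fibre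
    \<open>A\<close> and spreads the rest, the fraction \<open>l A\<close> of the mass of
    \<open>A\<close>, according to \<open>\<nu>\<close>. If \<open>m A = 0\<close>, division by zero
    gives \<open>l A = 1\<close>, and the row still integrates to 1.\<close>
  define l where "l A = 1 - \<theta> * v A / m A" for A
  define g where "g A B = (if A = B then \<theta> / m A else 0) + l A" for A B
  have l0: "0 \<le> l A" for A
    using le'[of A] m0[of A] by (cases "m A = 0") (auto simp: l_def)
  have g0: "0 \<le> g A B" for A B using l0 \<theta> m0 by (simp add: g_def)
  note nM = nn_integral_finite_range[OF M.finite_measure_axioms sp(1) _ fin, unfolded s(1), OF meas]
  note nN = nn_integral_finite_range[OF N.finite_measure_axioms sp(2) _ fin, unfolded s(2), OF meas]
  have sumv: "(\<Sum>B\<in>range \<kappa>. v B) = 1"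
  proof -
    have "ennreal (\<Sum>B\<in>range \<kappa>. v B) = 1"
      using nN[of "\<lambda>_. 1"] by (simp add: v_def N.emeasure_space_1)
    then show ?thesis by simp
  qed
  have summ: "(\<Sum>B\<in>range \<kappa>. m B) = 1"
  proof -
    have "ennreal (\<Sum>B\<in>range \<kappa>. m B) = 1"
      using nM[of "\<lambda>_. 1"] by (simp add: m_def M.emeasure_space_1)
    then show ?thesis by simp
  qed
  have suml: "(\<Sum>A\<in>range \<kappa>. l A * m A) = 1 - \<theta>"
  proof -
    have "l A * m A = m A - \<theta> * v A" for A
      using le'[of A] \<theta> v0[of A] by (cases "m A = 0") (auto simp: l_def field_simps mult_le_0_iff intro!: antisym)
    then show ?thesis by (simp add: sum_subtractf summ sumv flip: sum_distrib_left)
  qed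
  define f where "f z = ennreal (g (\<kappa> (fst z)) (\<kappa> (snd z)))" for z
  have f[measurable]: "f \<in> borel_measurable (borel \<Otimes>\<^sub>M borel)"
    unfolding f_def using borel_measurable_finite_range_pair[OF meas fin, of g] by measurable
  have fst1: "(\<integral>\<^sup>+y. f (x, y) \<partial>\<nu>) = 1" for x
  proof -
    have "(\<integral>\<^sup>+y. f (x, y) \<partial>\<nu>) = ennreal (\<Sum>B\<in>range \<kappa>. g (\<kappa> x) B * v B)"
      unfolding f_def using nN[of "g (\<kappa> x)"] g0 by (simp add: v_def)
    also have "(\<Sum>B\<in>range \<kappa>. g (\<kappa> x) B * v B)
        = (\<Sum>B\<in>range \<kappa>. if \<kappa> x = B then \<theta> / m (\<kappa> x) * v B else 0) + l (\<kappa> x) * (\<Sum>B\<in>range \<kappa>. v B)"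
      unfolding sum_distrib_left sum.distrib[symmetric]
      by (intro sum.cong refl) (auto simp: g_def algebra_simps)
    also have "\<dots> = 1" using fin by (simp add: sumv l_def)
    finally show ?thesis by simp
  qed
  \<comment> \<open>Only almost everywhere: for \<open>v B > 0\<close>, \<open>le'\<close> forces
    \<open>m B > 0\<close> or \<open>\<theta> = 0\<close>, whereas on a fibre with
    \<open>m B = v B = 0\<close> the integral is \<open>1 - \<theta>\<close>.\<close>
  have snd1: "AE y in \<nu>. (\<integral>\<^sup>+x. f (x, y) \<partial>\<mu>) = 1"
  proof -
    have "AE y in \<nu>. \<forall>B\<in>range \<kappa>. \<kappa> y = B \<longrightarrow> v B \<noteq> 0"
    proof (rule AE_finite_allI[OF fin])
      fix B
      show "AE y in \<nu>. \<kappa> y = B \<longrightarrow> v B \<noteq> 0"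
      proof (cases "v B = 0")
        case True
        then have "\<kappa> -` {B} \<in> null_sets \<nu>"
          using meas by (auto simp: v_def null_sets_def N.emeasure_eq_measure s)
        then show ?thesis by (rule AE_I') auto
      qed auto
    qed
    then show ?thesis
    proof (rule eventually_mono)
      fix y assume "\<forall>B\<in>range \<kappa>. \<kappa> y = B \<longrightarrow> v B \<noteq> 0"
      then have vy: "v (\<kappa> y) > 0" using v0[of "\<kappa> y"] by (simp add: order_less_le)
      have "(\<integral>\<^sup>+x. f (x, y) \<partial>\<mu>) = ennreal (\<Sum>A\<in>range \<kappa>. g A (\<kappa> y) * m A)"
        unfolding f_def using nM[of "\<lambda>A. g A (\<kappa> y)"] g0 by (simp add: m_def)
      also have "(\<Sum>A\<in>range \<kappa>. g A (\<kappa> y) * m A)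
        = (\<Sum>A\<in>range \<kappa>. if A = \<kappa> y then \<theta> / m (\<kappa> y) * m A else 0) + (\<Sum>A\<in>range \<kappa>. l A * m A)"
        unfolding sum.distrib[symmetric]
        by (intro sum.cong refl) (auto simp: g_def algebra_simps)
      also have "\<dots> = 1"
        using fin suml le'[of "\<kappa> y"] vy \<theta> by (auto simp: mult_le_0_iff)
      finally show "(\<integral>\<^sup>+x. f (x, y) \<partial>\<mu>) = 1" by simp
    qed
  qed
  define \<pi> where "\<pi> = density (\<mu> \<Otimes>\<^sub>M \<nu>) f"
  have s\<pi>[measurable_cong]: "sets \<pi> = sets (borel \<Otimes>\<^sub>M borel)" by (simp add: \<pi>_def sP)
  have sp\<pi>: "space \<pi> = UNIV" using sets_eq_imp_space_eq[OF s\<pi>] by (simp add: space_pair_measure)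
  have "distr \<pi> borel fst = \<mu>"
  proof (rule measure_eqI)
    fix A assume "A \<in> sets (distr \<pi> borel fst)"
    then have A[measurable]: "A \<in> sets borel" by simp
    have "emeasure (distr \<pi> borel fst) A = emeasure \<pi> (fst -` A)"
      by (subst emeasure_distr) (auto simp: sp\<pi>)
    also have "\<dots> = (\<integral>\<^sup>+z. f z * indicator A (fst z) \<partial>(\<mu> \<Otimes>\<^sub>M \<nu>))"
    proof -
      have "fst -` A \<inter> space (\<mu> \<Otimes>\<^sub>M \<nu>) \<in> sets (\<mu> \<Otimes>\<^sub>M \<nu>)" by measurable
      then have "fst -` A \<in> sets (\<mu> \<Otimes>\<^sub>M \<nu>)" by (simp add: space_pair_measure sp)
      then show ?thesis unfolding \<pi>_def
        by (subst emeasure_density) (auto simp: sP indicator_def intro!: nn_integral_cong)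
    qed
    also have "\<dots> = (\<integral>\<^sup>+x. \<integral>\<^sup>+y. f (x, y) * indicator A x \<partial>\<nu> \<partial>\<mu>)"
      by (subst N.nn_integral_fst[symmetric]) auto
    also have "\<dots> = (\<integral>\<^sup>+x. indicator A x \<partial>\<mu>)"
      by (intro nn_integral_cong, subst nn_integral_multc) (auto simp: fst1)
    also have "\<dots> = emeasure \<mu> A" by (simp add: s)
    finally show "emeasure (distr \<pi> borel fst) A = emeasure \<mu> A" .
  qed (simp add: s)
  moreover have "distr \<pi> borel snd = \<nu>"
  proof (rule measure_eqI)
    fix A assume "A \<in> sets (distr \<pi> borel snd)"
    then have A[measurable]: "A \<in> sets borel" by simp
    have "emeasure (distr \<pi> borel snd) A = emeasure \<pi> (snd -` A)"
      by (subst emeasure_distr) (auto simp: sp\<pi>)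
    also have "\<dots> = (\<integral>\<^sup>+z. f z * indicator A (snd z) \<partial>(\<mu> \<Otimes>\<^sub>M \<nu>))"
    proof -
      have "snd -` A \<inter> space (\<mu> \<Otimes>\<^sub>M \<nu>) \<in> sets (\<mu> \<Otimes>\<^sub>M \<nu>)" by measurable
      then have "snd -` A \<in> sets (\<mu> \<Otimes>\<^sub>M \<nu>)" by (simp add: space_pair_measure sp)
      then show ?thesis unfolding \<pi>_def
        by (subst emeasure_density) (auto simp: sP indicator_def intro!: nn_integral_cong)
    qed
    also have "\<dots> = (\<integral>\<^sup>+y. \<integral>\<^sup>+x. f (x, y) * indicator A y \<partial>\<mu> \<partial>\<nu>)"
      by (subst nn_integral_snd[symmetric]) auto
    also have "\<dots> = (\<integral>\<^sup>+y. indicator A y \<partial>\<nu>)"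
    proof (rule nn_integral_cong_AE, use snd1 in eventually_elim)
      case (elim y)
      then show ?case by (subst nn_integral_multc) auto
    qed
    also have "\<dots> = emeasure \<nu> A" by (simp add: s)
    finally show "emeasure (distr \<pi> borel snd) A = emeasure \<nu> A" .
  qed (simp add: s)
  ultimately have "\<pi> \<in> couplings \<mu> \<nu>" by (simp add: couplings_def s\<pi>)
  moreover have "emeasure \<pi> {z. \<kappa> (fst z) \<noteq> \<kappa> (snd z)} \<le> ennreal (1 - \<theta>)"
  proof -
    let ?E = "{z. \<kappa> (fst z) \<noteq> \<kappa> (snd z)}"
    have lm: "(\<lambda>x. l (\<kappa> x)) \<in> borel_measurable borel"
      by (rule borel_measurable_finite_range[OF meas fin])
    have E: "?E \<in> sets (borel \<Otimes>\<^sub>M borel)"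
      by (rule sets_finite_range_disagree[OF meas fin])
    have "emeasure \<pi> ?E = (\<integral>\<^sup>+z. f z * indicator ?E z \<partial>(\<mu> \<Otimes>\<^sub>M \<nu>))"
      unfolding \<pi>_def using E by (subst emeasure_density) (auto simp: sP)
    \<comment> \<open>Off the diagonal blocks only the spread part \<open>l\<close> is present; its
      total mass is \<open>1 - \<theta>\<close> by \<open>suml\<close>.\<close>
    also have "\<dots> \<le> (\<integral>\<^sup>+z. ennreal (l (\<kappa> (fst z))) \<partial>(\<mu> \<Otimes>\<^sub>M \<nu>))"
      by (intro nn_integral_mono) (auto simp: f_def g_def indicator_def)
    also have "\<dots> = (\<integral>\<^sup>+x. \<integral>\<^sup>+y. ennreal (l (\<kappa> x)) \<partial>\<nu> \<partial>\<mu>)"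
      using lm by (subst N.nn_integral_fst[symmetric]) auto
    also have "\<dots> = (\<integral>\<^sup>+x. ennreal (l (\<kappa> x)) \<partial>\<mu>)"
      by (simp add: N.emeasure_space_1)
    also have "\<dots> = ennreal (1 - \<theta>)"
      using nM[of l] l0 suml by (simp add: m_def)
    finally show ?thesis .
  qed
  ultimately show ?thesis by blast
qed

section \<open>Compactness in $TL^1$ from approximation by step functions\<close>

text \<open>Bolzano-Weierstrass for one index at a time, and the diagonal sequence over an
  enumeration of \<open>I\<close>.\<close>

lemma diagonal_convergent_subsequence:
  fixes f :: "nat \<Rightarrow> 'i \<Rightarrow> real"
  assumes I: "countable I" and bd: "\<And>n i. i \<in> I \<Longrightarrow> \<bar>f n i\<bar> \<le> M"
  shows "\<exists>s. strict_mono (s :: nat \<Rightarrow> nat) \<and> (\<forall>i\<in>I. convergent (\<lambda>n. f (s n) i))"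
proof (cases "I = {}")
  case True
  then show ?thesis using strict_mono_id by blast
next
  case False
  interpret subseqs "\<lambda>k s. convergent (\<lambda>n. f (s n) (from_nat_into I k))"
  proof
    fix k and s :: "nat \<Rightarrow> nat"
    have "bounded (range (\<lambda>n. f (s n) (from_nat_into I k)))"
      using bd[OF from_nat_into[OF False]] by (intro boundedI[of _ M]) auto
    then obtain l r where "strict_mono r" "((\<lambda>n. f (s n) (from_nat_into I k)) \<circ> r) \<longlonglongrightarrow> l"
      using bounded_imp_convergent_subsequence by blast
    then show "\<exists>r. strict_mono r \<and> convergent (\<lambda>n. f ((s \<circ> r) n) (from_nat_into I k))"
      by (auto simp: convergent_def o_def)
  qed
  have "convergent (\<lambda>n. f (diagseq n) i)" if i: "i \<in> I" for i
  proof -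
    obtain k where k: "i = from_nat_into I k"
      using from_nat_into_surj[OF I i] by metis
    \<comment> \<open>From position \<open>Suc k\<close> on, the diagonal sequence is a subsequence
      of the one selected for index number \<open>k\<close>.\<close>
    have "convergent (\<lambda>n. f ((diagseq \<circ> (+) (Suc k)) n) (from_nat_into I k))"
    proof (rule diagseq_holds)
      fix r s :: "nat \<Rightarrow> nat" and j
      assume "strict_mono r" "convergent (\<lambda>n. f (s n) (from_nat_into I j))"
      then show "convergent (\<lambda>n. f ((s \<circ> r) n) (from_nat_into I j))"
        using convergent_subseq_convergent[of "\<lambda>n. f (s n) (from_nat_into I j)" r] by (simp add: o_def)
    qed
    then have "convergent (\<lambda>n. f (diagseq (n + Suc k)) i)" by (simp add: k add.commute)
    then show ?thesis using convergent_ignore_initial_segment[of "\<lambda>n. f (diagseq n) i" "Suc k"] by blast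
  qed
  then show ?thesis using subseq_diagseq by blast
qed

text \<open>The cost under the coupling of \<open>coupling_of_partition\<close> splits by its
  source. Within a common cell the distance is at most \<open>r\<close>, or at most \<open>D\<close>
  if \<open>y \<in> E\<close>, and the step values differ by at most \<open>\<tau>\<close>. On pairs
  in different cells, of mass at most \<open>1 - \<theta>\<close>, distance and step values cost at
  most \<open>D + 2 * M\<close>. The two integrals replace \<open>u\<close> and \<open>g\<close> by
  step functions. \<open>E\<close> will be the boundary cell.\<close>

lemma TL1_dist_le_partition:
  fixes \<mu> \<nu> :: "'a::euclidean_space measure" and \<kappa> :: "'a \<Rightarrow> 'b" and h h' :: "'b \<Rightarrow> real"
  assumes pr: "prob_space \<mu>" "prob_space \<nu>" and s: "sets \<mu> = sets borel" "sets \<nu> = sets borel"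
    and meas: "\<And>B. \<kappa> -` {B} \<in> sets borel" and fin: "finite (range \<kappa>)"
    and \<theta>: "0 \<le> \<theta>" "\<theta> \<le> 1"
    and le: "\<And>B. \<theta> * measure \<nu> (\<kappa> -` {B}) \<le> measure \<mu> (\<kappa> -` {B})"
    and u[measurable]: "u \<in> borel_measurable borel" and g[measurable]: "g \<in> borel_measurable borel"
    and AE: "AE x in \<mu>. x \<in> \<Omega>" "AE x in \<nu>. x \<in> \<Omega>"
    and D: "\<And>x y. x \<in> \<Omega> \<Longrightarrow> y \<in> \<Omega> \<Longrightarrow> norm (x - y) \<le> D" "0 \<le> D"
    and M: "\<And>B. \<bar>h B\<bar> \<le> M" "\<And>B. \<bar>h' B\<bar> \<le> M"
    and \<tau>: "\<And>B. B \<in> range \<kappa> \<Longrightarrow> \<bar>h B - h' B\<bar> \<le> \<tau>"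
    and E[measurable]: "E \<in> sets borel"
    and r: "\<And>x y. x \<in> \<Omega> \<Longrightarrow> y \<in> \<Omega> \<Longrightarrow> \<kappa> x = \<kappa> y \<Longrightarrow> y \<notin> E \<Longrightarrow> norm (x - y) \<le> r" and r0: "0 \<le> r"
  shows "TL1_dist (\<mu>, u) (\<nu>, g) \<le> ennreal (r + \<tau>) + ennreal D * emeasure \<nu> E +
     ennreal (D + 2 * M) * ennreal (1 - \<theta>) + (\<integral>\<^sup>+x. ennreal \<bar>u x - h (\<kappa> x)\<bar> \<partial>\<mu>) +
     (\<integral>\<^sup>+y. ennreal \<bar>h' (\<kappa> y) - g y\<bar> \<partial>\<nu>)"
proof -
  interpret N: prob_space \<nu> by fact
  obtain \<pi> where \<pi>: "\<pi> \<in> couplings \<mu> \<nu>"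
    and ne: "emeasure \<pi> {z. \<kappa> (fst z) \<noteq> \<kappa> (snd z)} \<le> ennreal (1 - \<theta>)"
    using coupling_of_partition[OF pr s meas fin \<theta> le] by blast
  have s\<pi>[measurable_cong]: "sets \<pi> = sets (borel \<Otimes>\<^sub>M borel)"
    and d: "distr \<pi> borel fst = \<mu>" "distr \<pi> borel snd = \<nu>" using \<pi> by (auto simp: couplings_def)
  have sp\<pi>: "space \<pi> = UNIV" using sets_eq_imp_space_eq[OF s\<pi>] by (simp add: space_pair_measure)
  have fs[measurable]: "fst \<in> \<pi> \<rightarrow>\<^sub>M borel" "snd \<in> \<pi> \<rightarrow>\<^sub>M borel" by measurable
  have M0: "0 \<le> M" using M(1)[of undefined] by linarith
  have \<tau>0: "0 \<le> \<tau>" using \<tau>[of "\<kappa> undefined"] by force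
  have mass: "emeasure \<pi> UNIV = 1"
    using N.emeasure_space_1 unfolding d(2)[symmetric] by (simp add: emeasure_distr sp\<pi>)
  note [measurable] = borel_measurable_finite_range[OF meas fin, of h] borel_measurable_finite_range[OF meas fin, of h']
  let ?N = "{z. \<kappa> (fst z) \<noteq> \<kappa> (snd z)}"
  have N[measurable]: "?N \<in> sets \<pi>"
    using sets_finite_range_disagree[OF meas fin] by (simp add: s\<pi>)
  have "AE z in \<pi>. fst z \<in> \<Omega>" using AE(1) unfolding d(1)[symmetric] by (rule AE_distrD[OF fs(1)])
  moreover have "AE z in \<pi>. snd z \<in> \<Omega>" using AE(2) unfolding d(2)[symmetric] by (rule AE_distrD[OF fs(2)])
  ultimately have pw: "AE z in \<pi>. (case z of (x, y) \<Rightarrow> ennreal (norm (x - y) + \<bar>u x - g y\<bar>)) \<le>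
      ennreal (r + \<tau>) + ennreal D * indicator E (snd z) + ennreal (D + 2 * M) * indicator ?N z +
      ennreal \<bar>u (fst z) - h (\<kappa> (fst z))\<bar> + ennreal \<bar>h' (\<kappa> (snd z)) - g (snd z)\<bar>"
  proof eventually_elim
    case (elim z)
    obtain x y where z: "z = (x, y)" by (cases z)
    have xy: "x \<in> \<Omega>" "y \<in> \<Omega>" using elim z by auto
    have "norm (x - y) + \<bar>u x - g y\<bar> \<le> (r + \<tau>) + D * indicator E y + (D + 2 * M) * indicator ?N z
        + \<bar>u x - h (\<kappa> x)\<bar> + \<bar>h' (\<kappa> y) - g y\<bar>"
    proof (cases "\<kappa> x = \<kappa> y")
      case True
      have "norm (x - y) \<le> r + D * indicator E y"
        using r[OF xy True] D(1)[OF xy] r0 D(2) by (cases "y \<in> E") auto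
      moreover have "\<bar>h (\<kappa> x) - h' (\<kappa> y)\<bar> \<le> \<tau>" using \<tau>[of "\<kappa> x"] True by auto
      ultimately show ?thesis using True by (simp add: z)
    next
      case False
      moreover have "0 \<le> D * indicator E y" using D(2) by simp
      ultimately show ?thesis
        using D(1)[OF xy] M(1)[of "\<kappa> x"] M(2)[of "\<kappa> y"] r0 \<tau>0 by (simp add: z)
    qed
    then have "ennreal (norm (x - y) + \<bar>u x - g y\<bar>) \<le> ennreal ((r + \<tau>) + D * indicator E y + (D + 2 * M) * indicator ?N z
        + \<bar>u x - h (\<kappa> x)\<bar> + \<bar>h' (\<kappa> y) - g y\<bar>)" by (rule ennreal_leI)
    also have "\<dots> = ennreal (r + \<tau>) + ennreal D * indicator E (snd z) + ennreal (D + 2 * M) * indicator ?N z +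
      ennreal \<bar>u (fst z) - h (\<kappa> (fst z))\<bar> + ennreal \<bar>h' (\<kappa> (snd z)) - g (snd z)\<bar>"
      using r0 \<tau>0 D(2) M0 by (simp add: z ennreal_plus ennreal_mult ennreal_indicator)
    finally show ?case by (simp add: z)
  qed
  have "TL1_dist (\<mu>, u) (\<nu>, g) \<le> (\<integral>\<^sup>+(x, y). ennreal (norm (x - y) + \<bar>u x - g y\<bar>) \<partial>\<pi>)"
    unfolding TL1_dist_def using \<pi> by (auto intro!: INF_lower)
  also have "\<dots> \<le> (\<integral>\<^sup>+z. ennreal (r + \<tau>) + ennreal D * indicator E (snd z) + ennreal (D + 2 * M) * indicator ?N z +
      ennreal \<bar>u (fst z) - h (\<kappa> (fst z))\<bar> + ennreal \<bar>h' (\<kappa> (snd z)) - g (snd z)\<bar> \<partial>\<pi>)"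
    by (intro nn_integral_mono_AE pw)
  also have "\<dots> = ennreal (r + \<tau>) + (\<integral>\<^sup>+z. ennreal D * indicator E (snd z) \<partial>\<pi>) + ennreal (D + 2 * M) * emeasure \<pi> ?N +
     (\<integral>\<^sup>+z. ennreal \<bar>u (fst z) - h (\<kappa> (fst z))\<bar> \<partial>\<pi>) + (\<integral>\<^sup>+z. ennreal \<bar>h' (\<kappa> (snd z)) - g (snd z)\<bar> \<partial>\<pi>)"
    by (subst nn_integral_add, measurable)+ (simp add: nn_integral_cmult mass sp\<pi>)
  also have "(\<integral>\<^sup>+z. ennreal D * indicator E (snd z) \<partial>\<pi>) = (\<integral>\<^sup>+y. ennreal D * indicator E y \<partial>\<nu>)"
    unfolding d(2)[symmetric] by (rule nn_integral_distr[symmetric]) measurable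
  also have "\<dots> = ennreal D * emeasure \<nu> E"
    using E by (subst nn_integral_cmult) (auto simp: s intro!: borel_measurable_indicator)
  also have "(\<integral>\<^sup>+z. ennreal \<bar>u (fst z) - h (\<kappa> (fst z))\<bar> \<partial>\<pi>) = (\<integral>\<^sup>+x. ennreal \<bar>u x - h (\<kappa> x)\<bar> \<partial>\<mu>)"
    unfolding d(1)[symmetric] by (rule nn_integral_distr[symmetric]) measurable
  also have "(\<integral>\<^sup>+z. ennreal \<bar>h' (\<kappa> (snd z)) - g (snd z)\<bar> \<partial>\<pi>) = (\<integral>\<^sup>+y. ennreal \<bar>h' (\<kappa> y) - g y\<bar> \<partial>\<nu>)"
    unfolding d(2)[symmetric] by (rule nn_integral_distr[symmetric]) measurable
  finally show ?thesis
    using ne by (elim order_trans) (intro add_mono mult_left_mono order_refl, auto)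
qed

text \<open>The limit is a subsequential limit of the step functions with values
  \<open>\<alpha> k\<close>. \<open>conv\<close> speaks of intersections of cells of two levels
  because the L1 distance of two such step functions is a finite sum over these intersections, hence
  the limit of the corresponding sum for \<open>\<mu> n\<close>, where both are close to the same
  \<open>u n\<close>.\<close>

lemma TL1_tendsto_of_partitions:
  fixes \<mu> :: "nat \<Rightarrow> 'a::euclidean_space measure" and \<nu> :: "'a measure"
    and \<kappa> :: "nat \<Rightarrow> 'a \<Rightarrow> 'b" and a :: "nat \<Rightarrow> nat \<Rightarrow> 'b \<Rightarrow> real" and \<alpha> :: "nat \<Rightarrow> 'b \<Rightarrow> real"
  assumes pr: "\<And>n. prob_space (\<mu> n)" "prob_space \<nu>"
    and s: "\<And>n. sets (\<mu> n) = sets borel" "sets \<nu> = sets borel"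
    and \<Omega>: "bounded \<Omega>" "\<And>n. AE x in \<mu> n. x \<in> \<Omega>" "AE x in \<nu>. x \<in> \<Omega>"
    and u[measurable]: "\<And>n. u n \<in> borel_measurable borel"
    and meas: "\<And>k B. \<kappa> k -` {B} \<in> sets borel" and fin: "\<And>k. finite (range (\<kappa> k))"
    and a: "\<And>k n B. \<bar>a k n B\<bar> \<le> M" and \<alpha>: "\<And>k B. \<bar>\<alpha> k B\<bar> \<le> M"
    and lim: "\<And>k B. B \<in> range (\<kappa> k) \<Longrightarrow> (\<lambda>n. a k n B) \<longlonglongrightarrow> \<alpha> k B"
    and conv: "\<And>k l A B. (\<lambda>n. measure (\<mu> n) (\<kappa> k -` {A} \<inter> \<kappa> l -` {B})) \<longlonglongrightarrow> measure \<nu> (\<kappa> k -` {A} \<inter> \<kappa> l -` {B})"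
    and osc: "\<And>k. \<forall>\<^sub>F n in sequentially. (\<integral>\<^sup>+x. ennreal \<bar>u n x - a k n (\<kappa> k x)\<bar> \<partial>\<mu> n) \<le> ennreal (\<delta> k)"
    and \<delta>: "\<And>k. 0 \<le> \<delta> k" "\<delta> \<longlonglongrightarrow> 0"
    and E: "\<And>k. E k \<in> sets borel" "(\<lambda>k. measure \<nu> (E k)) \<longlonglongrightarrow> 0"
    and r: "\<And>k x y. x \<in> \<Omega> \<Longrightarrow> y \<in> \<Omega> \<Longrightarrow> \<kappa> k x = \<kappa> k y \<Longrightarrow> y \<notin> E k \<Longrightarrow> norm (x - y) \<le> r k"
      "\<And>k. 0 \<le> r k" "r \<longlonglongrightarrow> 0"
  shows "\<exists>g. g \<in> borel_measurable borel \<and> integrable \<nu> g \<and> (\<lambda>n. TL1_dist (\<mu> n, u n) (\<nu>, g)) \<longlonglongrightarrow> 0"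
proof -
  interpret N: prob_space \<nu> by fact
  have sp: "space (\<mu> n) = UNIV" "space \<nu> = UNIV" for n
    using sets_eq_imp_space_eq[OF s(1)[of n]] sets_eq_imp_space_eq[OF s(2)] by auto
  have fm: "finite_measure (\<mu> n)" for n using pr(1)[of n] by (simp add: prob_space_def)
  note [measurable_cong] = s
  have M0: "0 \<le> M" using \<alpha>[of 0 undefined] by linarith
  define gk where "gk k y = \<alpha> k (\<kappa> k y)" for k y
  have [measurable]: "gk k \<in> borel_measurable borel" for k 
    unfolding gk_def by (rule borel_measurable_finite_range[OF meas fin])
  have [measurable]: "(\<lambda>x. a k n (\<kappa> k x)) \<in> borel_measurable borel" for k n 
    by (rule borel_measurable_finite_range[OF meas fin])
  have cauchy: "(\<integral>\<^sup>+y. ennreal \<bar>gk k y - gk l y\<bar> \<partial>\<nu>) \<le> ennreal (\<delta> k + \<delta> l)" for k l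
  proof -
    define \<kappa>' where "\<kappa>' x = (\<kappa> k x, \<kappa> l x)" for x
    have vim: "\<kappa>' -` {B} = \<kappa> k -` {fst B} \<inter> \<kappa> l -` {snd B}" for B by (auto simp: \<kappa>'_def)
    have fin': "finite (range \<kappa>')"
      by (rule finite_subset[of _ "range (\<kappa> k) \<times> range (\<kappa> l)"]) (auto simp: \<kappa>'_def fin)
    have meas': "\<kappa>' -` {B} \<in> sets borel" for B unfolding vim using meas by auto
    have eq: "(\<integral>\<^sup>+y. ennreal \<bar>gk k y - gk l y\<bar> \<partial>\<nu>)
        = ennreal (\<Sum>B\<in>range \<kappa>'. \<bar>\<alpha> k (fst B) - \<alpha> l (snd B)\<bar> * measure \<nu> (\<kappa>' -` {B}))"
      using nn_integral_finite_range[OF N.finite_measure_axioms sp(2) _ fin', of "\<lambda>B. \<bar>\<alpha> k (fst B) - \<alpha> l (snd B)\<bar>"] meas'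
      by (simp add: gk_def \<kappa>'_def s)
    have eqn: "(\<integral>\<^sup>+x. ennreal \<bar>a k n (\<kappa> k x) - a l n (\<kappa> l x)\<bar> \<partial>\<mu> n)
        = ennreal (\<Sum>B\<in>range \<kappa>'. \<bar>a k n (fst B) - a l n (snd B)\<bar> * measure (\<mu> n) (\<kappa>' -` {B}))" for n
      using nn_integral_finite_range[OF fm sp(1) _ fin', of n "\<lambda>B. \<bar>a k n (fst B) - a l n (snd B)\<bar>"] meas'
      by (simp add: \<kappa>'_def s)
    have "(\<lambda>n. \<Sum>B\<in>range \<kappa>'. \<bar>a k n (fst B) - a l n (snd B)\<bar> * measure (\<mu> n) (\<kappa>' -` {B}))
        \<longlonglongrightarrow> (\<Sum>B\<in>range \<kappa>'. \<bar>\<alpha> k (fst B) - \<alpha> l (snd B)\<bar> * measure \<nu> (\<kappa>' -` {B}))"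
      unfolding vim using conv by (intro tendsto_intros lim) (auto simp: \<kappa>'_def)
    moreover have "\<forall>\<^sub>F n in sequentially.
        (\<Sum>B\<in>range \<kappa>'. \<bar>a k n (fst B) - a l n (snd B)\<bar> * measure (\<mu> n) (\<kappa>' -` {B})) \<le> \<delta> k + \<delta> l"
      using osc[of k] osc[of l]
    proof eventually_elim
      case (elim n)
      have "(\<integral>\<^sup>+x. ennreal \<bar>a k n (\<kappa> k x) - a l n (\<kappa> l x)\<bar> \<partial>\<mu> n)
        \<le> (\<integral>\<^sup>+x. ennreal \<bar>u n x - a k n (\<kappa> k x)\<bar> + ennreal \<bar>u n x - a l n (\<kappa> l x)\<bar> \<partial>\<mu> n)"
        by (intro nn_integral_mono) (auto simp flip: ennreal_plus intro!: ennreal_leI)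
      also have "\<dots> = (\<integral>\<^sup>+x. ennreal \<bar>u n x - a k n (\<kappa> k x)\<bar> \<partial>\<mu> n)
          + (\<integral>\<^sup>+x. ennreal \<bar>u n x - a l n (\<kappa> l x)\<bar> \<partial>\<mu> n)"
        by (rule nn_integral_add) measurable
      also have "\<dots> \<le> ennreal (\<delta> k) + ennreal (\<delta> l)" using elim by (rule add_mono)
      finally show ?case using \<delta>(1) unfolding eqn by (simp flip: ennreal_plus)
    qed
    ultimately have "(\<Sum>B\<in>range \<kappa>'. \<bar>\<alpha> k (fst B) - \<alpha> l (snd B)\<bar> * measure \<nu> (\<kappa>' -` {B})) \<le> \<delta> k + \<delta> l"
      by (rule tendsto_upperbound) simp
    then show ?thesis unfolding eq by (rule ennreal_leI)
  qed
  have int: "integrable \<nu> (gk k)" for k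
    by (rule N.integrable_const_bound[of _ M]) (auto simp: gk_def \<alpha>)
  \<comment> \<open>A Cauchy sequence in L1 has an almost everywhere Cauchy subsequence; its
    pointwise limit becomes the limit function, and the common bound \<open>M\<close> turns
    pointwise into L1 convergence.\<close>
  obtain t where t: "strict_mono t" "AE x in \<nu>. Cauchy (\<lambda>i. gk (t i) x)"
  proof (rule cauchy_L1_AE_cauchy_subseq[of \<nu> gk])
    fix e :: real assume "e > 0"
    then have "\<forall>\<^sub>F k in sequentially. \<delta> k < e / 2" using order_tendstoD(2)[OF \<delta>(2), of "e / 2"] by simp
    then obtain K where K: "\<And>k. k \<ge> K \<Longrightarrow> \<delta> k < e / 2" by (auto simp: eventually_sequentially)
    have "LINT x|\<nu>. norm (gk i x - gk j x) < e" if "i \<ge> K" "j \<ge> K" for i j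
    proof -
      have "ennreal (LINT x|\<nu>. \<bar>gk i x - gk j x\<bar>) = (\<integral>\<^sup>+x. ennreal \<bar>gk i x - gk j x\<bar> \<partial>\<nu>)"
        using int by (subst nn_integral_eq_integral) auto
      also have "\<dots> \<le> ennreal (\<delta> i + \<delta> j)" by (rule cauchy)
      finally have "(LINT x|\<nu>. \<bar>gk i x - gk j x\<bar>) \<le> \<delta> i + \<delta> j"
        using \<delta>(1)[of i] \<delta>(1)[of j] by (simp add: ennreal_le_iff del: ennreal_plus)
      then show ?thesis using K[OF that(1)] K[OF that(2)] by simp
    qed
    then show "\<exists>K. \<forall>i\<ge>K. \<forall>j\<ge>K. LINT x|\<nu>. norm (gk i x - gk j x) < e" by blast
  qed (use int that in auto)
  define g where "g x = lim (\<lambda>i. gk (t i) x)" for x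
  have g[measurable]: "g \<in> borel_measurable borel" unfolding g_def by measurable
  have tog: "AE x in \<nu>. (\<lambda>i. gk (t i) x) \<longlonglongrightarrow> g x"
    using t(2) by (rule eventually_mono) (auto simp: g_def Cauchy_convergent_iff convergent_LIMSEQ_iff)
  have intg: "integrable \<nu> g"
  proof (rule N.integrable_const_bound[of _ M])
    show "AE x in \<nu>. norm (g x) \<le> M" using tog
    proof eventually_elim
      case (elim x)
      then show ?case by (intro tendsto_upperbound[OF tendsto_norm[OF elim]]) (auto simp: gk_def \<alpha>)
    qed
  qed measurable
  have L1: "(\<lambda>i. \<integral>\<^sup>+x. norm (g x - gk (t i) x) \<partial>\<nu>) \<longlonglongrightarrow> 0"
  proof (rule nn_integral_dominated_convergence_norm[where w="\<lambda>_. M"])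
    show "AE x in \<nu>. norm (gk (t j) x) \<le> M" for j by (simp add: gk_def \<alpha>)
  qed (use tog in \<open>auto simp: N.emeasure_space_1\<close>)
  obtain D where D: "0 \<le> D" "\<And>x y. x \<in> \<Omega> \<Longrightarrow> y \<in> \<Omega> \<Longrightarrow> norm (x - y) \<le> D"
  proof
    show "0 \<le> diameter \<Omega>" using \<Omega>(1) by (rule diameter_ge_0)
    show "norm (x - y) \<le> diameter \<Omega>" if "x \<in> \<Omega>" "y \<in> \<Omega>" for x y
      using diameter_bounded_bound[OF \<Omega>(1) that] by (simp add: dist_norm)
  qed
  have bound: "\<forall>\<^sub>F n in sequentially. TL1_dist (\<mu> n, u n) (\<nu>, g) \<le>
      ennreal (r k + \<tau>) + ennreal D * emeasure \<nu> (E k) + ennreal (D + 2 * M) * ennreal \<tau> +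
      ennreal (\<delta> k) + (\<integral>\<^sup>+x. norm (g x - gk k x) \<partial>\<nu>)" if \<tau>: "0 < \<tau>" "\<tau> < 1" for k \<tau>
  proof -
    have "\<forall>\<^sub>F n in sequentially. \<forall>B\<in>range (\<kappa> k). \<bar>a k n B - \<alpha> k B\<bar> \<le> \<tau>"
    proof (intro eventually_ball_finite fin ballI)
      fix B assume B: "B \<in> range (\<kappa> k)"
      have "\<forall>\<^sub>F n in sequentially. dist (a k n B) (\<alpha> k B) < \<tau>"
        using lim[OF B] \<tau>(1) by (rule tendstoD)
      then show "\<forall>\<^sub>F n in sequentially. \<bar>a k n B - \<alpha> k B\<bar> \<le> \<tau>"
        by (rule eventually_mono) (simp add: dist_real_def)
    qed
    moreover have "\<forall>\<^sub>F n in sequentially. \<forall>B\<in>range (\<kappa> k).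
        (1 - \<tau>) * measure \<nu> (\<kappa> k -` {B}) \<le> measure (\<mu> n) (\<kappa> k -` {B})"
    proof (intro eventually_ball_finite fin ballI)
      fix B
      show "\<forall>\<^sub>F n in sequentially. (1 - \<tau>) * measure \<nu> (\<kappa> k -` {B}) \<le> measure (\<mu> n) (\<kappa> k -` {B})"
      \<comment> \<open>For a cell of positive measure the factor \<open>1 - \<tau>\<close> creates
        the strict gap that convergence of the frequencies requires.\<close>
      proof (cases "measure \<nu> (\<kappa> k -` {B}) = 0")
        case False
        then have "(1 - \<tau>) * measure \<nu> (\<kappa> k -` {B}) < measure \<nu> (\<kappa> k -` {B})"
          using \<tau>(1) by (simp add: algebra_simps order_less_le)
        moreover have "(\<lambda>n. measure (\<mu> n) (\<kappa> k -` {B})) \<longlonglongrightarrow> measure \<nu> (\<kappa> k -` {B})"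
          using conv[of k B k B] by simp
        ultimately have "\<forall>\<^sub>F n in sequentially. (1 - \<tau>) * measure \<nu> (\<kappa> k -` {B}) < measure (\<mu> n) (\<kappa> k -` {B})"
          by (simp add: order_tendsto_iff)
        then show ?thesis by (rule eventually_mono) simp
      qed simp
    qed
    ultimately show ?thesis using osc[of k]
    proof eventually_elim
      case (elim n)
      have "(1 - \<tau>) * measure \<nu> (\<kappa> k -` {B}) \<le> measure (\<mu> n) (\<kappa> k -` {B})" for B
      proof (cases "B \<in> range (\<kappa> k)")
        case False
        then have "\<kappa> k -` {B} = {}" by auto
        then show ?thesis by simp
      qed (use elim in auto)
      moreover have "\<bar>a k n B - \<alpha> k B\<bar> \<le> \<tau>" if "B \<in> range (\<kappa> k)" for B using elim that by auto
      ultimately have "TL1_dist (\<mu> n, u n) (\<nu>, g) \<le> ennreal (r k + \<tau>) + ennreal D * emeasure \<nu> (E k) +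
         ennreal (D + 2 * M) * ennreal (1 - (1 - \<tau>)) + (\<integral>\<^sup>+x. ennreal \<bar>u n x - a k n (\<kappa> k x)\<bar> \<partial>\<mu> n) +
         (\<integral>\<^sup>+y. ennreal \<bar>\<alpha> k (\<kappa> k y) - g y\<bar> \<partial>\<nu>)"
        using \<tau> r(1)[of _ _ k] r(2)[of k] E(1)[of k]
        by (intro TL1_dist_le_partition[where \<Omega>=\<Omega>] pr s meas fin u g \<Omega> D a \<alpha>) auto
      also have "(\<integral>\<^sup>+y. ennreal \<bar>\<alpha> k (\<kappa> k y) - g y\<bar> \<partial>\<nu>) = (\<integral>\<^sup>+x. norm (g x - gk k x) \<partial>\<nu>)"
        by (simp add: gk_def abs_minus_commute)
      finally show ?case
        by (rule order_trans) (use elim in \<open>auto intro!: add_mono\<close>)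
    qed
  qed
  have "(\<lambda>n. TL1_dist (\<mu> n, u n) (\<nu>, g)) \<longlonglongrightarrow> 0"
  proof (rule order_tendstoI)
    fix c :: ennreal assume "0 < c"
    \<comment> \<open>The level is \<open>t i\<close> and the tolerance \<open>1 / (i + 2)\<close>,
      where the 2 keeps it below 1 as \<open>bound\<close> demands. All five terms vanish as
      \<open>i\<close> grows, so for a given \<open>c\<close> a single \<open>i\<close>
      suffices.\<close>
    define T where "T i = ennreal (r (t i) + 1 / real (i + 2)) + ennreal (D * measure \<nu> (E (t i))) +
        ennreal ((D + 2 * M) * (1 / real (i + 2))) +
      ennreal (\<delta> (t i)) + (\<integral>\<^sup>+x. norm (g x - gk (t i) x) \<partial>\<nu>)" for i
    have "T \<longlonglongrightarrow> ennreal (0 + 0) + ennreal (D * 0) + ennreal ((D + 2 * M) * 0) + ennreal 0 + 0"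
    proof -
      have 1: "(\<lambda>i. 1 / real (i + 2)) \<longlonglongrightarrow> 0"
        using LIMSEQ_ignore_initial_segment[OF lim_inverse_n', of 2] by simp
      note sub = LIMSEQ_subseq_LIMSEQ[OF _ t(1), unfolded o_def]
      show ?thesis unfolding T_def
        by (intro tendsto_add tendsto_ennrealI tendsto_mult tendsto_const 1 L1 sub r(3) E(2) \<delta>(2))
    qed
    then have "T \<longlonglongrightarrow> 0" by simp
    then have "\<forall>\<^sub>F i in sequentially. T i < c" using \<open>0 < c\<close> by (simp add: order_tendsto_iff)
    then obtain i where i: "T i < c" by (auto simp: eventually_sequentially)
    have e: "ennreal ((D + 2 * M) * (1 / real (i + 2))) = ennreal (D + 2 * M) * ennreal (1 / real (i + 2))"
      "ennreal (D * measure \<nu> (E (t i))) = ennreal D * emeasure \<nu> (E (t i))"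
      unfolding N.emeasure_eq_measure using D M0 by (intro ennreal_mult; simp)+
    have "\<forall>\<^sub>F n in sequentially. TL1_dist (\<mu> n, u n) (\<nu>, g) \<le> T i"
      unfolding T_def e by (rule bound) auto
    then show "\<forall>\<^sub>F n in sequentially. TL1_dist (\<mu> n, u n) (\<nu>, g) < c"
      by (rule eventually_mono) (use i in auto)
  qed auto
  then show ?thesis using g intg by blast
qed

text \<open>There are countably many pairs of a level and a cell, so one subsequence makes all the
  values \<open>a k n B\<close> converge; along it \<open>TL1_tendsto_of_partitions\<close>
  applies.\<close>

lemma TL1_relatively_compact_of_partitions:
  fixes \<mu> :: "nat \<Rightarrow> 'a::euclidean_space measure" and \<nu> :: "'a measure"
    and \<kappa> :: "nat \<Rightarrow> 'a \<Rightarrow> 'b" and a :: "nat \<Rightarrow> nat \<Rightarrow> 'b \<Rightarrow> real"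
  assumes pr: "\<And>n. prob_space (\<mu> n)" "prob_space \<nu>"
    and s: "\<And>n. sets (\<mu> n) = sets borel" "sets \<nu> = sets borel"
    and \<Omega>: "bounded \<Omega>" "\<And>n. AE x in \<mu> n. x \<in> \<Omega>" "AE x in \<nu>. x \<in> \<Omega>"
    and u: "\<And>n. u n \<in> borel_measurable borel" "\<And>n. integrable (\<mu> n) (u n)"
    and meas: "\<And>k B. \<kappa> k -` {B} \<in> sets borel" and fin: "\<And>k. finite (range (\<kappa> k))"
    and a: "\<And>k n B. \<bar>a k n B\<bar> \<le> M"
    and conv: "\<And>k l A B. (\<lambda>n. measure (\<mu> n) (\<kappa> k -` {A} \<inter> \<kappa> l -` {B})) \<longlonglongrightarrow> measure \<nu> (\<kappa> k -` {A} \<inter> \<kappa> l -` {B})"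
    and osc: "\<And>k. \<forall>\<^sub>F n in sequentially. (\<integral>\<^sup>+x. ennreal \<bar>u n x - a k n (\<kappa> k x)\<bar> \<partial>\<mu> n) \<le> ennreal (\<delta> k)"
    and \<delta>: "\<And>k. 0 \<le> \<delta> k" "\<delta> \<longlonglongrightarrow> 0"
    and E: "\<And>k. E k \<in> sets borel" "(\<lambda>k. measure \<nu> (E k)) \<longlonglongrightarrow> 0"
    and r: "\<And>k x y. x \<in> \<Omega> \<Longrightarrow> y \<in> \<Omega> \<Longrightarrow> \<kappa> k x = \<kappa> k y \<Longrightarrow> y \<notin> E k \<Longrightarrow> norm (x - y) \<le> r k"
      "\<And>k. 0 \<le> r k" "r \<longlonglongrightarrow> 0"
  shows "TL1_relatively_compact \<Omega> (\<lambda>n. (\<mu> n, u n))"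
  unfolding TL1_relatively_compact_def
proof (intro conjI allI impI)
  have cl: "AE x in m. x \<in> closure \<Omega>" if "AE x in m. x \<in> \<Omega>" for m :: "'a measure"
    using that by (rule eventually_mono) (use closure_subset in auto)
  show "(\<mu> n, u n) \<in> TL1 \<Omega>" for n
    using pr s u cl[OF \<Omega>(2)] by (auto simp: TL1_def)
  fix R :: "nat \<Rightarrow> nat" assume R: "strict_mono R"
  have M0: "0 \<le> M" using a[of 0 0 undefined] by linarith
  define I where "I = (SIGMA k:UNIV. range (\<kappa> k))"
  have "countable I" unfolding I_def by (rule countable_SIGMA) (auto intro: countable_finite fin)
  then obtain S where S1: "strict_mono S"
      "\<forall>i\<in>I. convergent (\<lambda>n. case i of (k, B) \<Rightarrow> a k (R (S n)) B)"
    using diagonal_convergent_subsequence[of I "\<lambda>n (k, B). a k (R n) B" M] a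
    by (auto simp: case_prod_unfold)
  have S: "strict_mono S" "\<And>k B. B \<in> range (\<kappa> k) \<Longrightarrow> convergent (\<lambda>n. a k (R (S n)) B)"
    using S1 by (auto simp: I_def)
  \<comment> \<open>The value 0 off the range keeps \<open>\<alpha>\<close> bounded by
    \<open>M\<close> at every argument.\<close>
  define \<alpha> where "\<alpha> k B = (if B \<in> range (\<kappa> k) then lim (\<lambda>n. a k (R (S n)) B) else 0)" for k B
  have lim: "(\<lambda>n. a k (R (S n)) B) \<longlonglongrightarrow> \<alpha> k B" if "B \<in> range (\<kappa> k)" for k B
    using S(2)[OF that] that by (simp add: \<alpha>_def convergent_LIMSEQ_iff)
  have \<alpha>M: "\<bar>\<alpha> k B\<bar> \<le> M" for k B
  proof (cases "B \<in> range (\<kappa> k)")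
    case True
    have "(\<lambda>n. \<bar>a k (R (S n)) B\<bar>) \<longlonglongrightarrow> \<bar>\<alpha> k B\<bar>" by (intro tendsto_rabs lim True)
    then show ?thesis by (rule tendsto_upperbound) (auto simp: a)
  qed (simp add: \<alpha>_def M0)
  have RS: "strict_mono (\<lambda>n. R (S n))" using strict_mono_o[OF R S(1)] by (simp add: o_def)
  have "\<exists>g. g \<in> borel_measurable borel \<and> integrable \<nu> g \<and>
      (\<lambda>n. TL1_dist (\<mu> (R (S n)), u (R (S n))) (\<nu>, g)) \<longlonglongrightarrow> 0"
  proof (rule TL1_tendsto_of_partitions[where \<Omega>=\<Omega> and a="\<lambda>k n. a k (R (S n))" and E=E and r=r])
    show "(\<lambda>n. measure (\<mu> (R (S n))) (\<kappa> k -` {A} \<inter> \<kappa> l -` {B})) \<longlonglongrightarrow> measure \<nu> (\<kappa> k -` {A} \<inter> \<kappa> l -` {B})"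
      for k l A B
      using LIMSEQ_subseq_LIMSEQ[OF conv RS] by (simp add: o_def)
    show "\<forall>\<^sub>F n in sequentially. (\<integral>\<^sup>+x. ennreal \<bar>u (R (S n)) x - a k (R (S n)) (\<kappa> k x)\<bar> \<partial>\<mu> (R (S n))) \<le> ennreal (\<delta> k)"
      for k using eventually_subseq[OF RS osc[of k]] .
  qed (fact pr s \<Omega> u meas fin a \<alpha>M lim \<delta> E r)+
  then obtain g where "integrable \<nu> g"
      "(\<lambda>n. TL1_dist (\<mu> (R (S n)), u (R (S n))) (\<nu>, g)) \<longlonglongrightarrow> 0" by blast
  then show "\<exists>s. strict_mono s \<and> (\<exists>w\<in>TL1 \<Omega>. (\<lambda>k. TL1_dist (\<mu> (R (s k)), u (R (s k))) w) \<longlonglongrightarrow> 0)"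
    using S(1) pr(2) s(2) cl[OF \<Omega>(3)] by (intro exI[of _ S] conjI bexI[of _ "(\<nu>, g)"]) (auto simp: TL1_def)
qed

section \<open>Empirical frequencies of independent samples\<close>

definition count_in :: "(nat \<Rightarrow> 'a) \<Rightarrow> nat \<Rightarrow> 'a set \<Rightarrow> real" where
  "count_in x n A = (\<Sum>i<n. indicator A (x i))"

text \<open>Both tails in one statement: \<open>s > 0\<close> bounds large counts,
  \<open>s < 0\<close> small ones. The moment generating function of the indicator is
  \<open>1 + (exp s - 1) * measure \<mu> A\<close>, at most the exponential of its second
  summand.\<close>

lemma (in prob_space) count_in_chernoff:
  fixes X :: "nat \<Rightarrow> 'a \<Rightarrow> 'b::euclidean_space" and s \<tau> :: real
  assumes ind: "indep_vars (\<lambda>_. borel) X UNIV" and \<mu>: "\<And>i. distr M borel (X i) = \<mu>"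
    and A[measurable]: "A \<in> sets borel"
  shows "measure M {\<omega>\<in>space M. s * \<tau> \<le> s * count_in (\<lambda>i. X i \<omega>) n A}
       \<le> exp (n * measure \<mu> A * (exp s - 1) - s * \<tau>)"
proof -
  have X[measurable]: "X i \<in> borel_measurable M" for i using ind by (auto simp: indep_vars_def)
  have pr: "prob_space \<mu>" unfolding \<mu>[of 0, symmetric] by (rule prob_space_distr) simp
  interpret m: prob_space \<mu> by fact
  have s\<mu>[measurable_cong]: "sets \<mu> = sets borel" using \<mu>[of 0] by auto
  define f where "f x = ennreal (exp (s * indicator A x))" for x :: 'b
  have f[measurable]: "f \<in> borel_measurable borel" unfolding f_def by measurable
  have fp: "(\<integral>\<^sup>+x. f x \<partial>\<mu>) \<le> ennreal (exp (measure \<mu> A * (exp s - 1)))"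
  proof -
    have "(\<integral>\<^sup>+x. f x \<partial>\<mu>) = (\<integral>\<^sup>+x. ennreal (1 + (exp s - 1) * indicator A x) \<partial>\<mu>)"
      unfolding f_def by (intro nn_integral_cong) (auto simp: indicator_def)
    also have "\<dots> = ennreal (\<integral>x. 1 + (exp s - 1) * indicator A x \<partial>\<mu>)"
    proof (rule nn_integral_eq_integral)
      show "integrable \<mu> (\<lambda>x. 1 + (exp s - 1) * indicator A x)"
        by (auto simp: s\<mu> m.emeasure_eq_measure)
    qed (auto simp: indicator_def)
    also have "(\<integral>x. 1 + (exp s - 1) * indicator A x \<partial>\<mu>) = 1 + (exp s - 1) * measure \<mu> A"
      by (subst Bochner_Integration.integral_add) (auto simp: s\<mu> m.prob_space m.emeasure_eq_measure)
    also have "\<dots> \<le> exp (measure \<mu> A * (exp s - 1))"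
      using exp_ge_add_one_self[of "measure \<mu> A * (exp s - 1)"] by (simp add: mult.commute)
    finally show ?thesis by (simp add: ennreal_leI)
  qed
  have "ennreal (measure M {\<omega>\<in>space M. s * \<tau> \<le> s * count_in (\<lambda>i. X i \<omega>) n A})
      = emeasure M {\<omega>\<in>space M. s * \<tau> \<le> s * count_in (\<lambda>i. X i \<omega>) n A}"
    by (simp add: emeasure_eq_measure)
  also have "\<dots> \<le> ennreal (exp (- 1 * (s * \<tau>))) *
      nn_integral M (\<lambda>\<omega>. ennreal (exp (1 * (s * count_in (\<lambda>i. X i \<omega>) n A))) * indicator (space M) \<omega>)"
    by (rule Chernoff_ineq_nn_integral_ge) (auto simp: count_in_def)
  also have "nn_integral M (\<lambda>\<omega>. ennreal (exp (1 * (s * count_in (\<lambda>i. X i \<omega>) n A))) * indicator (space M) \<omega>)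
      = (\<integral>\<^sup>+\<omega>. (\<Prod>i<n. f (X i \<omega>)) \<partial>M)"
  proof (intro nn_integral_cong)
    fix \<omega> assume "\<omega> \<in> space M"
    moreover have "exp (1 * (s * count_in (\<lambda>i. X i \<omega>) n A)) = (\<Prod>i<n. exp (s * indicator A (X i \<omega>)))"
      by (simp only: count_in_def mult_1_left sum_distrib_left exp_sum finite_lessThan)
    then have "ennreal (exp (1 * (s * count_in (\<lambda>i. X i \<omega>) n A))) = (\<Prod>i<n. f (X i \<omega>))"
      unfolding f_def by (simp only: prod_ennreal exp_ge_zero)
    ultimately show "ennreal (exp (1 * (s * count_in (\<lambda>i. X i \<omega>) n A))) * indicator (space M) \<omega> = (\<Prod>i<n. f (X i \<omega>))"
      by simp
  qed
  also have "\<dots> = (\<Prod>i<n. \<integral>\<^sup>+\<omega>. f (X i \<omega>) \<partial>M)"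
  proof (rule indep_vars_nn_integral)
    show "indep_vars (\<lambda>_. borel) (\<lambda>i \<omega>. f (X i \<omega>)) {..<n}"
      using indep_vars_compose2[OF indep_vars_subset[OF ind, of "{..<n}"], of "\<lambda>_. f" "\<lambda>_. borel"] by simp
  qed auto
  also have "\<dots> = (\<Prod>i<n. \<integral>\<^sup>+x. f x \<partial>\<mu>)"
  proof (intro prod.cong refl)
    show "(\<integral>\<^sup>+\<omega>. f (X i \<omega>) \<partial>M) = (\<integral>\<^sup>+x. f x \<partial>\<mu>)" for i
      unfolding \<mu>[of i, symmetric] by (rule nn_integral_distr[symmetric]) auto
  qed
  also have "ennreal (exp (- 1 * (s * \<tau>))) * \<dots> \<le> ennreal (exp (- 1 * (s * \<tau>))) * (\<Prod>i<n. ennreal (exp (measure \<mu> A * (exp s - 1))))"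
    by (intro mult_left_mono prod_mono_ennreal) (auto intro: fp)
  also have "\<dots> = ennreal (exp (n * measure \<mu> A * (exp s - 1) - s * \<tau>))"
  proof -
    have "(\<Prod>i<n. ennreal (exp (measure \<mu> A * (exp s - 1)))) = ennreal (exp (n * (measure \<mu> A * (exp s - 1))))"
      by (simp add: ennreal_power exp_of_nat_mult)
    moreover have "exp (- 1 * (s * \<tau>)) * exp (n * (measure \<mu> A * (exp s - 1)))
        = exp (n * measure \<mu> A * (exp s - 1) - s * \<tau>)"
      unfolding mult_exp_exp by (simp add: mult.assoc)
    ultimately show ?thesis by (simp only: ennreal_mult[symmetric] exp_ge_zero)
  qed
  finally show ?thesis by simp
qed

text \<open>Union bound over \<open>Z n\<close>, then Borel-Cantelli. The sets may change with
  \<open>n\<close>, as the small cubes will.\<close>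

lemma (in prob_space) AE_eventually_count_in:
  fixes X :: "nat \<Rightarrow> 'a \<Rightarrow> 'b::euclidean_space"
  assumes ind: "indep_vars (\<lambda>_. borel) X UNIV" and \<mu>: "\<And>i. distr M borel (X i) = \<mu>"
    and fin: "\<And>n. finite (Z n)" and B[measurable]: "\<And>n z. z \<in> Z n \<Longrightarrow> B n z \<in> sets borel"
    and summ: "summable b" and b: "\<forall>\<^sub>F n in sequentially. (\<Sum>z\<in>Z n.
       exp (n * measure \<mu> (B n z) * (exp (s n) - 1) - s n * \<tau> n z)) \<le> b n"
  shows "AE \<omega> in M. \<forall>\<^sub>F n in sequentially. \<forall>z\<in>Z n. s n * count_in (\<lambda>i. X i \<omega>) n (B n z) < s n * \<tau> n z"
proof -
  have X[measurable]: "X i \<in> borel_measurable M" for i using ind by (auto simp: indep_vars_def)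
  define A where "A n = (\<Union>z\<in>Z n. {\<omega>\<in>space M. s n * \<tau> n z \<le> s n * count_in (\<lambda>i. X i \<omega>) n (B n z)})" for n
  have S: "{\<omega>\<in>space M. s n * \<tau> n z \<le> s n * count_in (\<lambda>i. X i \<omega>) n (B n z)} \<in> events" if "z \<in> Z n" for n z
    using B[OF that] unfolding count_in_def by measurable
  have "AE \<omega> in M. \<forall>\<^sub>F n in sequentially. \<omega> \<in> space M - A n"
  proof (rule borel_cantelli_AE1)
    show "A n \<in> events" for n unfolding A_def using fin S by auto
    have "measure M (A n) \<le> b n" if n: "(\<Sum>z\<in>Z n.
       exp (n * measure \<mu> (B n z) * (exp (s n) - 1) - s n * \<tau> n z)) \<le> b n" for n
    proof -
      have "measure M (A n) \<le> (\<Sum>z\<in>Z n. measure M {\<omega>\<in>space M. s n * \<tau> n z \<le> s n * count_in (\<lambda>i. X i \<omega>) n (B n z)})"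
        unfolding A_def using fin S by (intro finite_measure_subadditive_finite) auto
      also have "\<dots> \<le> (\<Sum>z\<in>Z n. exp (n * measure \<mu> (B n z) * (exp (s n) - 1) - s n * \<tau> n z))"
        by (intro sum_mono count_in_chernoff ind \<mu> B)
      finally show ?thesis using n by simp
    qed
    then have "\<forall>\<^sub>F n in sequentially. norm (measure M (A n)) \<le> b n"
      using b by (auto elim: eventually_mono)
    then show "summable (\<lambda>n. measure M (A n))" using summ by (rule summable_comparison_test_ev)
  qed (simp add: less_top[symmetric])
  then show ?thesis
  proof eventually_elim
    case (elim \<omega>)
    then show ?case by eventually_elim (auto simp: A_def not_le)
  qed
qed

lemma exp_le_quadratic:
  fixes s :: real
  assumes "\<bar>s\<bar> \<le> 1"
  shows "exp s - 1 \<le> s + s\<^sup>2"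
proof (cases "0 \<le> s")
  case True
  then show ?thesis using exp_bound[of s] assms by simp
next
  case False
  define t where "t = - s"
  have t: "0 < t" "t \<le> 1" using False assms by (auto simp: t_def)
  \<comment> \<open>The product equals \<open>1 + t ^ 3\<close>.\<close>
  have "1 \<le> (1 + t) * (1 - t + t\<^sup>2)"
    using t by (simp add: algebra_simps power2_eq_square)
  then have "1 / (1 + t) \<le> 1 - t + t\<^sup>2" using t by (simp add: field_simps)
  moreover have "exp s \<le> 1 / (1 + t)"
    using exp_ge_add_one_self[of t] t by (simp add: t_def exp_minus field_simps)
  ultimately show ?thesis by (simp add: t_def)
qed

text \<open>A strong law for one set by exponential tails: the exponent is at most
  \<open>n * (s\<^sup>2 - s * \<delta>)\<close>, which is negative for
  \<open>s = \<delta> / 2\<close>, so the tails are geometric. The lower tail is the same statement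
  for \<open>- s\<close> and \<open>- \<delta>\<close>.\<close>

lemma (in prob_space) AE_tendsto_frequency:
  fixes X :: "nat \<Rightarrow> 'a \<Rightarrow> 'b::euclidean_space"
  assumes ind: "indep_vars (\<lambda>_. borel) X UNIV" and \<mu>: "\<And>i. distr M borel (X i) = \<mu>"
    and A: "A \<in> sets borel"
  shows "AE \<omega> in M. (\<lambda>n. count_in (\<lambda>i. X i \<omega>) n A / n) \<longlonglongrightarrow> measure \<mu> A"
proof -
  define p where "p = measure \<mu> A"
  have "prob_space \<mu>" unfolding \<mu>[of 0, symmetric]
    by (rule prob_space_distr) (use ind in \<open>auto simp: indep_vars_def\<close>)
  then have p: "0 \<le> p" "p \<le> 1" by (auto simp: p_def prob_space.prob_le_1)
  have one: "AE \<omega> in M. \<forall>\<^sub>F n in sequentially. s * count_in (\<lambda>i. X i \<omega>) n A < s * (n * (p + \<delta>))"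
    if s: "\<bar>s\<bar> \<le> 1" "s\<^sup>2 < s * \<delta>" for s \<delta>
  proof -
    have "AE \<omega> in M. \<forall>\<^sub>F n in sequentially. \<forall>z\<in>{()}. s * count_in (\<lambda>i. X i \<omega>) n A < s * (n * (p + \<delta>))"
    proof (rule AE_eventually_count_in[OF ind \<mu>])
      show "summable (\<lambda>n. exp (s\<^sup>2 - s * \<delta>) ^ n)" using s by (intro summable_geometric) auto
      show "\<forall>\<^sub>F n in sequentially. (\<Sum>z\<in>{()}. exp (n * measure \<mu> A * (exp s - 1) - s * (n * (p + \<delta>))))
          \<le> exp (s\<^sup>2 - s * \<delta>) ^ n"
      proof (rule always_eventually, rule allI)
        fix n :: nat
        have "p * (exp s - 1) \<le> p * (s + s\<^sup>2)" using exp_le_quadratic[OF s(1)] p by (intro mult_left_mono)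
        also have "\<dots> \<le> s * p + s\<^sup>2" using p mult_right_mono[of p 1 "s\<^sup>2"] by (simp add: algebra_simps)
        finally have "n * (p * (exp s - 1)) \<le> n * (s * p + s\<^sup>2)" by (rule mult_left_mono) simp
        then have "n * p * (exp s - 1) - s * (n * (p + \<delta>)) \<le> n * (s\<^sup>2 - s * \<delta>)"
          by (simp add: algebra_simps)
        then show "(\<Sum>z\<in>{()}. exp (n * measure \<mu> A * (exp s - 1) - s * (n * (p + \<delta>)))) \<le> exp (s\<^sup>2 - s * \<delta>) ^ n"
          by (simp add: p_def[symmetric] exp_of_nat_mult[symmetric])
      qed
    qed (use A in auto)
    then show ?thesis by simp
  qed
  have "AE \<omega> in M. \<forall>j. \<forall>\<^sub>F n in sequentially. \<bar>count_in (\<lambda>i. X i \<omega>) n A / n - p\<bar> < 1 / Suc j"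
    unfolding AE_all_countable
  proof
    fix j
    define \<delta> s where "\<delta> = 1 / real (Suc j)" and "s = 1 / (2 * real (Suc j))"
    have "0 < s" "\<bar>s\<bar> \<le> 1" by (auto simp: s_def field_simps)
    moreover have "\<delta> = 2 * s" by (simp add: s_def \<delta>_def field_simps)
    ultimately have s: "\<bar>s\<bar> \<le> 1" "s\<^sup>2 < s * \<delta>" "0 < s" by (auto simp: power2_eq_square)
    have "AE \<omega> in M. \<forall>\<^sub>F n in sequentially. s * count_in (\<lambda>i. X i \<omega>) n A < s * (n * (p + \<delta>))"
      using s by (intro one) auto
    moreover have "AE \<omega> in M. \<forall>\<^sub>F n in sequentially. - s * count_in (\<lambda>i. X i \<omega>) n A < - s * (n * (p + - \<delta>))"
      using s by (intro one) auto
    ultimately show "AE \<omega> in M. \<forall>\<^sub>F n in sequentially. \<bar>count_in (\<lambda>i. X i \<omega>) n A / n - p\<bar> < 1 / Suc j"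
    proof eventually_elim
      case (elim \<omega>)
      then show ?case using eventually_gt_at_top[of 0]
      proof eventually_elim
        case (elim n)
        have "count_in (\<lambda>i. X i \<omega>) n A < n * (p + \<delta>)" "n * (p - \<delta>) < count_in (\<lambda>i. X i \<omega>) n A"
          using elim s(3) by auto
        then have "count_in (\<lambda>i. X i \<omega>) n A / n < p + \<delta>" "p - \<delta> < count_in (\<lambda>i. X i \<omega>) n A / n"
          using elim(3) by (auto simp: field_simps)
        then show ?case by (simp add: \<delta>_def abs_less_iff)
      qed
    qed
  qed
  then show ?thesis
  proof eventually_elim
    case (elim \<omega>)
    show ?case unfolding p_def[symmetric]
    proof (rule tendstoI)
      fix e :: real assume "e > 0"
      then obtain j where "1 / Suc j < e" using nat_approx_posE by blast
      then show "\<forall>\<^sub>F n in sequentially. dist (count_in (\<lambda>i. X i \<omega>) n A / n) p < e"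
        using spec[OF elim, of j] by (auto elim!: eventually_mono simp: dist_real_def)
    qed
  qed
qed

text \<open>Chernoff bounds with \<open>s = -1\<close> and \<open>s = 1\<close>, and a union bound over at most \<open>w n / c\<close> sets;
  the hypothesis on \<open>n / w n\<close> makes the failure probability at most \<open>n\<^sup>-\<^sup>2 / c\<close>.\<close>

lemma (in prob_space) AE_eventually_count_bounds:
  fixes X :: "nat \<Rightarrow> 'a \<Rightarrow> 'b::euclidean_space" and c C :: real
  assumes ind: "indep_vars (\<lambda>_. borel) X UNIV" and \<mu>: "\<And>i. distr M borel (X i) = \<mu>"
    and fin: "\<And>n. finite (Z n)" and B: "\<And>n z. z \<in> Z n \<Longrightarrow> B n z \<in> sets borel"
    and c: "0 < c" "c \<le> C" and w: "\<And>n. 0 < w n"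
    and p: "\<And>n z. z \<in> Z n \<Longrightarrow> c / w n \<le> measure \<mu> (B n z) \<and> measure \<mu> (B n z) \<le> C / w n"
    and card: "\<And>n. c * card (Z n) \<le> w n"
    and large: "\<forall>\<^sub>F n in sequentially. 12 / c * ln (real n) \<le> real n / w n"
  shows "AE \<omega> in M. \<forall>\<^sub>F n in sequentially. \<forall>z\<in>Z n.
     c / 4 * n / w n \<le> count_in (\<lambda>i. X i \<omega>) n (B n z) \<and> count_in (\<lambda>i. X i \<omega>) n (B n z) \<le> 3 * C * n / w n"
proof -
  \<comment> \<open>\<open>exp 1 - 1 \<le> 2\<close> against the threshold factor 3, and
    \<open>exp (- 1) - 1 \<le> - 1 / 2\<close> against \<open>c / 4\<close>, leave in both tails an
    exponent of at most \<open>- (c / 4 * n / w n)\<close>.\<close>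
  have e: "exp 1 \<le> (3::real)" using exp_le by simp
  have ei: "exp (- 1) \<le> 1 / (2::real)" using exp_ge_add_one_self[of "1::real"] by (simp add: exp_minus field_simps)
  have gen: "\<forall>\<^sub>F n in sequentially. (\<Sum>z\<in>Z n. exp (E n z)) \<le> 1 / c * (1 / real n ^ 2)"
    if E: "\<And>n z. z \<in> Z n \<Longrightarrow> E n z \<le> - (c / 4 * n / w n)" for E :: "nat \<Rightarrow> 'c \<Rightarrow> real"
    using large eventually_gt_at_top[of 0]
      eventually_ge_at_top[of "nat \<lceil>exp (c / 12)\<rceil>"]
  proof eventually_elim
    case (elim n)
    have n0: "0 < real n" using elim by simp
    \<comment> \<open>This threshold makes \<open>12 / c * ln n\<close> at least 1, hence
      \<open>w n \<le> n\<close>, which bounds the number of sets by \<open>n / c\<close>.\<close>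
    have "exp (c / 12) \<le> real n" using elim(3) by linarith
    then have "c / 12 \<le> ln (real n)" using n0 by (subst ln_ge_iff)
    then have "1 \<le> 12 / c * ln (real n)" using c by (simp add: field_simps)
    then have "1 \<le> real n / w n" using elim by linarith
    then have wn: "w n \<le> n" using w[of n] by (simp add: field_simps)
    have "(\<Sum>z\<in>Z n. exp (E n z)) \<le> (\<Sum>z\<in>Z n. exp (- (3 * ln (real n))))"
    proof (intro sum_mono)
      fix z assume z: "z \<in> Z n"
      have "c / 4 * (12 / c * ln (real n)) \<le> c / 4 * (real n / w n)"
        using elim(1) c by (intro mult_left_mono) auto
      then have "3 * ln (real n) \<le> c / 4 * n / w n" using c by simp
      then show "exp (E n z) \<le> exp (- (3 * ln (real n)))" using E[OF z] by simp
    qed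
    also have "\<dots> = card (Z n) * (1 / real n ^ 3)"
      using n0 by (simp add: exp_minus divide_inverse exp_of_nat_mult[of 3 "ln (real n)", simplified])
    also have "\<dots> \<le> n / c * (1 / real n ^ 3)"
      using card[of n] wn c by (intro mult_right_mono) (auto simp: field_simps)
    also have "\<dots> = 1 / c * (1 / real n ^ 2)"
      using n0 by (simp add: power3_eq_cube power2_eq_square)
    finally show ?case .
  qed
  have summ: "summable (\<lambda>n. 1 / c * (1 / real n ^ 2))"
    using inverse_power_summable[of 2, where 'a=real] by (intro summable_mult) (simp add: inverse_eq_divide)
  have "AE \<omega> in M. \<forall>\<^sub>F n in sequentially. \<forall>z\<in>Z n.
      - 1 * count_in (\<lambda>i. X i \<omega>) n (B n z) < - 1 * (c / 4 * n / w n)"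
  proof (rule AE_eventually_count_in[OF ind \<mu> fin B summ])
    show "\<forall>\<^sub>F n in sequentially. (\<Sum>z\<in>Z n. exp (n * measure \<mu> (B n z) * (exp (- 1) - 1) - - 1 * (c / 4 * n / w n)))
        \<le> 1 / c * (1 / real n ^ 2)"
    proof (rule gen)
      fix n z assume z: "z \<in> Z n"
      have "n * measure \<mu> (B n z) * (exp (- 1) - 1) \<le> n * measure \<mu> (B n z) * (- (1 / 2))"
        using ei by (intro mult_left_mono) auto
      also have "\<dots> \<le> n * (c / w n) * (- (1 / 2))"
        using p[OF z] by (intro mult_right_mono_neg mult_left_mono) auto
      finally show "n * measure \<mu> (B n z) * (exp (- 1) - 1) - - 1 * (c / 4 * n / w n) \<le> - (c / 4 * n / w n)"
        by (simp add: field_simps)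
    qed
  qed
  moreover have "AE \<omega> in M. \<forall>\<^sub>F n in sequentially. \<forall>z\<in>Z n.
      1 * count_in (\<lambda>i. X i \<omega>) n (B n z) < 1 * (3 * C * n / w n)"
  proof (rule AE_eventually_count_in[OF ind \<mu> fin B summ])
    show "\<forall>\<^sub>F n in sequentially. (\<Sum>z\<in>Z n. exp (n * measure \<mu> (B n z) * (exp 1 - 1) - 1 * (3 * C * n / w n)))
        \<le> 1 / c * (1 / real n ^ 2)"
    proof (rule gen)
      fix n z assume z: "z \<in> Z n"
      have "n * measure \<mu> (B n z) * (exp 1 - 1) \<le> n * (C / w n) * 2"
        using e p[OF z] w[of n] c by (intro mult_mono mult_left_mono) auto
      then have "n * measure \<mu> (B n z) * (exp 1 - 1) - 1 * (3 * C * n / w n) \<le> - (C * n / w n)"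
        by (simp add: field_simps)
      also have "\<dots> \<le> - (c / 4 * n / w n)"
        using c w[of n] mult_right_mono[of "c / 4" C "n / w n"] by simp
      finally show "n * measure \<mu> (B n z) * (exp 1 - 1) - 1 * (3 * C * n / w n) \<le> - (c / 4 * n / w n)" .
    qed
  qed
  ultimately show ?thesis
  proof eventually_elim
    case (elim \<omega>)
    then show ?case by eventually_elim (auto intro: less_imp_le)
  qed
qed

section \<open>Regular samples\<close>

lemma sets_empirical_measure [simp, measurable_cong]: "sets (empirical_measure x n) = sets borel"
  by (simp add: empirical_measure_def)

lemma AE_uniform_count:
  fixes n :: nat
  shows "(AE i in uniform_count_measure {..<n}. P i) \<longleftrightarrow> (\<forall>i<n. P i)"
  unfolding uniform_count_measure_def AE_point_measure by auto
lemma measurable_uniform_count [simp]: "x \<in> uniform_count_measure {..<n} \<rightarrow>\<^sub>M borel"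
  by (auto simp: measurable_def sets_uniform_count_measure space_uniform_count_measure)
text \<open>Every sample point carries positive mass, so an almost sure property holds at each of
  them.\<close>

lemma AE_empirical_measureD: 
  assumes "AE y in empirical_measure x n. P y" "i < n" shows "P (x i)"
  using AE_distrD[OF measurable_uniform_count assms(1)[unfolded empirical_measure_def]] assms(2)
  by (simp add: AE_uniform_count)

lemma AE_empirical_measureI:
  "{y. P y} \<in> sets borel \<Longrightarrow> (\<And>i. i < n \<Longrightarrow> P (x i)) \<Longrightarrow> AE y in empirical_measure x n. P y"
  unfolding empirical_measure_def by (subst AE_distr_iff) (auto simp: AE_uniform_count)
lemma nn_integral_empirical_measure:
  assumes "1 \<le> n" and f: "f \<in> borel_measurable borel" "\<And>y. 0 \<le> f y"
  shows "(\<integral>\<^sup>+y. ennreal (f y) \<partial>empirical_measure x n) = ennreal ((\<Sum>i<n. f (x i)) / n)"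
proof -
  have "(\<integral>\<^sup>+y. ennreal (f y) \<partial>empirical_measure x n) = (\<integral>\<^sup>+i. ennreal (f (x i)) \<partial>uniform_count_measure {..<n})"
    unfolding empirical_measure_def using f by (subst nn_integral_distr) auto
  also have "\<dots> = (\<Sum>i<n. ennreal (1 / n) * ennreal (f (x i)))"
    by (simp add: uniform_count_measure_def nn_integral_point_measure_finite)
  also have "\<dots> = ennreal (\<Sum>i<n. 1 / n * f (x i))"
    using f by (simp add: ennreal_mult[symmetric])
  finally show ?thesis by (simp add: sum_divide_distrib)
qed
lemma measure_empirical_measure:
  assumes "1 \<le> n" "A \<in> sets borel"
  shows "measure (empirical_measure x n) A = count_in x n A / n"
proof -
  have "0 \<le> (\<Sum>i<n. indicator A (x i) :: real)" by (intro sum_nonneg) auto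
  then show ?thesis unfolding measure_def emeasure_empirical_measure[OF assms] count_in_def
    by (subst enn2real_ennreal) auto
qed
lemma prob_space_empirical_measure: "1 \<le> n \<Longrightarrow> prob_space (empirical_measure x n)"
  unfolding empirical_measure_def
  by (intro prob_space.prob_space_distr prob_space_uniform_count_measure) (auto simp: lessThan_empty_iff)
lemma real_card_cube_points: "real (card (cube_points x n k z)) = count_in x n (dyadic_cube k z)"
proof -
  have "count_in x n (dyadic_cube k z) = (\<Sum>i<n. if x i \<in> dyadic_cube k z then 1 else 0)"
    unfolding count_in_def by (intro sum.cong) (auto simp: indicator_def)
  also have "\<dots> = card ({..<n} \<inter> {i. x i \<in> dyadic_cube k z})" by (simp add: sum.If_cases)
  finally show ?thesis by (simp add: cube_points_def Int_def)
qed

text \<open>With the value 0 on the boundary cell, each point there contributes at most the bound of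
  \<open>u\<close> to the error. For a cube without points the quotient is 0 as well, so that bound
  holds for every cell.\<close>

definition cell_mean :: "(nat \<Rightarrow> 'a::euclidean_space) \<Rightarrow> nat \<Rightarrow> nat \<Rightarrow> ('a \<Rightarrow> real) \<Rightarrow> ('a \<Rightarrow> int) option \<Rightarrow> real" where
  "cell_mean x n k u B = (case B of None \<Rightarrow> 0
     | Some z \<Rightarrow> (\<Sum>j\<in>cube_points x n k z. u (x j)) / card (cube_points x n k z))"

lemma abs_cell_mean_le:
  assumes "\<And>i. i < n \<Longrightarrow> \<bar>u (x i)\<bar> \<le> M" "0 \<le> M"
  shows "\<bar>cell_mean x n k u B\<bar> \<le> M"
proof (cases B)
  case (Some z)
  let ?I = "cube_points x n k z"
  have "\<bar>\<Sum>j\<in>?I. u (x j)\<bar> \<le> (\<Sum>j\<in>?I. M)"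
    using assms by (intro order_trans[OF sum_abs] sum_mono) (auto simp: cube_points_def)
  then have "\<bar>\<Sum>j\<in>?I. u (x j)\<bar> \<le> card ?I * M" by simp
  then show ?thesis using assms(2)
    by (cases "card ?I = 0") (auto simp: cell_mean_def Some abs_divide field_simps)
qed (simp add: cell_mean_def assms)

lemma sum_cell_mean_dev:
  fixes x :: "nat \<Rightarrow> 'a::euclidean_space"
  assumes fin: "finite (inner_cubes \<Omega> k)" and uM: "\<And>i. i < n \<Longrightarrow> \<bar>u (x i)\<bar> \<le> M"
  shows "(\<Sum>i<n. \<bar>u (x i) - cell_mean x n k u (dyadic_cell \<Omega> k (x i))\<bar>)
     \<le> (\<Sum>z\<in>inner_cubes \<Omega> k. \<Sum>i\<in>cube_points x n k z.
          \<bar>u (x i) - (\<Sum>j\<in>cube_points x n k z. u (x j)) / card (cube_points x n k z)\<bar>)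
       + M * count_in x n (dyadic_cell \<Omega> k -` {None})"
proof -
  let ?f = "\<lambda>i. \<bar>u (x i) - cell_mean x n k u (dyadic_cell \<Omega> k (x i))\<bar>"
  let ?J = "\<Union>z\<in>inner_cubes \<Omega> k. cube_points x n k z"
  have J: "?J = {i\<in>{..<n}. dyadic_cell \<Omega> k (x i) \<noteq> None}"
    by (auto simp: cube_points_def dyadic_cell_def dyadic_cube_def)
  have "(\<Sum>i<n. ?f i) = (\<Sum>i\<in>?J. ?f i) + (\<Sum>i\<in>{..<n} - ?J. ?f i)"
    by (subst add.commute, rule sum.subset_diff) (auto simp: J)
  also have "(\<Sum>i\<in>?J. ?f i) = (\<Sum>z\<in>inner_cubes \<Omega> k. \<Sum>i\<in>cube_points x n k z. ?f i)"
    using fin by (intro sum.UNION_disjoint) (auto simp: cube_points_def dyadic_cube_def)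
  also have "\<dots> = (\<Sum>z\<in>inner_cubes \<Omega> k. \<Sum>i\<in>cube_points x n k z.
          \<bar>u (x i) - (\<Sum>j\<in>cube_points x n k z. u (x j)) / card (cube_points x n k z)\<bar>)"
    by (intro sum.cong refl) (auto simp: cell_mean_def cube_points_def dyadic_cell_def dyadic_cube_def)
  also have "(\<Sum>i\<in>{..<n} - ?J. ?f i) \<le> (\<Sum>i\<in>{..<n} - ?J. M * indicator (dyadic_cell \<Omega> k -` {None}) (x i))"
    unfolding J by (intro sum_mono) (auto simp: cell_mean_def intro: uM)
  also have "\<dots> = (\<Sum>i<n. M * indicator (dyadic_cell \<Omega> k -` {None}) (x i))"
    by (intro sum.mono_neutral_left) (auto simp: J indicator_def)
  also have "\<dots> = M * count_in x n (dyadic_cell \<Omega> k -` {None})"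
    by (simp only: count_in_def sum_distrib_left)
  finally show ?thesis by simp
qed

lemma GMS_nonneg:
  assumes "admissible_zeta \<zeta>" "\<And>t. 0 \<le> t \<Longrightarrow> 0 \<le> \<eta> t" "0 < e"
  shows "0 \<le> GMS p q \<zeta> \<eta> x e n u"
  unfolding GMS_def rescaled_kernel_def
  using assms by (intro mult_nonneg_nonneg sum_nonneg) (auto simp: admissible_zeta_def)

lemma Linf_norm_empirical_bound:
  assumes "i < n"
  shows "ereal \<bar>u (x i)\<bar> \<le> Linf_norm (empirical_measure x n) u"
  unfolding Linf_norm_def by (rule AE_empirical_measureD[OF esssup_AE assms])

text \<open>The deterministic half: what is random enters only through \<open>x\<close>,
  \<open>freq\<close> and \<open>cnt\<close>, none of which mentions \<open>u\<close>.\<close>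

lemma relatively_compact_of_regular_sample:
  fixes \<Omega> :: "'a::euclidean_space set" and x :: "nat \<Rightarrow> 'a" and c \<beta> \<alpha> :: real
  assumes \<Omega>: "bounded \<Omega>" "open \<Omega>" and p: "1 \<le> p" and q: "0 \<le> q" and \<zeta>: "admissible_zeta \<zeta>"
    and \<eta>: "\<And>t. 0 \<le> t \<Longrightarrow> 0 \<le> \<eta> t" "antimono_on {0..} \<eta>" and r: "0 < r" "0 < \<eta> r"
    and \<epsilon>: "\<And>n. 1 \<le> n \<Longrightarrow> 0 < \<epsilon> n"
    and \<mu>: "prob_space \<mu>" "sets \<mu> = sets borel" "AE y in \<mu>. y \<in> \<Omega>"
    and x: "\<And>i. x i \<in> \<Omega>"
    and freq: "\<And>k l A B. (\<lambda>n. count_in x n (dyadic_cell \<Omega> k -` {A} \<inter> dyadic_cell \<Omega> l -` {B}) / n)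
       \<longlonglongrightarrow> measure \<mu> (dyadic_cell \<Omega> k -` {A} \<inter> dyadic_cell \<Omega> l -` {B})"
    and m: "\<forall>\<^sub>F n in sequentially. 2 * real DIM('a) \<le> r * \<epsilon> n * 2 ^ m n \<and> r * \<epsilon> n * 2 ^ m n \<le> 4 * real DIM('a)"
      "filterlim m at_top sequentially"
    and \<alpha>: "0 < \<alpha>" and cnt: "\<forall>\<^sub>F n in sequentially. \<forall>z\<in>inner_cubes \<Omega> (m n).
       \<alpha> * n / (2 ^ m n) ^ DIM('a) \<le> count_in x n (dyadic_cube (m n) z) \<and>
       count_in x n (dyadic_cube (m n) z) \<le> \<beta> * n / (2 ^ m n) ^ DIM('a)"
    and c: "0 < c" "\<And>k. c * card (inner_cubes \<Omega> k) \<le> (2 ^ k) ^ DIM('a)"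
    and u: "\<And>n. 1 \<le> n \<Longrightarrow> u n \<in> Linf (empirical_measure x n)"
    and sup: "(SUP n\<in>{1..}. Linf_norm (empirical_measure x n) (u n) + ereal (GMS p q \<zeta> \<eta> x (\<epsilon> n) n (u n))) < \<infinity>"
  shows "TL1_relatively_compact \<Omega> (\<lambda>n. (empirical_measure x (Suc n), u (Suc n)))"
proof -
  interpret m: prob_space \<mu> by fact
  have um: "u n \<in> borel_measurable borel" if "1 \<le> n" for n
    using u[OF that] by (simp add: Linf_def empirical_measure_def)
  obtain R where R: "\<And>n. 1 \<le> n \<Longrightarrow> Linf_norm (empirical_measure x n) (u n) + ereal (GMS p q \<zeta> \<eta> x (\<epsilon> n) n (u n)) \<le> ereal R"
  proof -
    let ?S = "SUP n\<in>{1..}. Linf_norm (empirical_measure x n) (u n) + ereal (GMS p q \<zeta> \<eta> x (\<epsilon> n) n (u n))"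
    obtain R where "?S \<le> ereal R" using sup by (cases ?S) auto
    then show ?thesis using that[of R] by (auto simp: SUP_le_iff)
  qed
  have G0: "0 \<le> GMS p q \<zeta> \<eta> x (\<epsilon> n) n (u n)" if "1 \<le> n" for n
    using GMS_nonneg[OF \<zeta> \<eta>(1) \<epsilon>[OF that]] .
  have bd: "\<bar>u n (x i)\<bar> \<le> R" if "1 \<le> n" "i < n" for n i
  proof -
    have "ereal \<bar>u n (x i)\<bar> \<le> Linf_norm (empirical_measure x n) (u n)"
      by (rule Linf_norm_empirical_bound[OF that(2)])
    also have "\<dots> \<le> Linf_norm (empirical_measure x n) (u n) + ereal (GMS p q \<zeta> \<eta> x (\<epsilon> n) n (u n))"
      using G0[OF that(1)] by (simp add: ereal_le_add_self)
    also have "\<dots> \<le> ereal R" by (rule R[OF that(1)])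
    finally show ?thesis by simp
  qed
  have GR: "GMS p q \<zeta> \<eta> x (\<epsilon> n) n (u n) \<le> R" if "1 \<le> n" for n
  proof -
    \<comment> \<open>The extended-real sum bounds its second term once the first is nonnegative; a
      sample point shows this for the essential supremum.\<close>
    have "0 \<le> ereal \<bar>u n (x 0)\<bar>" by simp
    also have "\<dots> \<le> Linf_norm (empirical_measure x n) (u n)"
      by (rule Linf_norm_empirical_bound) (use that in auto)
    finally have "ereal (GMS p q \<zeta> \<eta> x (\<epsilon> n) n (u n)) \<le> Linf_norm (empirical_measure x n) (u n) + ereal (GMS p q \<zeta> \<eta> x (\<epsilon> n) n (u n))"
      by (simp add: ereal_le_add_self2)
    also have "\<dots> \<le> ereal R" by (rule R[OF that])
    finally show ?thesis by simp
  qed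
  \<comment> \<open>Positive, since \<open>1 / (2 * M)\<close> occurs in
    \<open>oscillation_le_zeta\<close>.\<close>
  define M where "M = max R 1"
  have M: "0 < M" and uM: "\<And>n i. 1 \<le> n \<Longrightarrow> i < n \<Longrightarrow> \<bar>u n (x i)\<bar> \<le> M"
    using bd by (auto simp: M_def intro!: max.coboundedI1)
  have R0: "0 \<le> R" using bd[of 1 0] by force
  define E where "E k = dyadic_cell \<Omega> k -` {None}" for k
  have sE: "E k \<in> sets borel" for k unfolding E_def by (rule sets_vimage_dyadic_cell[OF \<Omega>(1)])
  \<comment> \<open>Every point of the open set lies in an inner cube at all fine levels; dominated
    convergence does the rest.\<close>
  have E0: "(\<lambda>k. measure \<mu> (E k)) \<longlonglongrightarrow> 0"
  proof -
    have "(\<lambda>k. \<integral>y. indicator (E k) y \<partial>\<mu>) \<longlonglongrightarrow> (\<integral>y. 0 \<partial>\<mu> :: real)"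
    proof (rule integral_dominated_convergence[where w="\<lambda>_. 1"])
      show "AE y in \<mu>. (\<lambda>k. indicator (E k) y :: real) \<longlonglongrightarrow> 0"
        using \<mu>(3)
      proof eventually_elim
        case (elim y)
        have "\<forall>\<^sub>F k in sequentially. indicator (E k) y = (0::real)"
          using eventually_dyadic_cell_neq_None[OF \<Omega>(2) elim] by eventually_elim (auto simp: E_def)
        then show ?case by (rule tendsto_eventually)
      qed
    qed (use sE \<mu>(2) in \<open>auto simp: indicator_def intro!: borel_measurable_indicator\<close>)
    then show ?thesis using sE \<mu>(2) by simp
  qed
  define L Cst where "L = 4 * real DIM('a) / r"
    and "Cst = (\<beta> / \<alpha>)\<^sup>2 * real (DIM('a) + 1) / \<alpha> * (3 ^ DIM('a) * \<beta>\<^sup>2 / c * L +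
      1 / (\<zeta> 1 * min (r powr - q) (1 / (2 * M))) * R / \<eta> r * L ^ (DIM('a) + 1))"
  have Cst: "0 \<le> Cst"
    unfolding Cst_def L_def using \<alpha> c r R0 M admissible_zeta_lower(1)[OF \<zeta>]
    by (intro mult_nonneg_nonneg divide_nonneg_nonneg add_nonneg_nonneg) auto
  \<comment> \<open>The first term is the oscillation in the inner cubes, the second the boundary
    cell, whose frequency eventually exceeds its limit by less than
    \<open>1 / 2 ^ k\<close>.\<close>
  define \<delta> where "\<delta> k = Cst / 2 ^ k + M * (measure \<mu> (E k) + 1 / 2 ^ k)" for k :: nat
  have half: "(\<lambda>k. 1 / 2 ^ k :: real) \<longlonglongrightarrow> 0"
    using LIMSEQ_power_zero[of "1 / 2 :: real"] by (simp add: power_divide)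
  have osc: "\<forall>\<^sub>F n in sequentially. (\<integral>\<^sup>+y. ennreal \<bar>u (Suc n) y - cell_mean x (Suc n) k (u (Suc n)) (dyadic_cell \<Omega> k y)\<bar>
      \<partial>empirical_measure x (Suc n)) \<le> ennreal (\<delta> k)" for k
  proof -
    have "(\<lambda>n. count_in x n (E k) / n) \<longlonglongrightarrow> measure \<mu> (E k)"
      using freq[of k None k None] by (simp add: E_def)
    then have "\<forall>\<^sub>F n in sequentially. count_in x n (E k) / n < measure \<mu> (E k) + 1 / 2 ^ k"
      by (rule order_tendstoD) simp
    moreover have "\<forall>\<^sub>F n in sequentially. k \<le> m n" using m(2) by (simp add: filterlim_at_top)
    ultimately have "\<forall>\<^sub>F n in sequentially. (\<integral>\<^sup>+y. ennreal \<bar>u n y - cell_mean x n k (u n) (dyadic_cell \<Omega> k y)\<bar>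
      \<partial>empirical_measure x n) \<le> ennreal (\<delta> k)"
      using m(1) cnt eventually_ge_at_top[of 1]
    proof eventually_elim
      case (elim n)
      have n: "1 \<le> n" using elim by simp
      have "(\<Sum>i<n. \<bar>u n (x i) - cell_mean x n k (u n) (dyadic_cell \<Omega> k (x i))\<bar>)
        \<le> (\<Sum>z\<in>inner_cubes \<Omega> k. \<Sum>i\<in>cube_points x n k z.
          \<bar>u n (x i) - (\<Sum>j\<in>cube_points x n k z. u n (x j)) / card (cube_points x n k z)\<bar>)
          + M * count_in x n (E k)"
        unfolding E_def by (rule sum_cell_mean_dev[OF finite_inner_cubes[OF \<Omega>(1)]]) (rule uM[OF n])
      also have "\<dots> \<le> n * (Cst / 2 ^ k) + M * (n * (measure \<mu> (E k) + 1 / 2 ^ k))"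
      proof (intro add_mono mult_left_mono)
        show "(\<Sum>z\<in>inner_cubes \<Omega> k. \<Sum>i\<in>cube_points x n k z.
          \<bar>u n (x i) - (\<Sum>j\<in>cube_points x n k z. u n (x j)) / card (cube_points x n k z)\<bar>) \<le> n * (Cst / 2 ^ k)"
          unfolding Cst_def L_def
          by (rule mean_oscillation_le[where \<Omega>=\<Omega> and m="m n" and e="\<epsilon> n",
                OF \<zeta> p q \<eta> r \<epsilon>[OF n] M R0 uM[OF n] n GR[OF n] _ _ _ \<alpha> _ finite_inner_cubes[OF \<Omega>(1)] c])
            (use elim in \<open>auto simp: real_card_cube_points\<close>)
        show "count_in x n (E k) \<le> n * (measure \<mu> (E k) + 1 / 2 ^ k)"
          using elim(1) n by (simp add: field_simps)
      qed (use M in auto)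
      also have "\<dots> = n * \<delta> k" by (simp add: \<delta>_def algebra_simps)
      finally have *: "(\<Sum>i<n. \<bar>u n (x i) - cell_mean x n k (u n) (dyadic_cell \<Omega> k (x i))\<bar>) / n \<le> \<delta> k"
        using n by (simp add: field_simps)
      have [measurable]: "(\<lambda>y. cell_mean x n k (u n) (dyadic_cell \<Omega> k y)) \<in> borel_measurable borel"
        by (intro borel_measurable_finite_range sets_vimage_dyadic_cell finite_range_dyadic_cell \<Omega>)
      note um[OF n, measurable]
      show ?case using * n by (subst nn_integral_empirical_measure) (auto intro: ennreal_leI)
    qed
    \<comment> \<open>The empirical measures are probabilities only from \<open>n = 1\<close> on,
      hence the shift to \<open>Suc n\<close>.\<close>
    then show ?thesis by (rule eventually_compose_filterlim[OF _ filterlim_Suc])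
  qed
  show ?thesis
  proof (rule TL1_relatively_compact_of_partitions[where \<Omega>=\<Omega> and \<nu>=\<mu> and \<kappa>="dyadic_cell \<Omega>" and E=E
        and a="\<lambda>k n. cell_mean x (Suc n) k (u (Suc n))" and M=M and \<delta>=\<delta> and r="\<lambda>k. real DIM('a) / 2 ^ k"])
    show "prob_space (empirical_measure x (Suc n))" for n by (rule prob_space_empirical_measure) simp
    show "AE y in empirical_measure x (Suc n). y \<in> \<Omega>" for n
      using x \<Omega>(2) by (intro AE_empirical_measureI) auto
    show "integrable (empirical_measure x (Suc n)) (u (Suc n))" for n
    proof -
      interpret prob_space "empirical_measure x (Suc n)" by (rule prob_space_empirical_measure) simp
      note um[of "Suc n", measurable]
      show ?thesis
        by (rule integrable_const_bound[of _ M]) (auto intro!: AE_empirical_measureI uM)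
    qed
    show "\<bar>cell_mean x (Suc n) k (u (Suc n)) B\<bar> \<le> M" for k n B
      using M by (intro abs_cell_mean_le uM) auto
    show "(\<lambda>n. measure (empirical_measure x (Suc n)) (dyadic_cell \<Omega> k -` {A} \<inter> dyadic_cell \<Omega> l -` {B}))
        \<longlonglongrightarrow> measure \<mu> (dyadic_cell \<Omega> k -` {A} \<inter> dyadic_cell \<Omega> l -` {B})" for k l A B
      using LIMSEQ_Suc[OF freq[of k A l B]] sets_vimage_dyadic_cell[OF \<Omega>(1)]
      by (subst measure_empirical_measure) auto
    show "0 \<le> \<delta> k" for k using Cst M by (simp add: \<delta>_def)
    show "\<delta> \<longlonglongrightarrow> 0"
    proof -
      have "(\<lambda>k. Cst * (1 / 2 ^ k) + M * (measure \<mu> (E k) + 1 / 2 ^ k)) \<longlonglongrightarrow> Cst * 0 + M * (0 + 0)"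
        by (intro tendsto_intros half E0)
      then show ?thesis by (simp add: \<delta>_def[abs_def])
    qed
    show "norm (y - y') \<le> real DIM('a) / 2 ^ k"
      if "dyadic_cell \<Omega> k y = dyadic_cell \<Omega> k y'" "y' \<notin> E k" for k y y'
      using that by (intro norm_le_of_same_index) (auto simp: E_def dyadic_cell_def split: if_splits)
    show "(\<lambda>k. real DIM('a) / 2 ^ k) \<longlonglongrightarrow> 0"
      using tendsto_mult[OF tendsto_const[of "real DIM('a)"] half] by simp
  qed (use \<mu> \<Omega> um sE E0 osc in \<open>auto simp: sets_vimage_dyadic_cell finite_range_dyadic_cell\<close>)
qed

section \<open>Choice of the scale and application to random samples\<close>

lemma ex_dyadic_scale:
  fixes y :: real
  assumes "1 \<le> y"
  shows "\<exists>m::nat. y \<le> 2 ^ m \<and> 2 ^ m \<le> 2 * y"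
proof -
  define m where "m = (LEAST m::nat. y \<le> 2 ^ m)"
  have "\<exists>m::nat. y \<le> 2 ^ m" using real_arch_pow[of 2 y] by (auto intro: less_imp_le)
  then have m: "y \<le> 2 ^ m" unfolding m_def by (rule LeastI_ex)
  have "2 ^ m \<le> 2 * y"
  proof (cases m)
    case (Suc k)
    have "\<not> y \<le> 2 ^ k" using not_less_Least[of k "\<lambda>m. y \<le> 2 ^ m"] Suc by (simp add: m_def[symmetric])
    then show ?thesis by (simp add: Suc)
  qed (use assms in simp)
  then show ?thesis using m by blast
qed

lemma powr_inverse_power:
  fixes x :: real
  assumes "0 \<le> x" "1 \<le> d"
  shows "(x powr (1 / real d)) ^ d = x"
proof (cases "x = 0")
  case False
  then have "(x powr (1 / real d)) ^ d = x powr (1 / real d * real d)"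
    using assms by (simp add: powr_realpow[symmetric] powr_powr)
  then show ?thesis using assms False by simp
qed (use assms in auto)

text \<open>The ratio in \<open>lim\<close> is eventually below
  \<open>t = (1 / A) powr (1 / d)\<close>; raising this to the power \<open>d\<close> gives the
  claim, which is the form needed for the union bound.\<close>

lemma eventually_ln_le:
  fixes \<epsilon> :: "nat \<Rightarrow> real"
  assumes d: "1 \<le> d" and \<epsilon>: "\<And>n. 1 \<le> n \<Longrightarrow> 0 < \<epsilon> n"
    and lim: "(\<lambda>n. ln (real n) powr (1 / real d) / (\<epsilon> n * real n powr (1 / real d))) \<longlonglongrightarrow> 0"
    and A: "0 < A"
  shows "\<forall>\<^sub>F n in sequentially. A * ln (real n) \<le> n * \<epsilon> n ^ d"
proof -
  define t where "t = (1 / A) powr (1 / real d)"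
  have t: "0 < t" "t ^ d = 1 / A" using A d by (auto simp: t_def powr_inverse_power)
  have "\<forall>\<^sub>F n in sequentially. ln (real n) powr (1 / real d) / (\<epsilon> n * real n powr (1 / real d)) < t"
    using order_tendstoD(2)[OF lim t(1)] .
  then show ?thesis using eventually_ge_at_top[of 1]
  proof eventually_elim
    case (elim n)
    have "ln (real n) powr (1 / real d) \<le> t * (\<epsilon> n * real n powr (1 / real d))"
      using elim \<epsilon>[OF elim(2)] by (simp add: field_simps)
    then have "(ln (real n) powr (1 / real d)) ^ d \<le> (t * (\<epsilon> n * real n powr (1 / real d))) ^ d"
      by (rule power_mono) simp
    moreover have "(ln (real n) powr (1 / real d)) ^ d = ln (real n)" "(real n powr (1 / real d)) ^ d = n"
      using elim d by (auto intro: powr_inverse_power)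
    ultimately have "ln (real n) \<le> 1 / A * (\<epsilon> n ^ d * n)" by (simp only: power_mult_distrib t)
    then show ?case using A by (simp add: field_simps)
  qed
qed

theorem theorem2p3:
  fixes \<Omega> :: "'a::euclidean_space set"
    and p q c C :: real
    and \<rho> :: "'a \<Rightarrow> real"
    and \<zeta> \<eta> :: "real \<Rightarrow> real"
    and P :: "'w measure"
    and X :: "nat \<Rightarrow> 'w \<Rightarrow> 'a"
    and \<epsilon> :: "nat \<Rightarrow> real"
  assumes "DIM('a) \<ge> 2" and "p \<ge> 1" and "0 \<le> q" and "q < p"
    and "bounded \<Omega>" and "open \<Omega>" and "lipschitz_boundary \<Omega>"
    and "C1_on \<Omega> \<rho>" and "continuous_on (closure \<Omega>) \<rho>"
    and "0 < c" and "\<And>x. x \<in> closure \<Omega> \<Longrightarrow> c \<le> \<rho> x \<and> \<rho> x \<le> C"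
    and "(\<integral>\<^sup>+x\<in>\<Omega>. ennreal (\<rho> x) \<partial>lborel) = 1"
    and "admissible_zeta \<zeta>" and "admissible_kernel DIM('a) p q \<eta>"
    and "prob_space P"
    and "prob_space.indep_vars P (\<lambda>_. borel) X UNIV"
    and "\<And>i. distributed P lborel (X i) (\<lambda>x. ennreal (\<rho> x) * indicator \<Omega> x)"
    and "\<And>n. n \<ge> 1 \<Longrightarrow> \<epsilon> n > 0" and "\<epsilon> \<longlonglongrightarrow> 0"
    and "(\<lambda>n. ln (real n) powr (1 / real DIM('a)) /
              (\<epsilon> n * real n powr (1 / real DIM('a)))) \<longlonglongrightarrow> 0"
  shows "AE \<omega> in P. \<forall>u :: nat \<Rightarrow> 'a \<Rightarrow> real.
    (\<forall>n\<ge>1. u n \<in> Linf (empirical_measure (\<lambda>i. X i \<omega>) n)) \<longrightarrow>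
    (SUP n\<in>{1..}. Linf_norm (empirical_measure (\<lambda>i. X i \<omega>) n) (u n)
                  + ereal (GMS p q \<zeta> \<eta> (\<lambda>i. X i \<omega>) (\<epsilon> n) n (u n))) < \<infinity> \<longrightarrow>
    TL1_relatively_compact \<Omega>
      (\<lambda>k. (empirical_measure (\<lambda>i. X i \<omega>) (Suc k), u (Suc k)))"
proof -
  interpret prob_space P by fact
  note c = \<open>0 < c\<close> and \<epsilon> = assms(18) and \<Omega> = \<open>bounded \<Omega>\<close> \<open>open \<Omega>\<close>
  obtain r where r: "0 < r" "0 < \<eta> r" using admissible_kernel_pos[OF assms(14)] .
  have \<eta>: "\<And>t. 0 \<le> t \<Longrightarrow> 0 \<le> \<eta> t" "antimono_on {0..} \<eta>"
    using assms(14) by (auto simp: admissible_kernel_def)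
  define \<mu> where "\<mu> = density lborel (\<lambda>x. ennreal (\<rho> x) * indicator \<Omega> x)"
  have s\<mu>: "sets \<mu> = sets borel" by (simp add: \<mu>_def)
  have f[measurable]: "(\<lambda>x. ennreal (\<rho> x) * indicator \<Omega> x) \<in> borel_measurable lborel"
    using assms(17)[of 0] by (simp add: distributed_def)
  have X[measurable]: "X i \<in> borel_measurable P" for i
    using assms(17)[of i] by (simp add: distributed_def)
  have law: "distr P borel (X i) = \<mu>" for i
  proof -
    have "distr P borel (X i) = distr P lborel (X i)" by (rule distr_cong) auto
    then show ?thesis using assms(17)[of i] by (simp add: distributed_def \<mu>_def)
  qed
  have pr\<mu>: "prob_space \<mu>" unfolding law[of 0, symmetric] by (rule prob_space_distr) simp
  interpret \<mu>: prob_space \<mu> by fact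
  have AE\<mu>: "AE x in \<mu>. x \<in> \<Omega>"
    unfolding \<mu>_def AE_density[OF f] by (auto simp: indicator_def)
  have cC: "c \<le> C"
  proof -
    have "\<Omega> \<noteq> {}" using assms(12) by auto
    then obtain y where "y \<in> \<Omega>" by blast
    then show ?thesis using assms(11)[of y] closure_subset[of \<Omega>] by force
  qed
  have cube: "c / (2 ^ k) ^ DIM('a) \<le> measure \<mu> (dyadic_cube k z) \<and> measure \<mu> (dyadic_cube k z) \<le> C / (2 ^ k) ^ DIM('a)"
    if z: "z \<in> inner_cubes \<Omega> k" for k z
  proof -
    have ze: "z \<in> extensional Basis" and sub: "dyadic_cube k z \<subseteq> \<Omega>" using z by (auto simp: inner_cubes_def)
    have em: "ennreal (measure \<mu> (dyadic_cube k z)) = (\<integral>\<^sup>+x. ennreal (\<rho> x) * indicator \<Omega> x * indicator (dyadic_cube k z) x \<partial>lborel)"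
      unfolding \<mu>.emeasure_eq_measure[symmetric] by (simp add: \<mu>_def emeasure_density)
    have const: "(\<integral>\<^sup>+x. ennreal b * indicator (dyadic_cube k z) x \<partial>lborel) = ennreal (b / (2 ^ k) ^ DIM('a))" if "0 \<le> b" for b
      using that by (subst nn_integral_cmult) (auto simp: emeasure_dyadic_cube[OF ze] power_divide simp flip: ennreal_mult)
    have \<rho>: "c \<le> \<rho> x \<and> \<rho> x \<le> C" if "x \<in> dyadic_cube k z" for x
      using that sub closure_subset[of \<Omega>] by (intro assms(11)) auto
    have "ennreal (c / (2 ^ k) ^ DIM('a)) \<le> ennreal (measure \<mu> (dyadic_cube k z))"
      unfolding em const[OF less_imp_le[OF c], symmetric] using sub \<rho>
      by (intro nn_integral_mono) (auto simp: indicator_def intro!: ennreal_leI)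
    moreover have "ennreal (measure \<mu> (dyadic_cube k z)) \<le> ennreal (C / (2 ^ k) ^ DIM('a))"
      unfolding em const[OF order_trans[OF less_imp_le[OF c] cC], symmetric] using sub \<rho>
      by (intro nn_integral_mono) (auto simp: indicator_def intro!: ennreal_leI)
    moreover have "0 \<le> C / (2 ^ k) ^ DIM('a)" using c cC by simp
    ultimately show ?thesis by (simp add: ennreal_le_iff)
  qed
  \<comment> \<open>Disjoint cubes of mass at least \<open>c / (2 ^ k) ^ d\<close> each have to fit
    into total mass 1.\<close>
  have card: "c * card (inner_cubes \<Omega> k) \<le> (2 ^ k) ^ DIM('a)" for k
  proof -
    have "c / (2 ^ k) ^ DIM('a) * card (inner_cubes \<Omega> k) = (\<Sum>z\<in>inner_cubes \<Omega> k. c / (2 ^ k) ^ DIM('a))" by simp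
    also have "\<dots> \<le> (\<Sum>z\<in>inner_cubes \<Omega> k. measure \<mu> (dyadic_cube k z))"
      using cube by (intro sum_mono) auto
    also have "\<dots> = measure \<mu> (\<Union>z\<in>inner_cubes \<Omega> k. dyadic_cube k z)"
      by (intro \<mu>.finite_measure_finite_Union[symmetric] finite_inner_cubes \<Omega>)
        (auto simp: s\<mu> disjoint_family_on_def dyadic_cube_def sets_dyadic_cube[unfolded dyadic_cube_def])
    also have "\<dots> \<le> 1" by (rule \<mu>.prob_le_1)
    finally show ?thesis by (simp add: field_simps)
  qed
  \<comment> \<open>The side \<open>1 / 2 ^ m\<close> is to be comparable to
    \<open>r * \<epsilon> n\<close>, so that adjacent cubes interact. The premise
    \<open>r * \<epsilon> n \<le> 2 * DIM('a)\<close>, true for large \<open>n\<close>, makes the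
    desired lower bound for \<open>2 ^ m\<close> at least 1.\<close>
  have "\<exists>m::nat. 0 < \<epsilon> n \<and> r * \<epsilon> n \<le> 2 * real DIM('a) \<longrightarrow>
      2 * real DIM('a) \<le> r * \<epsilon> n * 2 ^ m \<and> r * \<epsilon> n * 2 ^ m \<le> 4 * real DIM('a)" for n
  proof (cases "0 < \<epsilon> n \<and> r * \<epsilon> n \<le> 2 * real DIM('a)")
    case True
    then obtain m :: nat where "2 * real DIM('a) / (r * \<epsilon> n) \<le> 2 ^ m" "2 ^ m \<le> 2 * (2 * real DIM('a) / (r * \<epsilon> n))"
      using ex_dyadic_scale[of "2 * real DIM('a) / (r * \<epsilon> n)"] r by auto
    then show ?thesis using True r by (intro exI[of _ m]) (simp add: field_simps)
  qed auto
  then obtain m :: "nat \<Rightarrow> nat" where m: "\<And>n. 0 < \<epsilon> n \<Longrightarrow> r * \<epsilon> n \<le> 2 * real DIM('a) \<Longrightarrow>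
      2 * real DIM('a) \<le> r * \<epsilon> n * 2 ^ m n \<and> r * \<epsilon> n * 2 ^ m n \<le> 4 * real DIM('a)"
    by metis
  have small: "\<forall>\<^sub>F n in sequentially. 0 < \<epsilon> n \<and> r * \<epsilon> n < b" if "0 < b" for b
  proof -
    have "(\<lambda>n. r * \<epsilon> n) \<longlonglongrightarrow> r * 0" by (intro tendsto_intros assms(19))
    then have "\<forall>\<^sub>F n in sequentially. r * \<epsilon> n < b" using that by (intro order_tendstoD(2)) auto
    then show ?thesis using eventually_ge_at_top[of 1] by eventually_elim (use \<epsilon> in auto)
  qed
  have scale: "\<forall>\<^sub>F n in sequentially. 2 * real DIM('a) \<le> r * \<epsilon> n * 2 ^ m n \<and> r * \<epsilon> n * 2 ^ m n \<le> 4 * real DIM('a)"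
    using small[of "2 * real DIM('a)"] by (auto elim!: eventually_mono intro!: m)
  have mtop: "filterlim m at_top sequentially"
    unfolding filterlim_at_top
  proof
    fix k
    have "0 < 2 * real DIM('a) / 2 ^ k" by simp
    from small[OF this] scale show "\<forall>\<^sub>F n in sequentially. k \<le> m n"
    proof eventually_elim
      case (elim n)
      have "r * \<epsilon> n * 2 ^ k < 2 * real DIM('a)" using elim by (simp add: field_simps)
      also have "\<dots> \<le> r * \<epsilon> n * 2 ^ m n" using elim by simp
      finally have "(2::real) ^ k < 2 ^ m n" using r elim by simp
      then show ?case by simp
    qed
  qed
  define L where "L = 4 * real DIM('a) / r"
  have L: "0 < L" using r by (simp add: L_def)
  have large: "\<forall>\<^sub>F n in sequentially. 12 / c * ln (real n) \<le> real n / (2 ^ m n) ^ DIM('a)"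
  proof -
    \<comment> \<open>The factor \<open>L ^ d\<close> absorbs the loss in
      \<open>(2 ^ m n) ^ d \<le> (L / \<epsilon> n) ^ d\<close>.\<close>
    have "\<forall>\<^sub>F n in sequentially. 12 / c * L ^ DIM('a) * ln (real n) \<le> n * \<epsilon> n ^ DIM('a)"
      using assms(1) \<epsilon> assms(20) c L by (intro eventually_ln_le) auto
    then show ?thesis using scale small[OF zero_less_one]
    proof eventually_elim
      case (elim n)
      have "2 ^ m n \<le> L / \<epsilon> n" using elim r by (simp add: L_def field_simps)
      then have "(2 ^ m n) ^ DIM('a) \<le> (L / \<epsilon> n) ^ DIM('a)" by (intro power_mono) auto
      then have "n / (L / \<epsilon> n) ^ DIM('a) \<le> n / (2 ^ m n) ^ DIM('a)"
        using L elim by (intro divide_left_mono mult_pos_pos zero_less_power) auto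
      moreover have "12 / c * ln (real n) \<le> n / (L / \<epsilon> n) ^ DIM('a)"
        using elim L c by (simp add: power_divide field_simps)
      ultimately show ?case by simp
    qed
  qed
  have A1: "AE \<omega> in P. \<forall>i. X i \<omega> \<in> \<Omega>"
    unfolding AE_all_countable
  proof
    fix i
    show "AE \<omega> in P. X i \<omega> \<in> \<Omega>" 
      using AE\<mu> unfolding law[of i, symmetric] by (rule AE_distrD[OF X])
  qed
  have A2: "AE \<omega> in P. \<forall>\<^sub>F n in sequentially. \<forall>z\<in>inner_cubes \<Omega> (m n).
     c / 4 * n / (2 ^ m n) ^ DIM('a) \<le> count_in (\<lambda>i. X i \<omega>) n (dyadic_cube (m n) z) \<and>
     count_in (\<lambda>i. X i \<omega>) n (dyadic_cube (m n) z) \<le> 3 * C * n / (2 ^ m n) ^ DIM('a)"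
    by (rule AE_eventually_count_bounds[OF assms(16) law finite_inner_cubes[OF \<Omega>(1)] sets_dyadic_cube c cC _ cube card large])
      auto
  have sc: "dyadic_cell \<Omega> k -` {A} \<inter> dyadic_cell \<Omega> l -` {B} \<in> sets borel" for k l A B
    using sets_vimage_dyadic_cell[OF \<Omega>(1)] by auto
  \<comment> \<open>Finitely many cells per level leave countably many events; for any other label
    the preimage is empty and the limit trivial.\<close>
  have A3: "AE \<omega> in P. \<forall>k l. \<forall>A\<in>range (dyadic_cell \<Omega> k). \<forall>B\<in>range (dyadic_cell \<Omega> l).
     (\<lambda>n. count_in (\<lambda>i. X i \<omega>) n (dyadic_cell \<Omega> k -` {A} \<inter> dyadic_cell \<Omega> l -` {B}) / n)
       \<longlonglongrightarrow> measure \<mu> (dyadic_cell \<Omega> k -` {A} \<inter> dyadic_cell \<Omega> l -` {B})"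
    unfolding AE_all_countable
    by (intro allI AE_finite_allI finite_range_dyadic_cell \<Omega> AE_tendsto_frequency assms(16) law sc)
  \<comment> \<open>The null sets are fixed before any \<open>u\<close> is chosen.\<close>
  show ?thesis using A1 A2 A3
  proof eventually_elim
    case (elim \<omega>)
    have freq: "(\<lambda>n. count_in (\<lambda>i. X i \<omega>) n (dyadic_cell \<Omega> k -` {A} \<inter> dyadic_cell \<Omega> l -` {B}) / n)
       \<longlonglongrightarrow> measure \<mu> (dyadic_cell \<Omega> k -` {A} \<inter> dyadic_cell \<Omega> l -` {B})" for k l A B
    proof (cases "A \<in> range (dyadic_cell \<Omega> k) \<and> B \<in> range (dyadic_cell \<Omega> l)")
      case False
      then have e: "dyadic_cell \<Omega> k -` {A} \<inter> dyadic_cell \<Omega> l -` {B} = {}" by auto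
      show ?thesis unfolding e by (simp add: count_in_def)
    qed (use elim(3) in blast)
    show ?case
    proof (intro allI impI)
      fix u :: "nat \<Rightarrow> 'a \<Rightarrow> real"
      assume u: "\<forall>n\<ge>1. u n \<in> Linf (empirical_measure (\<lambda>i. X i \<omega>) n)"
        and S: "(SUP n\<in>{1..}. Linf_norm (empirical_measure (\<lambda>i. X i \<omega>) n) (u n)
                  + ereal (GMS p q \<zeta> \<eta> (\<lambda>i. X i \<omega>) (\<epsilon> n) n (u n))) < \<infinity>"
      show "TL1_relatively_compact \<Omega> (\<lambda>k. (empirical_measure (\<lambda>i. X i \<omega>) (Suc k), u (Suc k)))"
        by (rule relatively_compact_of_regular_sample[OF \<Omega> assms(2,3,13) \<eta> r \<epsilon> pr\<mu> s\<mu> AE\<mu> _ freq scale mtop _ elim(2) c card _ S])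
          (use elim(1) u c in auto)
    qed
  qed
qed

end
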